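(* For every $\varepsilon>0$, there is a polynomial time algorithm (an adaptation of the primal-dual algorithm with growing and reverse-delete pruning phases) that is a $(4+\varepsilon)$-approximation for the Non-Linear UFP-Cover problem with arbitrary non-decreasing cost functions given in the oracle model: it outputs a feasible $x$ of cost at most $(4+\varepsilon)$ times the optimum.
   Context: Non-Linear UFP-Cover problem: given $I=\{1,\dots,k\}$, a finite set $N$ of $n$ items, for each $i\in N$ a sub-interval $I_i\subseteq I$ and an arbitrary non-decreasing function $f_i:\{0,1,\dots,m\}\to\mathbb{Q}_{\ge0}\cup\{\infty\}$ ($m$ not necessarily polynomially bounded), and demands $D_t\in\mathbb{N}$ for $t\in I$; choose $x\in\{0,\dots,m\}^N$ with $\sum_{i:t\in I_i}x_i\ge D_t$ for all $t\in I$, minimizing $\sum_i f_i(x_i)$; the instance is assumed feasible. Oracle model: each $f_i$ is given by an oracle returning $f_i(x)$ for any queried $x$, and all values $f_i(x)$ are describable with a polynomial number of bits; polynomial time means polynomial in $n$, $k$, $\log m$, the bit lengths of the $D_t$ and of the function values. *)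

theory Defs
  imports
    "HOL-Library.Extended_Nonnegative_Real"
    "HOL-Library.FuncSet"
    "HOL-Library.Log_Nat"
    "HOL-Computational_Algebra.Polynomial"
begin

section \<open>Non-Linear UFP-Cover\<close>

text \<open>
  Items are \<open>{..<num_items}\<close>, and item \<open>i\<close> has the interval \<open>{left_end i..right_end i}\<close>.  A cost in
  \<open>\<rat>\<^sub>\<ge>\<^sub>0 \<union> {\<infinity>}\<close> is a \<^typ>\<open>rat option\<close>, where \<^const>\<open>None\<close> stands for \<open>\<infinity>\<close>.  Only the values of
  \<open>left_end\<close>, \<open>right_end\<close>, \<open>demand\<close> and \<open>cost_fun\<close> at items, time points in \<open>{1..horizon}\<close> and
  amounts in \<open>{..max_amount}\<close> are meaningful; neither the validity condition nor the input handed
  to an algorithm refers to any others.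
\<close>

record ufp_cover =
  horizon :: nat
  num_items :: nat
  max_amount :: nat
  left_end :: "nat \<Rightarrow> nat"
  right_end :: "nat \<Rightarrow> nat"
  demand :: "nat \<Rightarrow> nat"
  cost_fun :: "nat \<Rightarrow> nat \<Rightarrow> rat option"

definition cost_value :: "rat option \<Rightarrow> ennreal" where
  "cost_value v = (case v of None \<Rightarrow> \<infinity> | Some q \<Rightarrow> ennreal (of_rat q))"

text \<open>The condition on the end points admits empty intervals, in the form \<open>{r + 1..r}\<close>.\<close>

definition valid_ufp_cover :: "ufp_cover \<Rightarrow> bool" where
  "valid_ufp_cover P \<longleftrightarrow>
     (\<forall>i<num_items P. 1 \<le> left_end P i \<and> left_end P i \<le> right_end P i + 1 \<and>
        right_end P i \<le> horizon P) \<and>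
     (\<forall>i<num_items P. \<forall>x\<le>max_amount P. \<forall>q. cost_fun P i x = Some q \<longrightarrow> 0 \<le> q) \<and>
     (\<forall>i<num_items P. mono_on {..max_amount P} (\<lambda>x. cost_value (cost_fun P i x)))"

definition solutions :: "ufp_cover \<Rightarrow> (nat \<Rightarrow> nat) set" where
  "solutions P =
     {x \<in> {..<num_items P} \<rightarrow> {..max_amount P}.
        \<forall>t\<in>{1..horizon P}.
          demand P t \<le> (\<Sum>i | i < num_items P \<and> t \<in> {left_end P i..right_end P i}. x i)}"

definition total_cost :: "ufp_cover \<Rightarrow> (nat \<Rightarrow> nat) \<Rightarrow> ennreal" where
  "total_cost P x = (\<Sum>i<num_items P. cost_value (cost_fun P i (x i)))"

definition optimum :: "ufp_cover \<Rightarrow> ennreal" where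
  "optimum P = (INF x\<in>solutions P. total_cost P x)"


section \<open>Oracle algorithms with logarithmic cost\<close>

text \<open>
  Algorithms are programs of a While language over unbounded arrays of natural numbers, that is,
  structured programs of a random access machine with one additional instruction that consults an
  oracle.  Time is the logarithmic cost measure: every operation is charged one unit plus the bit
  lengths of its operands and of its result, addresses and oracle answers included.  Hence
  polynomial time agrees with polynomial time on (oracle) Turing machines.
\<close>

abbreviation bit_length :: "nat \<Rightarrow> nat" where
  "bit_length \<equiv> floorlog 2"

type_synonym state = "string \<Rightarrow> nat \<Rightarrow> nat"

datatype aexp =
    Const nat
  | Read string aexp
  | Plus aexp aexp
  | Minus aexp aexp
  | Times aexp aexp
  | Div aexp aexp
  | Mod aexp aexp

datatype bexp =
    Less aexp aexp
  | Equal aexp aexp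
  | Neg bexp
  | Conj bexp bexp

datatype com =
    Skip
  | Assign string aexp aexp
  | Query string aexp aexp
  | Seq com com
  | Cond bexp com com
  | While bexp com

fun aval :: "aexp \<Rightarrow> state \<Rightarrow> nat" where
  "aval (Const n) s = n"
| "aval (Read a e) s = s a (aval e s)"
| "aval (Plus e1 e2) s = aval e1 s + aval e2 s"
| "aval (Minus e1 e2) s = aval e1 s - aval e2 s"
| "aval (Times e1 e2) s = aval e1 s * aval e2 s"
| "aval (Div e1 e2) s = aval e1 s div aval e2 s"
| "aval (Mod e1 e2) s = aval e1 s mod aval e2 s"

fun bval :: "bexp \<Rightarrow> state \<Rightarrow> bool" where
  "bval (Less e1 e2) s \<longleftrightarrow> aval e1 s < aval e2 s"
| "bval (Equal e1 e2) s \<longleftrightarrow> aval e1 s = aval e2 s"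
| "bval (Neg b) s \<longleftrightarrow> \<not> bval b s"
| "bval (Conj b1 b2) s \<longleftrightarrow> bval b1 s \<and> bval b2 s"

text \<open>Each node is charged for its result; its operands are charged as the results of its children.\<close>

fun acost :: "aexp \<Rightarrow> state \<Rightarrow> nat" where
  "acost (Const n) s = 1 + bit_length n"
| "acost (Read a e) s = 1 + bit_length (aval (Read a e) s) + acost e s"
| "acost (Plus e1 e2) s = 1 + bit_length (aval (Plus e1 e2) s) + acost e1 s + acost e2 s"
| "acost (Minus e1 e2) s = 1 + bit_length (aval (Minus e1 e2) s) + acost e1 s + acost e2 s"
| "acost (Times e1 e2) s = 1 + bit_length (aval (Times e1 e2) s) + acost e1 s + acost e2 s"
| "acost (Div e1 e2) s = 1 + bit_length (aval (Div e1 e2) s) + acost e1 s + acost e2 s"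
| "acost (Mod e1 e2) s = 1 + bit_length (aval (Mod e1 e2) s) + acost e1 s + acost e2 s"

fun bcost :: "bexp \<Rightarrow> state \<Rightarrow> nat" where
  "bcost (Less e1 e2) s = 1 + acost e1 s + acost e2 s"
| "bcost (Equal e1 e2) s = 1 + acost e1 s + acost e2 s"
| "bcost (Neg b) s = 1 + bcost b s"
| "bcost (Conj b1 b2) s = 1 + bcost b1 s + bcost b2 s"

definition store :: "state \<Rightarrow> string \<Rightarrow> nat \<Rightarrow> nat \<Rightarrow> state" where
  "store s a j v = s(a := (s a)(j := v))"

text \<open>
  \<open>exec orc c s t s'\<close>: program \<open>c\<close> started in state \<open>s\<close> halts after time \<open>t\<close> in state \<open>s'\<close>.
  \<open>Query a e1 e2\<close> asks the oracle about the values of \<open>e1\<close> and \<open>e2\<close> and stores the two components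
  of the answer in cells \<open>0\<close> and \<open>1\<close> of array \<open>a\<close>; a query outside the domain of the oracle has no
  transition.
\<close>

inductive exec :: "(nat \<Rightarrow> nat \<Rightarrow> (nat \<times> nat) option) \<Rightarrow> com \<Rightarrow> state \<Rightarrow> nat \<Rightarrow> state \<Rightarrow> bool"
  for orc :: "nat \<Rightarrow> nat \<Rightarrow> (nat \<times> nat) option" where
  Skip: "exec orc Skip s 1 s"
| Assign: "exec orc (Assign a e1 e2) s (1 + acost e1 s + acost e2 s)
     (store s a (aval e1 s) (aval e2 s))"
| Query: "orc (aval e1 s) (aval e2 s) = Some (u, v) \<Longrightarrow>
     exec orc (Query a e1 e2) s (1 + acost e1 s + acost e2 s + bit_length u + bit_length v)
       (store (store s a 0 u) a 1 v)"
| Seq: "exec orc c1 s1 t1 s2 \<Longrightarrow> exec orc c2 s2 t2 s3 \<Longrightarrow>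
     exec orc (Seq c1 c2) s1 (1 + t1 + t2) s3"
| CondTrue: "bval b s \<Longrightarrow> exec orc c1 s t s' \<Longrightarrow> exec orc (Cond b c1 c2) s (1 + bcost b s + t) s'"
| CondFalse: "\<not> bval b s \<Longrightarrow> exec orc c2 s t s' \<Longrightarrow> exec orc (Cond b c1 c2) s (1 + bcost b s + t) s'"
| WhileFalse: "\<not> bval b s \<Longrightarrow> exec orc (While b c) s (1 + bcost b s) s"
| WhileTrue: "bval b s1 \<Longrightarrow> exec orc c s1 t1 s2 \<Longrightarrow> exec orc (While b c) s2 t2 s3 \<Longrightarrow>
     exec orc (While b c) s1 (1 + bcost b s1 + t1 + t2) s3"

lemma exec_deterministic:
  assumes "exec orc c s t s'" and "exec orc c s u s''"
  shows "t = u \<and> s' = s''"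
  using assms
proof (induction arbitrary: u s'' rule: exec.induct)
  case (Skip s)
  then show ?case by cases auto
next
  case (Assign a e1 e2 s)
  then show ?case by cases auto
next
  case (Query e1 s e2 v w a)
  from Query.prems Query.hyps show ?case by cases auto
next
  case (Seq c1 s1 t1 s2 c2 t2 s3)
  from Seq.prems obtain u1 s2' u2 where u: "u = 1 + u1 + u2"
    and run: "exec orc c1 s1 u1 s2'" "exec orc c2 s2' u2 s''"
    by cases auto
  from Seq.IH(1)[OF run(1)] run(2) have "exec orc c2 s2 u2 s''" by simp
  from Seq.IH(2)[OF this] Seq.IH(1)[OF run(1)] u show ?case by simp
next
  case (CondTrue b s c1 t s' c2)
  from CondTrue.prems CondTrue.hyps(1) obtain v
    where v: "u = 1 + bcost b s + v" and run: "exec orc c1 s v s''"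
    by cases auto
  from CondTrue.IH[OF run] v show ?case by simp
next
  case (CondFalse b s c2 t s' c1)
  from CondFalse.prems CondFalse.hyps(1) obtain v
    where v: "u = 1 + bcost b s + v" and run: "exec orc c2 s v s''"
    by cases auto
  from CondFalse.IH[OF run] v show ?case by simp
next
  case (WhileFalse b s c)
  from WhileFalse.prems WhileFalse.hyps show ?case by cases auto
next
  case (WhileTrue b s1 c t1 s2 t2 s3)
  from WhileTrue.prems WhileTrue.hyps(1) obtain u1 s2' u2 where u: "u = 1 + bcost b s1 + u1 + u2"
    and run: "exec orc c s1 u1 s2'" "exec orc (While b c) s2' u2 s''"
    by cases auto
  from WhileTrue.IH(1)[OF run(1)] run(2) have "exec orc (While b c) s2 u2 s''" by simp
  from WhileTrue.IH(2)[OF this] WhileTrue.IH(1)[OF run(1)] u show ?case by simp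
qed


section \<open>Algorithms for Non-Linear UFP-Cover\<close>

text \<open>Finite costs are given by reduced numerator and denominator, \<open>\<infinity>\<close> by the pair \<open>(1, 0)\<close>.\<close>

definition cost_code :: "rat option \<Rightarrow> nat \<times> nat" where
  "cost_code v = (case v of None \<Rightarrow> (1, 0)
     | Some q \<Rightarrow> (nat (fst (quotient_of q)), nat (snd (quotient_of q))))"

definition code_length :: "rat option \<Rightarrow> nat" where
  "code_length v = bit_length (fst (cost_code v)) + bit_length (snd (cost_code v))"

definition cost_oracle :: "ufp_cover \<Rightarrow> nat \<Rightarrow> nat \<Rightarrow> (nat \<times> nat) option" where
  "cost_oracle P i x =
     (if i < num_items P \<and> x \<le> max_amount P then Some (cost_code (cost_fun P i x)) else None)"

definition input_state :: "ufp_cover \<Rightarrow> state" where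
  "input_state P = (\<lambda>a j.
     if a = ''k'' \<and> j = 0 then horizon P
     else if a = ''n'' \<and> j = 0 then num_items P
     else if a = ''m'' \<and> j = 0 then max_amount P
     else if a = ''l'' \<and> j < num_items P then left_end P j
     else if a = ''r'' \<and> j < num_items P then right_end P j
     else if a = ''D'' \<and> j \<in> {1..horizon P} then demand P j
     else 0)"

definition output_of :: "state \<Rightarrow> nat \<Rightarrow> nat" where
  "output_of s = s ''x''"

text \<open>
  A bound that is polynomial in \<open>n\<close>, \<open>k\<close>, \<open>log m\<close> and the bit lengths of the demands and of the
  cost values is the same as a bound that is polynomial in this sum.  The end points of the
  intervals are at most \<open>k + 1\<close>.
\<close>

definition input_size :: "ufp_cover \<Rightarrow> nat" where
  "input_size P =
     num_items P + horizon P + bit_length (max_amount P)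
     + (\<Sum>t\<in>{1..horizon P}. bit_length (demand P t))
     + Max (insert 0 {code_length (cost_fun P i x) | i x. i < num_items P \<and> x \<le> max_amount P})"

definition polynomial_time :: "com \<Rightarrow> bool" where
  "polynomial_time c \<longleftrightarrow>
     (\<exists>p :: nat poly. \<forall>P. valid_ufp_cover P \<and> solutions P \<noteq> {} \<longrightarrow>
        (\<exists>t s. exec (cost_oracle P) c (input_state P) t s \<and> t \<le> poly p (input_size P)))"

definition approximation_algorithm :: "real \<Rightarrow> com \<Rightarrow> bool" where
  "approximation_algorithm \<alpha> c \<longleftrightarrow>
     (\<forall>P. valid_ufp_cover P \<and> solutions P \<noteq> {} \<longrightarrow>
        (\<exists>t s. exec (cost_oracle P) c (input_state P) t s \<and>
           output_of s \<in> solutions P \<and>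
           total_cost P (output_of s) \<le> ennreal \<alpha> * optimum P))"

end

theory Submission imports Defs begin

text \<open>
  Replace every cost function by a staircase with polynomially many steps: from amount \<open>x\<close> jump to
  the largest amount whose cost is at most \<open>1 + 1 / N\<close> times the cost of \<open>x + 1\<close>, found by
  bisection.  On the staircase instance run a local ratio algorithm.  At a time \<open>t\<close> of maximal
  shortfall \<open>\<Delta>\<close>, charge every possible raise of an item present at \<open>t\<close> in proportion to its gain
  truncated at \<open>\<Delta>\<close>, with the largest factor that keeps all prices non-negative; some raise becomes
  free and is committed.  At the end undo the commitments in reverse order whenever this preserves
  feasibility.  Every feasible raise pays for a gain of at least \<open>\<Delta>\<close>.  After pruning, every raised
  item has a witness time at which it is indispensable; all items with a witness to the left of
  \<open>t\<close> are present at the rightmost such witness, so without the item belonging to it their gain is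
  below the shortfall there, which is at most \<open>\<Delta>\<close>.  This gives \<open>2 * \<Delta>\<close> on each side and hence the
  factor 4.  Multiplying all prices by the denominator of the charging factor keeps them integral,
  and their bit length grows by at most that of a demand per step.
\<close>

section \<open>Raising amounts over a base vector\<close>

text \<open>An item may be committed several times, at ever higher levels, and the lower ones must
  not be paid again. So a price \<open>g i a\<close> always means the remaining price of holding
  \<open>a\<close> instead of the current base amount: committing to \<open>b\<close> makes
  \<open>b\<close> free, moves the base to \<open>b\<close> and leaves the prices above
  \<open>b\<close> valid for the new base. The ratio 4 is proved one commitment at a time, with
  irredundancy relative to the base of that moment; this is why pruning must run backwards. Prices
  are increases over amount 0: every solution pays at least the costs at 0, and they occur on both
  sides of the comparison. Amounts of infinite cost never enter the table. If growing finds no raise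
  at a time of shortfall, no solution has finite cost and any feasible vector is optimal. Each
  commitment uses up at least one table entry, which bounds both the running time and the number of
  rescalings. The program logic then needs a single word length that covers every stored
  number.\<close>

definition load :: "ufp_cover \<Rightarrow> (nat \<Rightarrow> nat) \<Rightarrow> nat \<Rightarrow> nat" where
  "load P x t = (\<Sum>i | i < num_items P \<and> t \<in> {left_end P i..right_end P i}. x i)"

definition feasible :: "ufp_cover \<Rightarrow> (nat \<Rightarrow> nat) \<Rightarrow> bool" where
  "feasible P x \<longleftrightarrow> (\<forall>t\<in>{1..horizon P}. demand P t \<le> load P x t)"

definition raises :: "ufp_cover \<Rightarrow> (nat \<Rightarrow> nat set) \<Rightarrow> (nat \<Rightarrow> nat) \<Rightarrow> (nat \<Rightarrow> nat) \<Rightarrow> bool" where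
  "raises P S X z \<longleftrightarrow> (\<forall>i<num_items P. z i = X i \<or> (X i < z i \<and> z i \<in> S i))"

definition raise_cost ::
    "ufp_cover \<Rightarrow> (nat \<Rightarrow> nat \<Rightarrow> nat) \<Rightarrow> (nat \<Rightarrow> nat) \<Rightarrow> (nat \<Rightarrow> nat) \<Rightarrow> nat" where
  "raise_cost P g X z = (\<Sum>i<num_items P. if X i < z i then g i (z i) else 0)"

definition irredundant :: "ufp_cover \<Rightarrow> (nat \<Rightarrow> nat) \<Rightarrow> (nat \<Rightarrow> nat) \<Rightarrow> bool" where
  "irredundant P X z \<longleftrightarrow> (\<forall>i<num_items P. X i < z i \<longrightarrow> \<not> feasible P (z(i := X i)))"

definition four_approx ::
    "ufp_cover \<Rightarrow> (nat \<Rightarrow> nat set) \<Rightarrow> (nat \<Rightarrow> nat \<Rightarrow> nat) \<Rightarrow> (nat \<Rightarrow> nat) \<Rightarrow> (nat \<Rightarrow> nat) \<Rightarrow> bool" where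
  "four_approx P S g X z \<longleftrightarrow> feasible P z \<and> raises P S X z \<and> irredundant P X z \<and>
     (\<forall>w. raises P S X w \<and> feasible P w \<longrightarrow> raise_cost P g X z \<le> 4 * raise_cost P g X w)"

section \<open>Truncated gains of irredundant raises\<close>

lemma load_mono: "(\<And>i. i < num_items P \<Longrightarrow> x i \<le> y i) \<Longrightarrow> load P x t \<le> load P y t"
  unfolding load_def by (rule sum_mono) auto

lemma feasible_mono:
  "feasible P x \<Longrightarrow> (\<And>i. i < num_items P \<Longrightarrow> x i \<le> y i) \<Longrightarrow> feasible P y"
  unfolding feasible_def using load_mono le_trans by meson

lemma raises_le: "raises P S X z \<Longrightarrow> i < num_items P \<Longrightarrow> X i \<le> z i"
  unfolding raises_def by (metis order.refl less_imp_le)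

text \<open>The demand at \<open>s\<close> is missed once \<open>j\<close> is reset, so all that the
  other items of \<open>B\<close> gain at \<open>s\<close> fits into the shortfall that
  \<open>X\<close> has there. The item \<open>j\<close> itself may gain arbitrarily much; truncation
  at \<Delta> is what bounds its share.\<close>

lemma one_sided_raise_bound:
  assumes le: "\<And>i. i < num_items P \<Longrightarrow> X i \<le> z i"
    and short: "\<forall>t\<in>{1..horizon P}. demand P t - load P X t \<le> \<Delta>"
    and B: "B \<subseteq> {..<num_items P}"
    and j: "j \<in> B" "s \<in> {1..horizon P}" "load P (z(j := X j)) s < demand P s"
    and pres: "\<And>i. i \<in> B \<Longrightarrow> s \<in> {left_end P i..right_end P i}"
  shows "(\<Sum>i\<in>B. min (z i - X i) \<Delta>) \<le> 2 * \<Delta>"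
proof -
  let ?T = "{i. i < num_items P \<and> s \<in> {left_end P i..right_end P i}}"
  have fin: "finite B" using B finite_subset by blast
  have sub: "B \<subseteq> ?T" using B pres by auto
  have jn: "j < num_items P" using B j by auto
  have "(\<Sum>i\<in>B - {j}. z i - X i) = (\<Sum>i\<in>B - {j}. (z(j := X j)) i - X i)"
    by (rule sum.cong) auto
  also have "\<dots> \<le> (\<Sum>i\<in>?T. (z(j := X j)) i - X i)"
    by (rule sum_mono2) (use sub in auto)
  also have "\<dots> = load P (z(j := X j)) s - load P X s"
    unfolding load_def by (rule sum_subtractf_nat) (use le in auto)
  also have "\<dots> \<le> \<Delta>" using short j by fastforce
  finally have 1: "(\<Sum>i\<in>B - {j}. z i - X i) \<le> \<Delta>" .
  have "(\<Sum>i\<in>B. min (z i - X i) \<Delta>) = min (z j - X j) \<Delta> + (\<Sum>i\<in>B - {j}. min (z i - X i) \<Delta>)"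
    using fin j by (simp add: sum.remove)
  also have "\<dots> \<le> \<Delta> + (\<Sum>i\<in>B - {j}. z i - X i)"
    by (intro add_mono sum_mono) auto
  finally show ?thesis using 1 by simp
qed

lemma irredundant_raise_bound:
  assumes le: "\<And>i. i < num_items P \<Longrightarrow> X i \<le> z i" and z: "feasible P z" and irr: "irredundant P X z"
    and short: "\<forall>t\<in>{1..horizon P}. demand P t - load P X t \<le> \<Delta>"
  shows "(\<Sum>i | i < num_items P \<and> t0 \<in> {left_end P i..right_end P i}. min (z i - X i) \<Delta>) \<le> 4 * \<Delta>"
proof -
  define B where "B = {i. i < num_items P \<and> t0 \<in> {left_end P i..right_end P i} \<and> X i < z i}"
  have fin: "finite B" unfolding B_def by auto
  have "\<forall>i\<in>B. \<exists>t. t \<in> {1..horizon P} \<and> load P (z(i := X i)) t < demand P t"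
    using irr unfolding irredundant_def feasible_def B_def by (fastforce simp: not_le)
  then obtain \<tau> where \<tau>: "\<And>i. i \<in> B \<Longrightarrow> \<tau> i \<in> {1..horizon P}"
    "\<And>i. i \<in> B \<Longrightarrow> load P (z(i := X i)) (\<tau> i) < demand P (\<tau> i)" by metis
  \<comment> \<open>Resetting an item changes loads only inside its interval, and \<open>z\<close>
    meets all demands, so the violated time lies in the interval.\<close>
  have cov: "\<tau> i \<in> {left_end P i..right_end P i}" if i: "i \<in> B" for i
  proof (rule ccontr)
    assume "\<not> ?thesis"
    then have "load P (z(i := X i)) (\<tau> i) = load P z (\<tau> i)"
      unfolding load_def by (intro sum.cong) auto
    then show False using z \<tau>[OF i] unfolding feasible_def by (metis not_le)
  qed
  \<comment> \<open>A member of \<open>?L\<close> is present at \<open>t0\<close> and at its own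
    witness, hence at all times between. The rightmost witness up to \<open>t0\<close> is such a
    time for all members at once. The other side is the mirror image.\<close>
  have left: "(\<Sum>i\<in>{i\<in>B. \<tau> i \<le> t0}. min (z i - X i) \<Delta>) \<le> 2 * \<Delta>" (is "sum _ ?L \<le> _")
  proof (cases "?L = {}")
    case True
    show ?thesis unfolding True by simp
  next
    case False
    have "Max (\<tau> ` ?L) \<in> \<tau> ` ?L" by (rule Max_in) (use fin False in auto)
    then obtain j where j: "j \<in> ?L" "Max (\<tau> ` ?L) = \<tau> j" by auto
    have mx: "\<tau> i \<le> \<tau> j" if "i \<in> ?L" for i using fin that unfolding j(2)[symmetric] by simp
    show ?thesis
    proof (rule one_sided_raise_bound[OF le short, of _ j "\<tau> j"])
      fix i assume i: "i \<in> ?L"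
      then show "\<tau> j \<in> {left_end P i..right_end P i}"
        using cov[of i] mx[OF i] j unfolding B_def by auto
    qed (use j \<tau>[of j] in \<open>auto simp: B_def\<close>)
  qed
  have right: "(\<Sum>i\<in>{i\<in>B. \<not> \<tau> i \<le> t0}. min (z i - X i) \<Delta>) \<le> 2 * \<Delta>" (is "sum _ ?R \<le> _")
  proof (cases "?R = {}")
    case True
    show ?thesis unfolding True by simp
  next
    case False
    have "Min (\<tau> ` ?R) \<in> \<tau> ` ?R" by (rule Min_in) (use fin False in auto)
    then obtain j where j: "j \<in> ?R" "Min (\<tau> ` ?R) = \<tau> j" by auto
    have mn: "\<tau> j \<le> \<tau> i" if "i \<in> ?R" for i using fin that unfolding j(2)[symmetric] by simp
    show ?thesis
    proof (rule one_sided_raise_bound[OF le short, of _ j "\<tau> j"])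
      fix i assume i: "i \<in> ?R"
      then show "\<tau> j \<in> {left_end P i..right_end P i}"
        using cov[of i] mn[OF i] j unfolding B_def by auto
    qed (use j \<tau>[of j] in \<open>auto simp: B_def\<close>)
  qed
  have "(\<Sum>i | i < num_items P \<and> t0 \<in> {left_end P i..right_end P i}. min (z i - X i) \<Delta>)
      = (\<Sum>i\<in>B. min (z i - X i) \<Delta>)"
    by (rule sum.mono_neutral_right) (auto simp: B_def)
  also have "\<dots> = (\<Sum>i\<in>?L. min (z i - X i) \<Delta>) + (\<Sum>i\<in>?R. min (z i - X i) \<Delta>)"
    using fin by (subst sum.union_disjoint[symmetric]) (auto intro!: sum.cong)
  finally show ?thesis using left right by simp
qed

text \<open>All prices are multiplied by \<open>q\<close>, also those of items absent at
  \<open>t0\<close>, so that the price vector keeps one common scale. In a growth step the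
  subtraction is exact on every candidate raise, because \<open>p / q\<close> is the least
  ratio.\<close>

definition price_step ::
    "ufp_cover \<Rightarrow> (nat \<Rightarrow> nat) \<Rightarrow> nat \<Rightarrow> nat \<Rightarrow> nat \<Rightarrow> nat \<Rightarrow> (nat \<Rightarrow> nat \<Rightarrow> nat) \<Rightarrow> nat \<Rightarrow> nat \<Rightarrow> nat" where
  "price_step P X t0 \<Delta> p q g i a =
     g i a * q - (if t0 \<in> {left_end P i..right_end P i} then p * min (a - X i) \<Delta> else 0)"

text \<open>
  One growing step: \<open>t0\<close> is a time of maximal shortfall \<open>\<Delta>\<close>, and raising item \<open>i\<close> to \<open>b\<close> has the
  least price \<open>p / q\<close> per useful unit there.  Prices are rescaled by \<open>q\<close> to stay integral.
\<close>

definition growth_step ::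
    "ufp_cover \<Rightarrow> (nat \<Rightarrow> nat set) \<Rightarrow> (nat \<Rightarrow> nat) \<Rightarrow> (nat \<Rightarrow> nat \<Rightarrow> nat) \<Rightarrow> nat \<Rightarrow> nat \<Rightarrow>
      (nat \<Rightarrow> nat \<Rightarrow> nat) \<Rightarrow> bool" where
  "growth_step P S X g i b g' \<longleftrightarrow>
     (\<exists>t0 \<Delta> p q. t0 \<in> {1..horizon P} \<and> 0 < \<Delta> \<and> \<Delta> = demand P t0 - load P X t0 \<and>
       (\<forall>t\<in>{1..horizon P}. demand P t - load P X t \<le> \<Delta>) \<and>
       i < num_items P \<and> t0 \<in> {left_end P i..right_end P i} \<and> b \<in> S i \<and> X i < b \<and>
       p = g i b \<and> q = min (b - X i) \<Delta> \<and>
       (\<forall>j a. j < num_items P \<and> t0 \<in> {left_end P j..right_end P j} \<and> a \<in> S j \<and> X j < a \<longrightarrow>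
          p * min (a - X j) \<Delta> \<le> g j a * q) \<and>
       g' = price_step P X t0 \<Delta> p q g)"

lemma four_approx_refl: "feasible P X \<Longrightarrow> four_approx P S g X X"
  unfolding four_approx_def raises_def irredundant_def raise_cost_def by auto

text \<open>
  The local ratio argument: on the prices removed in the step, every feasible raise pays at least
  \<open>p * \<Delta>\<close> and an irredundant one pays at most \<open>4 * p * \<Delta>\<close>.
\<close>

lemma growth_step_four_approx:
  assumes st: "growth_step P S X g i b g'"
    and ap: "four_approx P S g' (X(i := b)) z'"
    and z: "z = (if z' i = b \<and> feasible P (z'(i := X i)) then z'(i := X i) else z')"
  shows "four_approx P S g X z"
proof -
  let ?X = "X(i := b)" and ?n = "num_items P"
  obtain t0 \<Delta> p q where t0: "t0 \<in> {1..horizon P}" and \<Delta>0: "0 < \<Delta>"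
    and \<Delta>: "\<Delta> = demand P t0 - load P X t0"
    and short: "\<forall>t\<in>{1..horizon P}. demand P t - load P X t \<le> \<Delta>"
    and i: "i < ?n" "t0 \<in> {left_end P i..right_end P i}" "b \<in> S i" "X i < b"
    and p: "p = g i b" and q: "q = min (b - X i) \<Delta>"
    and best: "\<And>j a. \<lbrakk>j < ?n; t0 \<in> {left_end P j..right_end P j}; a \<in> S j; X j < a\<rbrakk> \<Longrightarrow>
          p * min (a - X j) \<Delta> \<le> g j a * q"
    and g': "g' = price_step P X t0 \<Delta> p q g"
    using st unfolding growth_step_def by metis
  have q0: "0 < q" using q i \<Delta>0 by auto
  have fz': "feasible P z'" and rz': "raises P S ?X z'" and irr': "irredundant P ?X z'"
    and cz': "\<And>w. raises P S ?X w \<Longrightarrow> feasible P w \<Longrightarrow>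
      raise_cost P g' ?X z' \<le> 4 * raise_cost P g' ?X w"
    using ap unfolding four_approx_def by auto
  have zle: "z j \<le> z' j" for j using z i by auto
  have fz: "feasible P z" using z fz' by auto
  have rz: "raises P S X z"
    unfolding raises_def
  proof (intro allI impI)
    fix j assume j: "j < ?n"
    show "z j = X j \<or> X j < z j \<and> z j \<in> S j"
      using rz' j i z unfolding raises_def by (cases "j = i") (auto dest: spec[of _ j])
  qed
  have irr: "irredundant P X z"
    unfolding irredundant_def
  proof (intro allI impI)
    fix j assume j: "j < ?n" "X j < z j"
    show "\<not> feasible P (z(j := X j))"
    proof (cases "j = i")
      case False
      then have "\<not> feasible P (z'(j := X j))"
        using irr' j zle[of j] unfolding irredundant_def by fastforce
      then show ?thesis by (rule contrapos_nn) (erule feasible_mono, simp add: zle)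
    next
      case True
      then have zz: "z = z'" using j z by (auto split: if_splits)
      show ?thesis
      proof (cases "z' i = b")
        case True
        then show ?thesis using zz z \<open>j = i\<close> i by (metis fun_upd_same less_irrefl)
      next
        case F: False
        \<comment> \<open>A raise of \<open>i\<close> beyond \<open>b\<close> survived. Resetting it
          to \<open>b\<close> already breaks feasibility, so resetting it to the smaller
          \<open>X i\<close> does too.\<close>
        then have "b < z' i" using rz' i unfolding raises_def by auto
        then have "\<not> feasible P (z'(i := b))" using irr' i unfolding irredundant_def by auto
        then show ?thesis
          unfolding True zz by (rule contrapos_nn) (erule feasible_mono, use i in simp)
      qed
    qed
  qed
  \<comment> \<open>The local ratio decomposition: the rescaled old price of a raise is its residual
    price plus \<open>p\<close> per unit of truncated gain at \<open>t0\<close>. Minimality of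
    \<open>p / q\<close> rules out truncation in the subtraction.\<close>
  have split: "q * raise_cost P g X w = raise_cost P g' X w
      + p * (\<Sum>j | j < ?n \<and> t0 \<in> {left_end P j..right_end P j}. min (w j - X j) \<Delta>)"
    if w: "raises P S X w" for w
  proof -
    have "q * raise_cost P g X w = (\<Sum>j<?n. if X j < w j then g j (w j) * q else 0)"
      unfolding raise_cost_def sum_distrib_left by (rule sum.cong) auto
    also have "\<dots> = (\<Sum>j<?n. (if X j < w j then g' j (w j) else 0)
        + (if t0 \<in> {left_end P j..right_end P j} then p * min (w j - X j) \<Delta> else 0))"
    proof (rule sum.cong)
      fix j assume "j \<in> {..<?n}"
      then show "(if X j < w j then g j (w j) * q else 0) = (if X j < w j then g' j (w j) else 0)
        + (if t0 \<in> {left_end P j..right_end P j} then p * min (w j - X j) \<Delta> else 0)"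
        using w best[of j "w j"] unfolding raises_def g' price_step_def by (auto dest: spec[of _ j])
    qed simp
    also have "\<dots> = raise_cost P g' X w
        + (\<Sum>j | j < ?n \<and> t0 \<in> {left_end P j..right_end P j}. p * min (w j - X j) \<Delta>)"
      unfolding raise_cost_def sum.distrib
      by (subst sum.inter_filter[symmetric]) (auto intro!: arg_cong2[of _ _ _ _ sum])
    finally show ?thesis by (simp add: sum_distrib_left)
  qed
  \<comment> \<open>As \<open>p\<close> is the price of this raise and \<open>q\<close> its
    truncated gain, both sides of the subtraction are \<open>p * q\<close>.\<close>
  have gib: "g' i b = 0" using g' i p q unfolding price_step_def by simp
  \<comment> \<open>The two sides can differ only at \<open>i\<close>, and only when
    \<open>z' i = b\<close>; there the free price of \<open>b\<close> makes both terms 0, whether or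
    not the raise is undone.\<close>
  have eq: "raise_cost P g' X z = raise_cost P g' ?X z'"
    unfolding raise_cost_def
  proof (rule sum.cong)
    fix j assume "j \<in> {..<?n}"
    then show "(if X j < z j then g' j (z j) else 0) = (if ?X j < z' j then g' j (z' j) else 0)"
      using rz' gib i z unfolding raises_def by (cases "j = i") (auto dest: spec[of _ j])
  qed simp
  have "raise_cost P g X z \<le> 4 * raise_cost P g X w" if w: "raises P S X w" "feasible P w" for w
  proof -
    \<comment> \<open>The assumption on \<open>z'\<close> compares only with raises over the base
      containing \<open>b\<close>, so \<open>w\<close> is lifted to at least \<open>b\<close> at
      \<open>i\<close>. Since \<open>b\<close> counts as base there, the lift adds no residual
      price.\<close>
    let ?w = "w(i := max (w i) b)"
    have rw: "raises P S ?X ?w"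
      using w(1) i unfolding raises_def by (auto simp: max_def)
    have fw: "feasible P ?w" using feasible_mono[OF w(2)] by auto
    have 1: "raise_cost P g' ?X ?w \<le> raise_cost P g' X w"
      unfolding raise_cost_def by (rule sum_mono) (use i in \<open>auto simp: max_def\<close>)
    \<comment> \<open>Either one item alone gains \<Delta>, or truncation changes nothing and the
      gains sum to the increase in load, which must close the shortfall.\<close>
    have 2: "\<Delta> \<le> (\<Sum>j | j < ?n \<and> t0 \<in> {left_end P j..right_end P j}. min (w j - X j) \<Delta>)"
    proof (cases "\<exists>j. j < ?n \<and> t0 \<in> {left_end P j..right_end P j} \<and> \<Delta> \<le> w j - X j")
      case True
      then obtain j where "j < ?n" "t0 \<in> {left_end P j..right_end P j}" "\<Delta> \<le> w j - X j" by blast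
      then show ?thesis
        using member_le_sum[of j "{j. j < ?n \<and> t0 \<in> {left_end P j..right_end P j}}"
            "\<lambda>j. min (w j - X j) \<Delta>"] by (simp add: min.absorb2)
    next
      case False
      have "\<Delta> \<le> load P w t0 - load P X t0"
        using w(2) t0 \<Delta> unfolding feasible_def by (auto intro: diff_le_mono)
      also have "\<dots> = (\<Sum>j | j < ?n \<and> t0 \<in> {left_end P j..right_end P j}. w j - X j)"
        unfolding load_def
        by (rule sum_subtractf_nat[symmetric]) (use raises_le[OF w(1)] in auto)
      also have "\<dots> = (\<Sum>j | j < ?n \<and> t0 \<in> {left_end P j..right_end P j}. min (w j - X j) \<Delta>)"
        by (rule sum.cong) (use False in \<open>auto simp: min_def not_le\<close>)
      finally show ?thesis .
    qed
    have "q * raise_cost P g X z \<le> 4 * raise_cost P g' ?X ?w + p * (4 * \<Delta>)"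
      unfolding split[OF rz] eq
      by (intro add_mono cz'[OF rw fw] mult_left_mono
          irredundant_raise_bound[OF raises_le[OF rz] fz irr short]) auto
    also have "\<dots> \<le> 4 * raise_cost P g' X w + p * (4 * (\<Sum>j | j < ?n \<and> t0 \<in> {left_end P j..right_end P j}. min (w j - X j) \<Delta>))"
      using 1 2 by (intro add_mono mult_left_mono) auto
    also have "\<dots> = q * (4 * raise_cost P g X w)"
      using split[OF w(1)] by simp
    finally show ?thesis using q0 by simp
  qed
  then show ?thesis unfolding four_approx_def using fz rz irr by blast
qed

text \<open>The history grows at its end like a stack and keeps the old amount of each commitment.
  Inverting the last rule application therefore yields exactly the base to which pruning
  returns.\<close>

inductive growth ::
    "ufp_cover \<Rightarrow> (nat \<Rightarrow> nat set) \<Rightarrow> (nat \<Rightarrow> nat \<Rightarrow> nat) \<Rightarrow> (nat \<times> nat \<times> nat) list \<Rightarrow>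
      (nat \<Rightarrow> nat) \<Rightarrow> (nat \<Rightarrow> nat \<Rightarrow> nat) \<Rightarrow> bool"
  for P S g0 where
  growth_Nil: "growth P S g0 [] (\<lambda>_. 0) g0"
| growth_snoc: "growth P S g0 h X g \<Longrightarrow> growth_step P S X g i b g' \<Longrightarrow>
     growth P S g0 (h @ [(i, X i, b)]) (X(i := b)) g'"

inductive_cases growth_snocE: "growth P S g0 (h @ [(i, a, b)]) X' g'"
inductive_cases growth_NilE: "growth P S g0 [] X' g'"

text \<open>At \<open>t0\<close> every present item is already at or above its highest level, so no
  choice of levels achieves a larger load there. Combined with rounding up to levels, this shows
  that every solution has infinite cost.\<close>

lemma stuck_no_finite_solution:
  assumes t0: "t0 \<in> {1..horizon P}"
    and short: "load P X t0 < demand P t0"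
    and stuck: "\<And>i a. i < num_items P \<Longrightarrow> t0 \<in> {left_end P i..right_end P i} \<Longrightarrow> a \<in> S i \<Longrightarrow> a \<le> X i"
    and w: "raises P S (\<lambda>_. 0) w"
  shows "\<not> feasible P w"
proof
  assume "feasible P w"
  then have "demand P t0 \<le> load P w t0" using t0 unfolding feasible_def by auto
  also have "\<dots> \<le> load P X t0"
    unfolding load_def
    by (rule sum_mono) (use w stuck in \<open>auto simp: raises_def\<close>)
  finally show False using short by simp
qed

section \<open>A timed program logic\<close>

text \<open>One word length for all cells of all arrays makes the logarithmic cost of an expression
  at most \<open>Suc W\<close> times a factor that depends only on the program text.\<close>

definition bounded :: "nat \<Rightarrow> state \<Rightarrow> bool" where
  "bounded W s \<longleftrightarrow> (\<forall>a j. s a j < 2 ^ W)"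

text \<open>Exponent of an upper bound for the value, in multiples of \<open>Suc W\<close>. A
  constant is charged its own value, by \<open>c < 2 ^ c\<close>: crude, but independent of the
  instance. The extra 1 for a sum pays for the carry.\<close>

fun value_coeff :: "aexp \<Rightarrow> nat" where
  "value_coeff (Const c) = c"
| "value_coeff (Read a e) = 1"
| "value_coeff (Plus e1 e2) = 1 + value_coeff e1 + value_coeff e2"
| "value_coeff (Minus e1 e2) = value_coeff e1"
| "value_coeff (Times e1 e2) = value_coeff e1 + value_coeff e2"
| "value_coeff (Div e1 e2) = value_coeff e1"
| "value_coeff (Mod e1 e2) = value_coeff e1"

fun acost_coeff :: "aexp \<Rightarrow> nat" where
  "acost_coeff (Const c) = 1 + value_coeff (Const c)"
| "acost_coeff (Read a e) = 1 + value_coeff (Read a e) + acost_coeff e"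
| "acost_coeff (Plus e1 e2) = 1 + value_coeff (Plus e1 e2) + acost_coeff e1 + acost_coeff e2"
| "acost_coeff (Minus e1 e2) = 1 + value_coeff (Minus e1 e2) + acost_coeff e1 + acost_coeff e2"
| "acost_coeff (Times e1 e2) = 1 + value_coeff (Times e1 e2) + acost_coeff e1 + acost_coeff e2"
| "acost_coeff (Div e1 e2) = 1 + value_coeff (Div e1 e2) + acost_coeff e1 + acost_coeff e2"
| "acost_coeff (Mod e1 e2) = 1 + value_coeff (Mod e1 e2) + acost_coeff e1 + acost_coeff e2"

fun bcost_coeff :: "bexp \<Rightarrow> nat" where
  "bcost_coeff (Less e1 e2) = 1 + acost_coeff e1 + acost_coeff e2"
| "bcost_coeff (Equal e1 e2) = 1 + acost_coeff e1 + acost_coeff e2"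
| "bcost_coeff (Neg b) = 1 + bcost_coeff b"
| "bcost_coeff (Conj b1 b2) = 1 + bcost_coeff b1 + bcost_coeff b2"

fun com_coeff :: "com \<Rightarrow> nat" where
  "com_coeff Skip = 1"
| "com_coeff (Assign a e1 e2) = 1 + acost_coeff e1 + acost_coeff e2"
| "com_coeff (Query a e1 e2) = 3 + acost_coeff e1 + acost_coeff e2"
| "com_coeff (Seq c1 c2) = 1 + com_coeff c1 + com_coeff c2"
| "com_coeff (Cond b c1 c2) = 1 + bcost_coeff b + com_coeff c1 + com_coeff c2"
| "com_coeff (While b c) = 1 + bcost_coeff b + com_coeff c"

lemma aval_bound:
  assumes "bounded W s"
  shows "aval e s < 2 ^ (value_coeff e * Suc W)"
proof (induction e)
  case (Const c)
  have "c < 2 ^ c" by simp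
  also have "(2::nat) ^ c \<le> 2 ^ (c * Suc W)" by (rule power_increasing) auto
  finally show ?case by simp
next
  case (Read a e)
  have "s a (aval e s) < 2 ^ W" using assms by (simp add: bounded_def)
  also have "(2::nat) ^ W \<le> 2 ^ Suc W" by (rule power_increasing) auto
  finally show ?case by simp
next
  case (Plus e1 e2)
  let ?a = "value_coeff e1 * Suc W" and ?b = "value_coeff e2 * Suc W"
  have "aval e1 s < 2 ^ (?a + ?b)" "aval e2 s < 2 ^ (?a + ?b)"
    using Plus by (auto intro: less_le_trans power_increasing)
  then have "aval e1 s + aval e2 s < 2 ^ Suc (?a + ?b)" by simp
  also have "(2::nat) ^ Suc (?a + ?b) \<le> 2 ^ ((1 + value_coeff e1 + value_coeff e2) * Suc W)"
    by (rule power_increasing) (auto simp: algebra_simps)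
  finally show ?case by simp
next
  case (Times e1 e2)
  then show ?case by (auto simp: add_mult_distrib power_add intro!: mult_strict_mono' simp del: mult_Suc_right)
next
  case (Minus e1 e2)
  then show ?case by (auto intro: le_less_trans[of _ "aval e1 s"])
next
  case (Div e1 e2)
  then show ?case by (auto intro: le_less_trans[OF div_le_dividend])
next
  case (Mod e1 e2)
  then show ?case by (auto intro: le_less_trans[OF mod_less_eq_dividend])
qed

lemma bit_length_aval: "bounded W s \<Longrightarrow> bit_length (aval e s) \<le> value_coeff e * Suc W"
  by (rule floorlog_leI) (rule aval_bound, assumption, simp_all)

lemma acost_bound: "bounded W s \<Longrightarrow> acost e s \<le> acost_coeff e * Suc W"
proof (induction e)
  case (Const c)
  then show ?case using bit_length_aval[of W s "Const c"] by (simp add: algebra_simps)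
next
  case (Read a e)
  then show ?case using bit_length_aval[of W s "Read a e"] by (simp add: algebra_simps)
next
  case (Plus e1 e2)
  then show ?case using bit_length_aval[of W s "Plus e1 e2"] by (simp add: algebra_simps)
next
  case (Times e1 e2)
  then show ?case using bit_length_aval[of W s "Times e1 e2"] by (simp add: algebra_simps)
next
  case (Minus e1 e2)
  then show ?case using bit_length_aval[of W s "Minus e1 e2"] by (simp add: algebra_simps)
next
  case (Div e1 e2)
  then show ?case using bit_length_aval[of W s "Div e1 e2"] by (simp add: algebra_simps)
next
  case (Mod e1 e2)
  then show ?case using bit_length_aval[of W s "Mod e1 e2"] by (simp add: algebra_simps)
qed

lemma bcost_bound: "bounded W s \<Longrightarrow> bcost b s \<le> bcost_coeff b * Suc W"
proof (induction b)
  case (Less e1 e2)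
  then show ?case using acost_bound[of W s e1] acost_bound[of W s e2] by (simp add: algebra_simps)
next
  case (Equal e1 e2)
  then show ?case using acost_bound[of W s e1] acost_bound[of W s e2] by (simp add: algebra_simps)
qed (auto simp: algebra_simps)

text \<open>
  Since \<open>com_coeff\<close> adds up the whole program text, loop-free code runs with \<open>R = 1\<close>, sequential
  composition keeps \<open>R\<close>, and a loop multiplies it by the number of rounds plus one.
\<close>

definition runs ::
    "(nat \<Rightarrow> nat \<Rightarrow> (nat \<times> nat) option) \<Rightarrow> nat \<Rightarrow> com \<Rightarrow> nat \<Rightarrow> state \<Rightarrow> (state \<Rightarrow> bool) \<Rightarrow> bool" where
  "runs orc W c R s Q \<longleftrightarrow> (bounded W s \<and> 1 \<le> R \<longrightarrow>
     (\<exists>t s'. exec orc c s t s' \<and> bounded W s' \<and> t \<le> R * (com_coeff c * Suc W) \<and> Q s'))"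

lemma runs_mono:
  assumes "runs orc W c R s Q" "1 \<le> R" "R \<le> R'" "\<And>s'. Q s' \<Longrightarrow> Q' s'"
  shows "runs orc W c R' s Q'"
proof -
  have "t \<le> R' * (com_coeff c * Suc W)" if "t \<le> R * (com_coeff c * Suc W)" for t
    using that mult_le_mono1[OF assms(3)] le_trans by blast
  then show ?thesis using assms(1,2,4) unfolding runs_def by blast
qed

lemma runs_post: "runs orc W c R s Q \<Longrightarrow> (\<And>s'. Q s' \<Longrightarrow> Q' s') \<Longrightarrow> runs orc W c R s Q'"
  unfolding runs_def by blast

lemma bounded_store: "bounded W s \<Longrightarrow> v < 2 ^ W \<Longrightarrow> bounded W (store s a j v)"
  by (auto simp: bounded_def store_def)

lemma runs_Skip: "Q s \<Longrightarrow> runs orc W Skip R s Q"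
  unfolding runs_def using exec.Skip by fastforce

text \<open>A value read from the state, possibly diminished, stays below the word bound by itself.
  Only the remaining expressions cause a range obligation when they are assigned.\<close>

fun nongrowing :: "aexp \<Rightarrow> bool" where
  "nongrowing (Read a e) = True"
| "nongrowing (Minus e1 e2) = nongrowing e1"
| "nongrowing _ = False"

lemma nongrowing_bound: "bounded W s \<Longrightarrow> nongrowing e \<Longrightarrow> aval e s < 2 ^ W"
  by (induction e rule: nongrowing.induct) (auto simp: bounded_def)

lemma runs_Assign:
  assumes "\<not> nongrowing e2 \<Longrightarrow> aval e2 s < 2 ^ W" "Q (store s a (aval e1 s) (aval e2 s))"
  shows "runs orc W (Assign a e1 e2) R s Q"
  unfolding runs_def
proof
  assume "bounded W s \<and> 1 \<le> R"
  then have b: "bounded W s" and R: "1 \<le> R" by auto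
  have small: "aval e2 s < 2 ^ W" using assms(1) nongrowing_bound[OF b] by blast
  have "1 + acost e1 s + acost e2 s \<le> 1 * (com_coeff (Assign a e1 e2) * Suc W)"
    using acost_bound[OF b, of e1] acost_bound[OF b, of e2] by (simp add: algebra_simps)
  also have "\<dots> \<le> R * (com_coeff (Assign a e1 e2) * Suc W)" by (rule mult_le_mono1[OF R])
  finally show "\<exists>t s'. exec orc (Assign a e1 e2) s t s' \<and> bounded W s'
      \<and> t \<le> R * (com_coeff (Assign a e1 e2) * Suc W) \<and> Q s'"
    using exec.Assign bounded_store[OF b small] assms(2) by blast
qed

lemma runs_Query:
  assumes o: "orc (aval e1 s) (aval e2 s) = Some (u, v)" and "u < 2 ^ W" "v < 2 ^ W"
    "Q (store (store s a 0 u) a 1 v)"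
  shows "runs orc W (Query a e1 e2) R s Q"
  unfolding runs_def
proof
  assume "bounded W s \<and> 1 \<le> R"
  then have b: "bounded W s" and R: "1 \<le> R" by auto
  have "bit_length u \<le> W" "bit_length v \<le> W" using assms by (auto intro: floorlog_leI)
  then have "1 + acost e1 s + acost e2 s + bit_length u + bit_length v
      \<le> 1 * (com_coeff (Query a e1 e2) * Suc W)"
    using acost_bound[OF b, of e1] acost_bound[OF b, of e2] by (simp add: algebra_simps)
  also have "\<dots> \<le> R * (com_coeff (Query a e1 e2) * Suc W)" by (rule mult_le_mono1[OF R])
  finally show "\<exists>t s'. exec orc (Query a e1 e2) s t s' \<and> bounded W s'
      \<and> t \<le> R * (com_coeff (Query a e1 e2) * Suc W) \<and> Q s'"
    using exec.Query[where orc=orc, OF o] assms by (blast intro: bounded_store b)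
qed

lemma runs_Assign_eq:
  assumes "aval e1 s = j" "aval e2 s = v" "\<not> nongrowing e2 \<Longrightarrow> v < 2 ^ W" "Q (store s a j v)"
  shows "runs orc W (Assign a e1 e2) R s Q"
  using runs_Assign[of e2 s W Q a e1] assms by blast

lemma runs_Query_eq:
  assumes "aval e1 s = i" "aval e2 s = x" "orc i x = Some (u, v)" "u < 2 ^ W" "v < 2 ^ W"
    "Q (store (store s a 0 u) a 1 v)"
  shows "runs orc W (Query a e1 e2) R s Q"
  using runs_Query[of orc e1 s e2 u v W Q a] assms by blast

lemma runs_Seq:
  assumes "runs orc W c1 R s (\<lambda>s'. runs orc W c2 R s' Q)"
  shows "runs orc W (Seq c1 c2) R s Q"
  unfolding runs_def
proof
  assume b: "bounded W s \<and> 1 \<le> R"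
  then obtain t1 s1 t2 s2 where 1: "exec orc c1 s t1 s1" "t1 \<le> R * (com_coeff c1 * Suc W)"
    and 2: "exec orc c2 s1 t2 s2" "bounded W s2" "t2 \<le> R * (com_coeff c2 * Suc W)" "Q s2"
    using assms unfolding runs_def by blast
  have "1 \<le> R * Suc W" using b by simp
  then have "1 + t1 + t2 \<le> R * (com_coeff (Seq c1 c2) * Suc W)"
    using 1(2) 2(3) by (simp add: algebra_simps)
  then show "\<exists>t s'. exec orc (Seq c1 c2) s t s' \<and> bounded W s'
      \<and> t \<le> R * (com_coeff (Seq c1 c2) * Suc W) \<and> Q s'"
    using exec.Seq[OF 1(1) 2(1)] 2 by blast
qed

lemma runs_Cond:
  assumes "bval b s \<Longrightarrow> runs orc W c1 R s Q" "\<not> bval b s \<Longrightarrow> runs orc W c2 R s Q"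
  shows "runs orc W (Cond b c1 c2) R s Q"
  unfolding runs_def
proof
  assume a: "bounded W s \<and> 1 \<le> R"
  have "1 + bcost b s \<le> 1 * ((1 + bcost_coeff b) * Suc W)"
    using bcost_bound[of W s b] a by (simp add: algebra_simps)
  also have "\<dots> \<le> R * ((1 + bcost_coeff b) * Suc W)" by (rule mult_le_mono1) (use a in simp)
  finally have bc: "1 + bcost b s \<le> R * ((1 + bcost_coeff b) * Suc W)" .
  have tot: "1 + bcost b s + t \<le> R * (com_coeff (Cond b c1 c2) * Suc W)"
    if "t \<le> R * (com_coeff c1 * Suc W) \<or> t \<le> R * (com_coeff c2 * Suc W)" for t
    using bc that by (auto simp: algebra_simps)
  show "\<exists>t s'. exec orc (Cond b c1 c2) s t s' \<and> bounded W s'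
      \<and> t \<le> R * (com_coeff (Cond b c1 c2) * Suc W) \<and> Q s'"
  proof (cases "bval b s")
    case True
    then obtain t s' where "exec orc c1 s t s'" "bounded W s'" "t \<le> R * (com_coeff c1 * Suc W)" "Q s'"
      using assms(1) a unfolding runs_def by blast
    then show ?thesis using exec.CondTrue[OF True] tot by blast
  next
    case False
    then obtain t s' where "exec orc c2 s t s'" "bounded W s'" "t \<le> R * (com_coeff c2 * Suc W)" "Q s'"
      using assms(2) a unfolding runs_def by blast
    then show ?thesis using exec.CondFalse[OF False] tot by blast
  qed
qed

lemma runs_While:
  fixes I :: "state \<Rightarrow> bool" and \<mu> :: "state \<Rightarrow> nat"
  assumes body: "\<And>s. I s \<Longrightarrow> bval b s \<Longrightarrow> runs orc W c R s (\<lambda>s'. I s' \<and> \<mu> s' < \<mu> s)"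
    and I: "I s" and M: "\<mu> s \<le> M" and post: "\<And>s. I s \<Longrightarrow> \<not> bval b s \<Longrightarrow> Q s"
    and R: "1 \<le> R"
  shows "runs orc W (While b c) (Suc M * R) s Q"
proof -
  let ?k = "com_coeff (While b c)"
  have bc: "1 + bcost b s \<le> R * ((1 + bcost_coeff b) * Suc W)" if "bounded W s" for s
  proof -
    have "1 + bcost b s \<le> 1 * ((1 + bcost_coeff b) * Suc W)"
      using bcost_bound[OF that, of b] by (simp add: algebra_simps)
    also have "\<dots> \<le> R * ((1 + bcost_coeff b) * Suc W)" by (rule mult_le_mono1[OF R])
    finally show ?thesis .
  qed
  have "\<exists>t s'. exec orc (While b c) s t s' \<and> bounded W s' \<and> t \<le> Suc M * R * (?k * Suc W) \<and> Q s'"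
    if "bounded W s"
    using that I M
  proof (induction M arbitrary: s)
    case 0
    have "\<not> bval b s"
    proof
      assume "bval b s"
      then show False using body[OF 0(2)] 0 R unfolding runs_def by force
    qed
    moreover have "1 + bcost b s \<le> Suc 0 * R * (?k * Suc W)"
      using bc[OF 0(1)] by (simp add: algebra_simps)
    ultimately show ?case using exec.WhileFalse post 0 by blast
  next
    case (Suc M)
    show ?case
    proof (cases "bval b s")
      case False
      moreover have "1 + bcost b s \<le> Suc (Suc M) * R * (?k * Suc W)"
        using bc[OF Suc.prems(1)] by (simp add: algebra_simps)
      ultimately show ?thesis using exec.WhileFalse post Suc.prems by blast
    next
      case True
      obtain t1 s1 where 1: "exec orc c s t1 s1" "bounded W s1" "t1 \<le> R * (com_coeff c * Suc W)"
          "I s1" "\<mu> s1 < \<mu> s"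
        using body[OF Suc.prems(2) True] Suc.prems R unfolding runs_def by blast
      have "\<mu> s1 \<le> M" using 1 Suc.prems by simp
      then obtain t2 s2 where 2: "exec orc (While b c) s1 t2 s2" "bounded W s2"
          "t2 \<le> Suc M * R * (?k * Suc W)" "Q s2"
        using Suc.IH[OF 1(2,4)] by blast
      have "1 + bcost b s + t1 \<le> R * (?k * Suc W)"
        using bc[OF Suc.prems(1)] 1(3) by (simp add: algebra_simps)
      then have "1 + bcost b s + t1 + t2 \<le> Suc (Suc M) * R * (?k * Suc W)"
        using 2(3) by (simp add: algebra_simps)
      then show ?thesis using exec.WhileTrue[OF True 1(1) 2(1)] 2 by blast
    qed
  qed
  then show ?thesis unfolding runs_def by blast
qed

abbreviation var :: "string \<Rightarrow> aexp" where
  "var a \<equiv> Read a (Const 0)"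

abbreviation setv :: "string \<Rightarrow> aexp \<Rightarrow> com" where
  "setv a e \<equiv> Assign a (Const 0) e"

abbreviation count_up :: "string \<Rightarrow> aexp \<Rightarrow> com \<Rightarrow> com" where
  "count_up i e c \<equiv> While (Less (var i) e) (Seq c (setv i (Plus (var i) (Const 1))))"

lemma store_apply: "store s a j v b = (if b = a then (s a)(j := v) else s b)"
  by (simp add: store_def)

text \<open>The invariant is indexed by the counter value and is demanded of the state after the
  increment; the body must return with the counter unchanged. The limit is an expression, so it has
  to keep the value \<open>d\<close> along the invariant.\<close>

lemma runs_count_up:
  fixes I :: "nat \<Rightarrow> state \<Rightarrow> bool"
  assumes body: "\<And>j s. I j s \<Longrightarrow> s i 0 = j \<Longrightarrow> a \<le> j \<Longrightarrow> j < d \<Longrightarrow>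
      runs orc W c R s (\<lambda>s'. s' i 0 = j \<and> I (Suc j) (store s' i 0 (Suc j)))"
    and lim: "\<And>j s. I j s \<Longrightarrow> s i 0 = j \<Longrightarrow> j \<le> d \<Longrightarrow> aval e s = d"
    and init: "I a s" "s i 0 = a" "a \<le> d" and d: "d < 2 ^ W"
    and post: "\<And>s. I d s \<Longrightarrow> s i 0 = d \<Longrightarrow> Q s" and R: "1 \<le> R" and R': "Suc (d - a) * R \<le> R'"
  shows "runs orc W (count_up i e c) R' s Q"
proof -
  have "runs orc W (count_up i e c) (Suc (d - a) * R) s Q"
  proof (rule runs_While[where I="\<lambda>s. a \<le> s i 0 \<and> s i 0 \<le> d \<and> I (s i 0) s" and \<mu>="\<lambda>s. d - s i 0"])
    fix s assume A: "a \<le> s i 0 \<and> s i 0 \<le> d \<and> I (s i 0) s" and B: "bval (Less (var i) e) s"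
    then have lt: "s i 0 < d" using lim[of "s i 0" s] by simp
    show "runs orc W (Seq c (setv i (Plus (var i) (Const 1)))) R s
       (\<lambda>s'. (a \<le> s' i 0 \<and> s' i 0 \<le> d \<and> I (s' i 0) s') \<and> d - s' i 0 < d - s i 0)"
    proof (rule runs_Seq, rule runs_post[OF body[of "s i 0"]])
      fix s' assume *: "s' i 0 = s i 0 \<and> I (Suc (s i 0)) (store s' i 0 (Suc (s i 0)))"
      show "runs orc W (setv i (Plus (var i) (Const 1))) R s'
         (\<lambda>s'. (a \<le> s' i 0 \<and> s' i 0 \<le> d \<and> I (s' i 0) s') \<and> d - s' i 0 < d - s i 0)"
        by (rule runs_Assign) (use * lt A d in \<open>auto simp: store_apply\<close>)
    qed (use A lt in auto)
  next
    fix s assume A: "a \<le> s i 0 \<and> s i 0 \<le> d \<and> I (s i 0) s" and B: "\<not> bval (Less (var i) e) s"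
    then have "s i 0 = d" using lim[of "s i 0" s] by simp
    then show "Q s" using A post by metis
  qed (use init R in auto)
  then show ?thesis by (rule runs_mono) (use R R' in auto)
qed

text \<open>The frame condition, on whole arrays: \<open>V\<close> collects the names that a program
  may write, so facts about other arrays carry over by a disjointness check on names.\<close>

definition agree_off :: "string set \<Rightarrow> state \<Rightarrow> state \<Rightarrow> bool" where
  "agree_off V s s' \<longleftrightarrow> (\<forall>a. a \<notin> V \<longrightarrow> s' a = s a)"

lemma agree_off_refl [simp]: "agree_off V s s"
  by (simp add: agree_off_def)

lemma agree_off_store [simp]: "a \<in> V \<Longrightarrow> agree_off V s (store s' a j v) = agree_off V s s'"
  by (auto simp: agree_off_def store_apply)

lemma agree_offD: "agree_off V s s' \<Longrightarrow> a \<notin> V \<Longrightarrow> s' a = s a"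
  by (simp add: agree_off_def)

lemma agree_off_trans: "agree_off V s s' \<Longrightarrow> agree_off V' s' s'' \<Longrightarrow> V \<union> V' \<subseteq> V'' \<Longrightarrow> agree_off V'' s s''"
  unfolding agree_off_def by (metis UnI1 UnI2 subsetD)

section \<open>The growing phase\<close>

text \<open>
  Entry \<open>e < E[0]\<close> of the level table stands for raising item \<open>O[e]\<close> to amount \<open>A[e]\<close>; the cost
  increase over amount 0 is \<open>P[e] / Q[e]\<close>, \<open>V[0]\<close> is the product of all \<open>Q[e]\<close>, and \<open>C[e]\<close> is the
  current integral price.  The stack \<open>SO\<close>, \<open>SA\<close>, \<open>SB\<close> of height \<open>K[0]\<close> records the item, the old
  and the new amount of each commitment.
\<close>

definition covers :: "aexp \<Rightarrow> aexp \<Rightarrow> bexp" where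
  "covers i t = Conj (Neg (Less t (Read ''l'' i))) (Neg (Less (Read ''r'' i) t))"

definition load_prog :: com where
  "load_prog = Seq (setv ''S'' (Const 0)) (Seq (setv ''i'' (Const 0))
     (count_up ''i'' (var ''n'')
       (Cond (covers (var ''i'') (var ''t''))
         (setv ''S'' (Plus (var ''S'') (Read ''x'' (var ''i'')))) Skip)))"

text \<open>\<open>dl\<close> holds the largest shortfall found so far and \<open>ts\<close> a time
  attaining it. The final value 0 of \<open>dl\<close> means feasibility, so the same scan selects
  the time of a growing step and decides each undo in pruning.\<close>

definition scan_prog :: com where
  "scan_prog = Seq (setv ''dl'' (Const 0)) (Seq (setv ''ts'' (Const 0)) (Seq (setv ''t'' (Const 1))
     (count_up ''t'' (Plus (var ''k'') (Const 1))
       (Seq load_prog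
         (Cond (Less (Plus (var ''S'') (var ''dl'')) (Read ''D'' (var ''t'')))
           (Seq (setv ''dl'' (Minus (Read ''D'' (var ''t'')) (var ''S''))) (setv ''ts'' (var ''t'')))
           Skip)))))"

definition gain_prog :: com where
  "gain_prog = Seq (setv ''g'' (Minus (Read ''A'' (var ''e'')) (Read ''x'' (Read ''O'' (var ''e'')))))
     (Cond (Less (var ''dl'') (var ''g'')) (setv ''g'' (var ''dl'')) Skip)"

text \<open>The value \<open>E\<close> of \<open>best\<close> is the sentinel for no candidate.
  Ratios are compared by cross multiplication; the products occur only inside the test and are never
  stored, so they need not fit into the word length.\<close>

definition search_prog :: com where
  "search_prog = Seq (setv ''best'' (var ''E'')) (Seq (setv ''num'' (Const 0))
     (Seq (setv ''den'' (Const 0)) (Seq (setv ''e'' (Const 0))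
     (count_up ''e'' (var ''E'')
       (Cond (Conj (covers (Read ''O'' (var ''e'')) (var ''ts''))
           (Less (Read ''x'' (Read ''O'' (var ''e''))) (Read ''A'' (var ''e''))))
         (Seq gain_prog
           (Cond (Conj (Neg (Equal (var ''best'') (var ''E'')))
               (Neg (Less (Times (Read ''C'' (var ''e'')) (var ''den'')) (Times (var ''num'') (var ''g'')))))
             Skip
             (Seq (setv ''best'' (var ''e'')) (Seq (setv ''num'' (Read ''C'' (var ''e'')))
               (setv ''den'' (var ''g''))))))
         Skip)))))"

definition reprice_prog :: com where
  "reprice_prog = Seq (setv ''e'' (Const 0))
     (count_up ''e'' (var ''E'')
       (Seq gain_prog
         (Cond (covers (Read ''O'' (var ''e'')) (var ''ts''))
           (Assign ''C'' (var ''e'') (Minus (Times (Read ''C'' (var ''e'')) (var ''den''))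
              (Times (var ''num'') (var ''g''))))
           (Assign ''C'' (var ''e'') (Times (Read ''C'' (var ''e'')) (var ''den''))))))"

definition holds_input :: "ufp_cover \<Rightarrow> state \<Rightarrow> bool" where
  "holds_input P s \<longleftrightarrow> s ''k'' 0 = horizon P \<and> s ''n'' 0 = num_items P \<and> s ''m'' 0 = max_amount P \<and>
     (\<forall>i<num_items P. s ''l'' i = left_end P i \<and> s ''r'' i = right_end P i) \<and>
     (\<forall>t\<in>{1..horizon P}. s ''D'' t = demand P t)"

lemma holds_input_agree:
  "holds_input P s \<Longrightarrow> agree_off V s s' \<Longrightarrow>
    V \<inter> {''k'', ''n'', ''m'', ''l'', ''r'', ''D''} = {} \<Longrightarrow> holds_input P s'"
  unfolding holds_input_def agree_off_def by auto

lemma covers_iff: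
  "bval (covers i t) s \<longleftrightarrow> aval t s \<in> {s ''l'' (aval i s)..s ''r'' (aval i s)}"
  by (auto simp: covers_def)

lemma load_alt:
  "load P x t = (\<Sum>i<num_items P. if t \<in> {left_end P i..right_end P i} then x i else 0)"
  unfolding load_def by (subst sum.inter_filter[symmetric]) (auto intro!: arg_cong2[of _ _ _ _ sum])

lemma load_le:
  assumes "\<And>i. i < num_items P \<Longrightarrow> x i \<le> m"
  shows "load P x t \<le> num_items P * m"
proof -
  have "load P x t \<le> (\<Sum>i<num_items P. m)"
    unfolding load_alt by (rule sum_mono) (use assms in auto)
  then show ?thesis by simp
qed

text \<open>Room for the sum computed by \<open>load_prog\<close> and for the loop counters; the
  time counter ends at \<open>Suc (horizon P)\<close>.\<close>

locale bit_budget =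
  fixes P :: ufp_cover and W :: nat
  assumes W_pos: "1 < (2::nat) ^ W" and W_load: "num_items P * max_amount P < 2 ^ W"
    and W_items: "num_items P < 2 ^ W" and W_horizon: "Suc (horizon P) < 2 ^ W"
    and W_amount: "max_amount P < 2 ^ W"
begin

abbreviation runsP where "runsP \<equiv> runs (cost_oracle P) W"

lemma runs_load:
  assumes inp: "holds_input P s" and x: "\<And>i. i < num_items P \<Longrightarrow> s ''x'' i \<le> max_amount P"
    and R: "Suc (num_items P) \<le> R"
  shows "runsP load_prog R s
    (\<lambda>s'. agree_off {''S'', ''i''} s s' \<and> s' ''S'' 0 = load P (s ''x'') (s ''t'' 0))"
proof -
  let ?f = "\<lambda>i. if s ''t'' 0 \<in> {left_end P i..right_end P i} then s ''x'' i else 0"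
  let ?I = "\<lambda>j s'. agree_off {''S'', ''i''} s s' \<and> s' ''S'' 0 = (\<Sum>i<j. ?f i)"
  show ?thesis unfolding load_prog_def
  proof (intro runs_Seq runs_Assign, goal_cases)
    case 3
    show ?case
    proof (rule runs_count_up[where I="?I" and a=0 and d="num_items P" and R=1])
      fix j s' assume I: "?I j s'" and j: "s' ''i'' 0 = j" "j < num_items P"
      then have eq: "\<And>a. a \<notin> {''S'', ''i''} \<Longrightarrow> s' a = s a" by (auto dest: agree_offD)
      have le: "(\<Sum>i<Suc j. ?f i) < 2 ^ W"
      proof -
        have "(\<Sum>i<Suc j. ?f i) \<le> (\<Sum>i<num_items P. ?f i)"
          by (rule sum_mono2) (use j in auto)
        also have "\<dots> \<le> num_items P * max_amount P"
          unfolding load_alt[symmetric] by (rule load_le) (rule x)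
        finally show ?thesis using W_load by simp
      qed
      have lr: "s ''l'' j = left_end P j" "s ''r'' j = right_end P j"
        using inp j by (auto simp: holds_input_def)
      show "runsP (Cond (covers (var ''i'') (var ''t''))
         (setv ''S'' (Plus (var ''S'') (Read ''x'' (var ''i'')))) Skip) 1 s'
         (\<lambda>s'. s' ''i'' 0 = j \<and> ?I (Suc j) (store s' ''i'' 0 (Suc j)))"
        by (intro runs_Cond runs_Assign runs_Skip)
          (use le I j lr in \<open>auto simp: covers_iff store_apply eq\<close>)
    next
      fix j s' assume "?I j s'"
      then show "aval (var ''n'') s' = num_items P"
        using inp by (simp add: agree_off_def holds_input_def)
    next
      fix s' assume "?I (num_items P) s'"
      then show "agree_off {''S'', ''i''} s s' \<and> s' ''S'' 0 = load P (s ''x'') (s ''t'' 0)"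
        by (simp add: load_alt)
    qed (use W_items R in \<open>auto simp: store_apply\<close>)
  qed (use W_pos in \<open>auto simp: store_apply\<close>)
qed

lemma runs_scan:
  assumes inp: "holds_input P s" and x: "\<And>i. i < num_items P \<Longrightarrow> s ''x'' i \<le> max_amount P"
    and R: "Suc (horizon P) * Suc (num_items P) \<le> R"
  shows "runsP scan_prog R s
    (\<lambda>s'. agree_off {''dl'', ''ts'', ''t'', ''S'', ''i''} s s'
       \<and> (\<forall>t\<in>{1..horizon P}. demand P t - load P (s ''x'') t \<le> s' ''dl'' 0)
       \<and> (0 < s' ''dl'' 0 \<longrightarrow> s' ''ts'' 0 \<in> {1..horizon P}
           \<and> s' ''dl'' 0 = demand P (s' ''ts'' 0) - load P (s ''x'') (s' ''ts'' 0)))"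
proof -
  let ?V = "{''dl'', ''ts'', ''t'', ''S'', ''i''}"
  let ?I = "\<lambda>j s'. agree_off ?V s s'
       \<and> (\<forall>t\<in>{1..<j}. demand P t - load P (s ''x'') t \<le> s' ''dl'' 0)
       \<and> (0 < s' ''dl'' 0 \<longrightarrow> s' ''ts'' 0 \<in> {1..<j}
           \<and> s' ''dl'' 0 = demand P (s' ''ts'' 0) - load P (s ''x'') (s' ''ts'' 0))"
  show ?thesis unfolding scan_prog_def
  proof (intro runs_Seq runs_Assign, goal_cases)
    case 4
    show ?case
    proof (rule runs_count_up[where I="?I" and a=1 and d="Suc (horizon P)" and R="Suc (num_items P)"])
      fix j s' assume I: "?I j s'" and j: "s' ''t'' 0 = j" "1 \<le> j" "j < Suc (horizon P)"
      then have eq: "\<And>a. a \<notin> ?V \<Longrightarrow> s' a = s a" by (auto dest: agree_offD)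
      have inp': "holds_input P s'" by (rule holds_input_agree[OF inp conjunct1[OF I]]) auto
      have D: "s ''D'' j = demand P j" using inp j by (auto simp: holds_input_def)
      show "runsP (Seq load_prog
         (Cond (Less (Plus (var ''S'') (var ''dl'')) (Read ''D'' (var ''t'')))
           (Seq (setv ''dl'' (Minus (Read ''D'' (var ''t'')) (var ''S''))) (setv ''ts'' (var ''t'')))
           Skip)) (Suc (num_items P)) s'
         (\<lambda>s'. s' ''t'' 0 = j \<and> ?I (Suc j) (store s' ''t'' 0 (Suc j)))"
      proof (rule runs_Seq, rule runs_post[OF runs_load[OF inp']])
        fix s'' assume L: "agree_off {''S'', ''i''} s' s'' \<and> s'' ''S'' 0 = load P (s' ''x'') (s' ''t'' 0)"
        then have eq': "\<And>a. a \<notin> {''S'', ''i''} \<Longrightarrow> s'' a = s' a" by (auto dest: agree_offD)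
        have ag: "agree_off ?V s s''" using I L by (blast intro: agree_off_trans)
        show "runsP (Cond (Less (Plus (var ''S'') (var ''dl'')) (Read ''D'' (var ''t'')))
           (Seq (setv ''dl'' (Minus (Read ''D'' (var ''t'')) (var ''S''))) (setv ''ts'' (var ''t'')))
           Skip) (Suc (num_items P)) s''
         (\<lambda>s'. s' ''t'' 0 = j \<and> ?I (Suc j) (store s' ''t'' 0 (Suc j)))"
        proof (intro runs_Cond runs_Seq runs_Assign runs_Skip, goal_cases)
          case 1
          then show ?case by simp
        next
          case 2
          then show ?case using W_horizon j by (auto simp: store_apply eq')
        next
          case 3
          show ?case using 3 I L D j ag
            by (auto simp: store_apply eq eq' less_Suc_eq_le le_less dest!: bspec)
        next
          case 4
          show ?case using 4 I L D j ag
            by (auto simp: store_apply eq eq' less_Suc_eq)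
        qed
      qed (use x in \<open>auto simp: eq\<close>)
    next
      fix j s' assume "?I j s'"
      then show "aval (Plus (var ''k'') (Const 1)) s' = Suc (horizon P)"
        using inp by (simp add: agree_off_def holds_input_def)
    qed (use W_horizon R in \<open>auto simp: store_apply\<close>)
  qed (use W_pos in \<open>auto simp: store_apply\<close>)
qed

end

text \<open>Transitivity of \<open>c / g < p / d \<le> c' / g'\<close> without division. It carries
  minimality over when a new candidate displaces the incumbent \<open>p / d\<close>. If
  \<open>d\<close> is 0, then \<open>p\<close> is positive and \<open>g'\<close> must be 0.\<close>

lemma ratio_less_trans:
  fixes c d p g :: nat
  assumes "c * d < p * g" "p * g' \<le> c' * d"
  shows "c * g' \<le> c' * g"
proof (cases "d = 0")
  case False
  have "(c * g') * d = (c * d) * g'" by simp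
  also have "\<dots> \<le> (p * g) * g'" using assms(1) by (intro mult_le_mono1) simp
  also have "\<dots> = (p * g') * g" by simp
  also have "\<dots> \<le> (c' * d) * g" using assms(2) by (intro mult_le_mono1)
  also have "\<dots> = (c' * g) * d" by simp
  finally show ?thesis using False by simp
qed (use assms in auto)

definition gain :: "state \<Rightarrow> nat \<Rightarrow> nat" where
  "gain s e = min (s ''A'' e - s ''x'' (s ''O'' e)) (s ''dl'' 0)"

definition eligible :: "ufp_cover \<Rightarrow> state \<Rightarrow> nat \<Rightarrow> bool" where
  "eligible P s e \<longleftrightarrow> s ''ts'' 0 \<in> {left_end P (s ''O'' e)..right_end P (s ''O'' e)} \<and>
     s ''x'' (s ''O'' e) < s ''A'' e"

context bit_budget
begin

lemma runs_gain:
  "runsP gain_prog R s (\<lambda>s'. agree_off {''g''} s s' \<and> s' ''g'' 0 = gain s (s ''e'' 0))"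
  unfolding gain_prog_def
  by (intro runs_Seq runs_Cond runs_Assign runs_Skip)
    (auto simp: store_apply gain_def)

lemma runs_search:
  assumes inp: "holds_input P s" and own: "\<And>e. e < s ''E'' 0 \<Longrightarrow> s ''O'' e < num_items P"
    and dl: "0 < s ''dl'' 0" and W: "s ''E'' 0 < 2 ^ W" and R: "Suc (s ''E'' 0) \<le> R"
  shows "runsP search_prog R s
    (\<lambda>s'. agree_off {''best'', ''num'', ''den'', ''e'', ''g''} s s'
       \<and> ((s' ''best'' 0 = s ''E'' 0 \<and> (\<forall>e<s ''E'' 0. \<not> eligible P s e))
        \<or> (s' ''best'' 0 < s ''E'' 0 \<and> eligible P s (s' ''best'' 0)
           \<and> s' ''num'' 0 = s ''C'' (s' ''best'' 0) \<and> s' ''den'' 0 = gain s (s' ''best'' 0)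
           \<and> (\<forall>e<s ''E'' 0. eligible P s e \<longrightarrow> s' ''num'' 0 * gain s e \<le> s ''C'' e * s' ''den'' 0))))"
proof -
  let ?V = "{''best'', ''num'', ''den'', ''e'', ''g''}"
  let ?I = "\<lambda>j s'. agree_off ?V s s'
       \<and> ((s' ''best'' 0 = s ''E'' 0 \<and> (\<forall>e<j. \<not> eligible P s e))
        \<or> (s' ''best'' 0 < s ''E'' 0 \<and> eligible P s (s' ''best'' 0)
           \<and> s' ''num'' 0 = s ''C'' (s' ''best'' 0) \<and> s' ''den'' 0 = gain s (s' ''best'' 0)
           \<and> (\<forall>e<j. eligible P s e \<longrightarrow> s' ''num'' 0 * gain s e \<le> s ''C'' e * s' ''den'' 0)))"
  show ?thesis unfolding search_prog_def
  proof (intro runs_Seq runs_Assign, goal_cases)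
    case 5
    show ?case
    proof (rule runs_count_up[where I="?I" and a=0 and d="s ''E'' 0" and R=1])
      fix j s' assume I: "?I j s'" and j: "s' ''e'' 0 = j" "j < s ''E'' 0"
      then have eq: "\<And>a. a \<notin> ?V \<Longrightarrow> s' a = s a" by (auto dest: agree_offD)
      have lr: "s ''l'' (s ''O'' j) = left_end P (s ''O'' j)" "s ''r'' (s ''O'' j) = right_end P (s ''O'' j)"
        using inp own[OF j(2)] by (auto simp: holds_input_def)
      show "runsP (Cond (Conj (covers (Read ''O'' (var ''e'')) (var ''ts''))
           (Less (Read ''x'' (Read ''O'' (var ''e''))) (Read ''A'' (var ''e''))))
         (Seq gain_prog
           (Cond (Conj (Neg (Equal (var ''best'') (var ''E'')))
               (Neg (Less (Times (Read ''C'' (var ''e'')) (var ''den'')) (Times (var ''num'') (var ''g'')))))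
             Skip
             (Seq (setv ''best'' (var ''e'')) (Seq (setv ''num'' (Read ''C'' (var ''e'')))
               (setv ''den'' (var ''g''))))))
         Skip) 1 s'
         (\<lambda>s'. s' ''e'' 0 = j \<and> ?I (Suc j) (store s' ''e'' 0 (Suc j)))"
      proof (rule runs_Cond)
        assume "bval (Conj (covers (Read ''O'' (var ''e'')) (var ''ts''))
           (Less (Read ''x'' (Read ''O'' (var ''e''))) (Read ''A'' (var ''e'')))) s'"
        then have el: "eligible P s j" using j lr by (simp add: covers_iff eq eligible_def)
        show "runsP (Seq gain_prog
           (Cond (Conj (Neg (Equal (var ''best'') (var ''E'')))
               (Neg (Less (Times (Read ''C'' (var ''e'')) (var ''den'')) (Times (var ''num'') (var ''g'')))))
             Skip
             (Seq (setv ''best'' (var ''e'')) (Seq (setv ''num'' (Read ''C'' (var ''e'')))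
               (setv ''den'' (var ''g'')))))) 1 s'
         (\<lambda>s'. s' ''e'' 0 = j \<and> ?I (Suc j) (store s' ''e'' 0 (Suc j)))"
        proof (rule runs_Seq, rule runs_post[OF runs_gain])
          fix s'' assume G: "agree_off {''g''} s' s'' \<and> s'' ''g'' 0 = gain s' (s' ''e'' 0)"
          then have eq': "\<And>a. a \<notin> {''g''} \<Longrightarrow> s'' a = s' a" by (auto dest: agree_offD)
          have g: "s'' ''g'' 0 = gain s j" using G j by (simp add: eq gain_def)
          have ag: "agree_off ?V s s''" using I G by (blast intro: agree_off_trans)
          show "runsP (Cond (Conj (Neg (Equal (var ''best'') (var ''E'')))
               (Neg (Less (Times (Read ''C'' (var ''e'')) (var ''den'')) (Times (var ''num'') (var ''g'')))))
             Skip
             (Seq (setv ''best'' (var ''e'')) (Seq (setv ''num'' (Read ''C'' (var ''e'')))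
               (setv ''den'' (var ''g''))))) 1 s''
            (\<lambda>s'. s' ''e'' 0 = j \<and> ?I (Suc j) (store s' ''e'' 0 (Suc j)))"
          proof (rule runs_Cond)
            assume b: "bval (Conj (Neg (Equal (var ''best'') (var ''E'')))
               (Neg (Less (Times (Read ''C'' (var ''e'')) (var ''den'')) (Times (var ''num'') (var ''g''))))) s''"
            show "runsP Skip 1 s'' (\<lambda>s'. s' ''e'' 0 = j \<and> ?I (Suc j) (store s' ''e'' 0 (Suc j)))"
              by (rule runs_Skip) (use b I ag j g in \<open>clarsimp simp: store_apply eq eq' All_less_Suc\<close>)
          next
            assume b: "\<not> bval (Conj (Neg (Equal (var ''best'') (var ''E'')))
               (Neg (Less (Times (Read ''C'' (var ''e'')) (var ''den'')) (Times (var ''num'') (var ''g''))))) s''"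
            \<comment> \<open>Either no earlier entry was eligible, or entry \<open>j\<close> is
              strictly cheaper than an incumbent that was minimal among the earlier ones.\<close>
            then have "\<forall>e<j. eligible P s e \<longrightarrow> s ''C'' j * gain s e \<le> s ''C'' e * gain s j"
              using I j g ratio_less_trans[of "s ''C'' j" "s' ''den'' 0" "s' ''num'' 0" "gain s j"]
              by (auto simp: eq eq')
            then have all: "\<forall>e<Suc j. eligible P s e \<longrightarrow> s ''C'' j * gain s e \<le> s ''C'' e * gain s j"
              by (simp add: All_less_Suc)
            show "runsP (Seq (setv ''best'' (var ''e'')) (Seq (setv ''num'' (Read ''C'' (var ''e'')))
               (setv ''den'' (var ''g'')))) 1 s''
               (\<lambda>s'. s' ''e'' 0 = j \<and> ?I (Suc j) (store s' ''e'' 0 (Suc j)))"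
            proof (intro runs_Seq runs_Assign, goal_cases)
              case 4
              show ?case using ag j g all el by (simp add: store_apply eq eq')
            qed simp_all
          qed
        qed
      next
        assume "\<not> bval (Conj (covers (Read ''O'' (var ''e'')) (var ''ts''))
           (Less (Read ''x'' (Read ''O'' (var ''e''))) (Read ''A'' (var ''e'')))) s'"
        then have el: "\<not> eligible P s j" using j lr by (simp add: covers_iff eq eligible_def)
        show "runsP Skip 1 s' (\<lambda>s'. s' ''e'' 0 = j \<and> ?I (Suc j) (store s' ''e'' 0 (Suc j)))"
          by (rule runs_Skip) (use I j el in \<open>simp add: store_apply eq All_less_Suc\<close>)
      qed
    next
      fix j s' assume "?I j s'"
      then show "aval (var ''E'') s' = s ''E'' 0" by (simp add: agree_off_def)
    qed (use W R in \<open>auto simp: store_apply\<close>)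
  qed (use W W_pos in \<open>auto simp: store_apply\<close>)
qed

lemma runs_reprice:
  assumes inp: "holds_input P s" and own: "\<And>e. e < s ''E'' 0 \<Longrightarrow> s ''O'' e < num_items P"
    and W: "s ''E'' 0 < 2 ^ W" "\<And>e. e < s ''E'' 0 \<Longrightarrow> s ''C'' e * s ''den'' 0 < 2 ^ W"
    and R: "Suc (s ''E'' 0) \<le> R"
  shows "runsP reprice_prog R s
    (\<lambda>s'. agree_off {''C'', ''e'', ''g''} s s' \<and>
       (\<forall>e<s ''E'' 0. s' ''C'' e = s ''C'' e * s ''den'' 0 -
         (if s ''ts'' 0 \<in> {left_end P (s ''O'' e)..right_end P (s ''O'' e)}
          then s ''num'' 0 * gain s e else 0)))"
proof -
  define cov where "cov e \<longleftrightarrow> s ''ts'' 0 \<in> {left_end P (s ''O'' e)..right_end P (s ''O'' e)}" for e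
  let ?V = "{''C'', ''e'', ''g''}"
  let ?c = "\<lambda>e. s ''C'' e * s ''den'' 0 -
         (if cov e then s ''num'' 0 * gain s e else 0)"
  let ?I = "\<lambda>j s'. agree_off ?V s s' \<and> (\<forall>e<j. s' ''C'' e = ?c e) \<and> (\<forall>e\<ge>j. s' ''C'' e = s ''C'' e)"
  show ?thesis unfolding reprice_prog_def cov_def[symmetric]
  proof (intro runs_Seq runs_Assign, goal_cases)
    case 2
    show ?case
    proof (rule runs_count_up[where I="?I" and a=0 and d="s ''E'' 0" and R=1])
      fix j s' assume I: "?I j s'" and j: "s' ''e'' 0 = j" "j < s ''E'' 0"
      then have eq: "\<And>a. a \<notin> ?V \<Longrightarrow> s' a = s a" by (auto dest: agree_offD)
      have lr: "s ''l'' (s ''O'' j) = left_end P (s ''O'' j)" "s ''r'' (s ''O'' j) = right_end P (s ''O'' j)"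
        using inp own[OF j(2)] by (auto simp: holds_input_def)
      show "runsP (Seq gain_prog
         (Cond (covers (Read ''O'' (var ''e'')) (var ''ts''))
           (Assign ''C'' (var ''e'') (Minus (Times (Read ''C'' (var ''e'')) (var ''den''))
              (Times (var ''num'') (var ''g''))))
           (Assign ''C'' (var ''e'') (Times (Read ''C'' (var ''e'')) (var ''den''))))) 1 s'
         (\<lambda>s'. s' ''e'' 0 = j \<and> ?I (Suc j) (store s' ''e'' 0 (Suc j)))"
      proof (rule runs_Seq, rule runs_post[OF runs_gain])
        fix s'' assume G: "agree_off {''g''} s' s'' \<and> s'' ''g'' 0 = gain s' (s' ''e'' 0)"
        then have eq': "\<And>a. a \<notin> {''g''} \<Longrightarrow> s'' a = s' a" by (auto dest: agree_offD)
        have g: "s'' ''g'' 0 = gain s j" using G j by (simp add: eq gain_def)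
        have ag: "agree_off ?V s s''" using I G by (blast intro: agree_off_trans)
        have cv: "bval (covers (Read ''O'' (var ''e'')) (var ''ts'')) s'' = cov j"
          using j lr by (simp add: covers_iff eq eq' cov_def)
        show "runsP (Cond (covers (Read ''O'' (var ''e'')) (var ''ts''))
           (Assign ''C'' (var ''e'') (Minus (Times (Read ''C'' (var ''e'')) (var ''den''))
              (Times (var ''num'') (var ''g''))))
           (Assign ''C'' (var ''e'') (Times (Read ''C'' (var ''e'')) (var ''den'')))) 1 s''
         (\<lambda>s'. s' ''e'' 0 = j \<and> ?I (Suc j) (store s' ''e'' 0 (Suc j)))"
        proof (intro runs_Cond runs_Assign, goal_cases)
          case 1
          then show ?case using W(2)[OF j(2)] I j
            by (auto simp: eq eq' intro: le_less_trans[OF diff_le_self])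
        next
          case 2
          then show ?case using I ag g j lr by (simp add: store_apply eq eq' cv All_less_Suc)
        next
          case 3
          then show ?case using W(2)[OF j(2)] I j by (auto simp: eq eq')
        next
          case 4
          then show ?case using I ag g j lr by (simp add: store_apply eq eq' cv All_less_Suc)
        qed
      qed
    next
      fix j s' assume "?I j s'"
      then show "aval (var ''E'') s' = s ''E'' 0" by (simp add: agree_off_def)
    qed (use W R in \<open>auto simp: store_apply\<close>)
  qed (use W_pos in \<open>auto simp: store_apply\<close>)
qed

end

section \<open>Commitments, the undo stack and the growing invariant\<close>

definition push_prog :: com where
  "push_prog = Seq (Assign ''SO'' (var ''K'') (Read ''O'' (var ''best'')))
     (Seq (Assign ''SA'' (var ''K'') (Read ''x'' (Read ''O'' (var ''best''))))
     (Seq (Assign ''SB'' (var ''K'') (Read ''A'' (var ''best'')))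
     (Seq (Assign ''x'' (Read ''O'' (var ''best'')) (Read ''A'' (var ''best'')))
       (setv ''K'' (Plus (var ''K'') (Const 1))))))"

definition grow_body :: com where
  "grow_body = Seq scan_prog (Cond (Equal (var ''dl'') (Const 0)) (setv ''go'' (Const 0))
     (Seq search_prog (Cond (Equal (var ''best'') (var ''E''))
       (Seq (setv ''go'' (Const 0)) (setv ''bad'' (Const 1)))
       (Seq reprice_prog push_prog))))"

definition grow_prog :: com where
  "grow_prog = Seq (setv ''go'' (Const 1)) (While (Equal (var ''go'') (Const 1)) grow_body)"

text \<open>If the amount is no longer \<open>SB\<close>, a later and higher raise of the same item
  has been kept, and this commitment is only an intermediate level. Otherwise the undo is performed
  in place and revoked if the scan reports a shortfall.\<close>

definition prune_body :: com where
  "prune_body = Seq (setv ''K'' (Minus (var ''K'') (Const 1)))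
     (Cond (Equal (Read ''x'' (Read ''SO'' (var ''K''))) (Read ''SB'' (var ''K'')))
       (Seq (Assign ''x'' (Read ''SO'' (var ''K'')) (Read ''SA'' (var ''K'')))
       (Seq scan_prog
         (Cond (Equal (var ''dl'') (Const 0)) Skip
           (Assign ''x'' (Read ''SO'' (var ''K'')) (Read ''SB'' (var ''K''))))))
       Skip)"

definition prune_prog :: com where
  "prune_prog = While (Less (Const 0) (var ''K'')) prune_body"

definition levels :: "state \<Rightarrow> nat \<Rightarrow> nat set" where
  "levels s i = {s ''A'' e |e. e < s ''E'' 0 \<and> s ''O'' e = i}"

definition entries_ok :: "ufp_cover \<Rightarrow> state \<Rightarrow> bool" where
  "entries_ok P s \<longleftrightarrow>
     (\<forall>e<s ''E'' 0. s ''O'' e < num_items P \<and> 0 < s ''A'' e \<and> s ''A'' e \<le> max_amount P)"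

definition stack_is :: "(nat \<times> nat \<times> nat) list \<Rightarrow> state \<Rightarrow> bool" where
  "stack_is h s \<longleftrightarrow> s ''K'' 0 = length h \<and> (\<forall>j<length h. h ! j = (s ''SO'' j, s ''SA'' j, s ''SB'' j))"

text \<open>The termination measure of growing: amounts never decrease in this phase, so no entry
  reopens, and a commitment closes at least its own.\<close>

definition open_entries :: "state \<Rightarrow> nat set" where
  "open_entries s = {e. e < s ''E'' 0 \<and> s ''x'' (s ''O'' e) < s ''A'' e}"

definition stuck :: "ufp_cover \<Rightarrow> (nat \<Rightarrow> nat set) \<Rightarrow> (nat \<Rightarrow> nat) \<Rightarrow> bool" where
  "stuck P S X \<longleftrightarrow> (\<exists>t0\<in>{1..horizon P}. load P X t0 < demand P t0 \<and>
     (\<forall>i<num_items P. t0 \<in> {left_end P i..right_end P i} \<longrightarrow> (\<forall>a\<in>S i. a \<le> X i)))"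

text \<open>\<open>c\<close> stands for the bit length of the initial prices and \<open>d\<close>
  for that of the demands. The last clause keeps the stack height below the number of entries, which
  caps the price exponent by \<open>c + d * E\<close>.\<close>

definition growing ::
    "ufp_cover \<Rightarrow> (nat \<Rightarrow> nat set) \<Rightarrow> (nat \<Rightarrow> nat \<Rightarrow> nat) \<Rightarrow> nat \<Rightarrow> nat \<Rightarrow> state \<Rightarrow> bool" where
  "growing P S g0 c d s \<longleftrightarrow> (\<exists>h g. growth P S g0 h (s ''x'') g \<and> stack_is h s \<and>
       (\<forall>e<s ''E'' 0. s ''C'' e = g (s ''O'' e) (s ''A'' e))) \<and>
     (\<forall>e<s ''E'' 0. s ''C'' e < 2 ^ (c + d * s ''K'' 0)) \<and>
     (\<forall>i<num_items P. s ''x'' i \<le> max_amount P) \<and>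
     s ''K'' 0 + card (open_entries s) \<le> s ''E'' 0"

lemma growing_cong:
  assumes "growing P S g0 c d s" "agree_off V s s'"
    "V \<inter> {''x'', ''K'', ''E'', ''O'', ''A'', ''C'', ''SO'', ''SA'', ''SB''} = {}"
  shows "growing P S g0 c d s'"
proof -
  have eq: "s' a = s a" if "a \<in> {''x'', ''K'', ''E'', ''O'', ''A'', ''C'', ''SO'', ''SA'', ''SB''}" for a
    by (rule agree_offD[OF assms(2)]) (use that assms(3) in blast)
  show ?thesis using assms(1) unfolding growing_def stack_is_def open_entries_def
    by (simp add: eq)
qed

context bit_budget
begin

text \<open>The effect of one commitment on the invariant, separated from program execution: the new
  state enters only through the contents of its arrays.\<close>

lemma growing_step:
  fixes s :: state
  defines "Ow \<equiv> s ''O''" and "A \<equiv> s ''A''" and "E \<equiv> s ''E'' 0" and "K \<equiv> s ''K'' 0" and "X \<equiv> s ''x''"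
  assumes gr: "growing P S g0 c d s" and ok: "entries_ok P s" and S: "S = levels s"
    and ts: "ts \<in> {1..horizon P}" and dl: "0 < dl" "dl = demand P ts - load P X ts"
    and short: "\<forall>t\<in>{1..horizon P}. demand P t - load P X t \<le> dl"
    and d: "demand P ts < 2 ^ d"
    and best: "best < E" "ts \<in> {left_end P (Ow best)..right_end P (Ow best)}" "X (Ow best) < A best"
    and num: "num = s ''C'' best" and den: "den = min (A best - X (Ow best)) dl"
    and min: "\<forall>e<E. ts \<in> {left_end P (Ow e)..right_end P (Ow e)} \<and> X (Ow e) < A e \<longrightarrow>
      num * min (A e - X (Ow e)) dl \<le> s ''C'' e * den"
    and C: "\<forall>e<E. s' ''C'' e = s ''C'' e * den -
         (if ts \<in> {left_end P (Ow e)..right_end P (Ow e)} then num * min (A e - X (Ow e)) dl else 0)"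
    and s': "s' ''O'' = Ow" "s' ''A'' = A" "s' ''E'' = s ''E''" "s' ''K'' 0 = Suc K"
      "s' ''x'' = X(Ow best := A best)"
    and stk: "\<And>j. j < K \<Longrightarrow> s' ''SO'' j = s ''SO'' j \<and> s' ''SA'' j = s ''SA'' j \<and> s' ''SB'' j = s ''SB'' j"
      "s' ''SO'' K = Ow best" "s' ''SA'' K = X (Ow best)" "s' ''SB'' K = A best"
  shows "growing P S g0 c d s' \<and> card (open_entries s') < card (open_entries s)"
proof -
  obtain h g where h: "growth P S g0 h X g" "stack_is h s" "\<And>e. e < E \<Longrightarrow> s ''C'' e = g (Ow e) (A e)"
    and Cb: "\<And>e. e < E \<Longrightarrow> s ''C'' e < 2 ^ (c + d * K)"
    and X: "\<And>i. i < num_items P \<Longrightarrow> X i \<le> max_amount P"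
    and card: "K + card (open_entries s) \<le> E"
    using gr unfolding growing_def Ow_def A_def E_def K_def X_def by blast
  have own: "Ow e < num_items P" "A e \<le> max_amount P" if "e < E" for e
    using ok that unfolding entries_ok_def Ow_def A_def E_def by auto
  have Smem: "a \<in> S i \<longleftrightarrow> (\<exists>e<E. A e = a \<and> Ow e = i)" for a i
    unfolding S levels_def Ow_def A_def E_def by auto
  let ?g' = "price_step P X ts dl num den g"
  have "growth_step P S X g (Ow best) (A best) ?g'"
    unfolding growth_step_def
  proof (intro exI conjI)
    show "\<forall>j a. j < num_items P \<and> ts \<in> {left_end P j..right_end P j} \<and> a \<in> S j \<and> X j < a \<longrightarrow>
          num * min (a - X j) dl \<le> g j a * den"
      using min h(3) unfolding Smem by force
    show "A best \<in> S (Ow best)" using best unfolding Smem by blast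
    show "num = g (Ow best) (A best)" using num h(3) best by simp
  qed (use ts dl short best den own[OF best(1)] in blast)+
  from growth_snoc[OF h(1) this]
  have 1: "growth P S g0 (h @ [(Ow best, X (Ow best), A best)]) (s' ''x'') ?g'"
    unfolding s' .
  have lh: "length h = K" using h(2) unfolding stack_is_def K_def by simp
  have 2: "stack_is (h @ [(Ow best, X (Ow best), A best)]) s'"
    using h(2) stk unfolding stack_is_def lh s'
    by (auto simp: nth_append lh less_Suc_eq K_def)
  have 3: "s' ''C'' e = ?g' (Ow e) (A e)" if "e < E" for e
    using C that h(3)[OF that] unfolding price_step_def by simp
  \<comment> \<open>The scaling factor is truncated at a shortfall, hence is at most a
    demand.\<close>
  have "den < 2 ^ d" using den dl d by linarith
  have 4: "s' ''C'' e < 2 ^ (c + d * Suc K)" if "e < E" for e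
  proof -
    have "s' ''C'' e \<le> s ''C'' e * den" using C that by simp
    also have "\<dots> < 2 ^ (c + d * K) * 2 ^ d"
      by (rule mult_strict_mono'[OF Cb[OF that] \<open>den < 2 ^ d\<close>]) auto
    finally show ?thesis by (simp add: power_add algebra_simps)
  qed
  have 5: "s' ''x'' i \<le> max_amount P" if "i < num_items P" for i
    using X[OF that] own[OF best(1)] unfolding s' by simp
  have sub: "open_entries s' \<subset> open_entries s"
  proof
    show "open_entries s' \<subseteq> open_entries s"
      using best unfolding open_entries_def s' by (auto simp: Ow_def A_def X_def split: if_splits)
    have "best \<in> open_entries s" "best \<notin> open_entries s'"
      using best unfolding open_entries_def s' by (auto simp: Ow_def A_def X_def E_def)
    then show "open_entries s' \<noteq> open_entries s" by blast
  qed
  have "finite (open_entries s)" unfolding open_entries_def by simp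
  then have 6: "card (open_entries s') < card (open_entries s)" using sub by (rule psubset_card_mono)
  show ?thesis
    unfolding growing_def s' using 1 2 3 4 5 6 card by (auto simp: E_def s')
qed

abbreviation grow_vars :: "string set" where
  "grow_vars \<equiv> {''dl'', ''ts'', ''t'', ''S'', ''i'', ''best'', ''num'', ''den'', ''e'', ''g'', ''C'',
     ''SO'', ''SA'', ''SB'', ''x'', ''K'', ''go'', ''bad''}"

text \<open>The three alternatives are: still running, stopped at a feasible vector, stopped with a
  proof that no finite solution exists. The arrays of the table itself are outside
  \<open>grow_vars\<close>, so the levels are those of the initial state \<open>s\<close>.\<close>

definition grow_inv ::
    "state \<Rightarrow> (nat \<Rightarrow> nat \<Rightarrow> nat) \<Rightarrow> nat \<Rightarrow> nat \<Rightarrow> state \<Rightarrow> bool" where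
  "grow_inv s g0 c d s' \<longleftrightarrow> agree_off grow_vars s s' \<and> growing P (levels s) g0 c d s' \<and>
     (s' ''go'' 0 = 1 \<and> s' ''bad'' 0 = 0
      \<or> s' ''go'' 0 = 0 \<and> s' ''bad'' 0 = 0 \<and> feasible P (s' ''x'')
      \<or> s' ''go'' 0 = 0 \<and> s' ''bad'' 0 = 1 \<and> stuck P (levels s) (s' ''x''))"

text \<open>The flag \<open>go\<close> is part of the measure so that a last round, which closes no
  entry and only clears the flag, decreases it as well.\<close>

lemma runs_grow_body:
  assumes inp: "holds_input P s" and ok: "entries_ok P s"
    and d: "\<And>t. t \<in> {1..horizon P} \<Longrightarrow> demand P t < 2 ^ d"
    and W: "s ''E'' 0 < 2 ^ W" "c + d * s ''E'' 0 \<le> W"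
    and I: "grow_inv s g0 c d s1" and go: "s1 ''go'' 0 = 1"
  shows "runsP grow_body (Suc (horizon P) * Suc (num_items P) + Suc (s ''E'' 0)) s1
    (\<lambda>s'. grow_inv s g0 c d s' \<and>
      s' ''go'' 0 + card (open_entries s') < s1 ''go'' 0 + card (open_entries s1))"
proof -
  let ?R = "Suc (horizon P) * Suc (num_items P) + Suc (s ''E'' 0)"
  let ?Q = "\<lambda>s'. grow_inv s g0 c d s' \<and>
      s' ''go'' 0 + card (open_entries s') < s1 ''go'' 0 + card (open_entries s1)"
  have ag1: "agree_off grow_vars s s1" and gr1: "growing P (levels s) g0 c d s1" and bad: "s1 ''bad'' 0 = 0"
    using I go unfolding grow_inv_def by auto
  have eq1: "s1 ''E'' = s ''E''" "s1 ''O'' = s ''O''" "s1 ''A'' = s ''A''"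
    using agree_offD[OF ag1] by simp_all
  have inp1: "holds_input P s1" by (rule holds_input_agree[OF inp ag1]) simp
  have ok1: "entries_ok P s1" using ok unfolding entries_ok_def eq1 .
  have lev1: "levels s = levels s1" unfolding levels_def eq1 ..
  have x1: "s1 ''x'' i \<le> max_amount P" if "i < num_items P" for i
    using gr1 that unfolding growing_def by blast
  show ?thesis
    unfolding grow_body_def
  proof (rule runs_Seq, rule runs_post[OF runs_scan[OF inp1 x1]])
    fix s2
    assume A2: "agree_off {''dl'', ''ts'', ''t'', ''S'', ''i''} s1 s2 \<and>
       (\<forall>t\<in>{1..horizon P}. demand P t - load P (s1 ''x'') t \<le> s2 ''dl'' 0) \<and>
       (0 < s2 ''dl'' 0 \<longrightarrow> s2 ''ts'' 0 \<in> {1..horizon P} \<and>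
         s2 ''dl'' 0 = demand P (s2 ''ts'' 0) - load P (s1 ''x'') (s2 ''ts'' 0))"
    have eq2: "\<And>a. a \<notin> {''dl'', ''ts'', ''t'', ''S'', ''i''} \<Longrightarrow> s2 a = s1 a"
      by (rule agree_offD[OF conjunct1[OF A2]])
    have ag2: "agree_off grow_vars s s2" by (rule agree_off_trans[OF ag1 conjunct1[OF A2]]) simp
    have gr2: "growing P (levels s) g0 c d s2" by (rule growing_cong[OF gr1 conjunct1[OF A2]]) simp
    have op2: "open_entries s2 = open_entries s1" unfolding open_entries_def by (simp add: eq2)
    show "runsP (Cond (Equal (var ''dl'') (Const 0)) (setv ''go'' (Const 0))
     (Seq search_prog (Cond (Equal (var ''best'') (var ''E''))
       (Seq (setv ''go'' (Const 0)) (setv ''bad'' (Const 1)))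
       (Seq reprice_prog push_prog)))) ?R s2 ?Q"
    proof (rule runs_Cond)
      assume "bval (Equal (var ''dl'') (Const 0)) s2"
      then have feas: "feasible P (s1 ''x'')" using A2 unfolding feasible_def by auto
      let ?s = "store s2 ''go'' 0 0"
      have "growing P (levels s) g0 c d ?s"
        by (rule growing_cong[OF gr2, of "{''go''}"]) simp_all
      moreover have "open_entries ?s = open_entries s1"
        unfolding open_entries_def by (simp add: store_apply eq2)
      ultimately show "runsP (setv ''go'' (Const 0)) ?R s2 ?Q"
        by (intro runs_Assign) (use W_pos ag2 feas go bad in \<open>simp_all add: grow_inv_def store_apply eq2\<close>)
    next
      assume "\<not> bval (Equal (var ''dl'') (Const 0)) s2"
      then have dl: "0 < s2 ''dl'' 0" by simp
      have inp2: "holds_input P s2" by (rule holds_input_agree[OF inp1 conjunct1[OF A2]]) simp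
      have ok2: "e < s2 ''E'' 0 \<Longrightarrow> s2 ''O'' e < num_items P" for e
        using ok1 by (auto simp: entries_ok_def eq2)
      show "runsP (Seq search_prog (Cond (Equal (var ''best'') (var ''E''))
       (Seq (setv ''go'' (Const 0)) (setv ''bad'' (Const 1)))
       (Seq reprice_prog push_prog))) ?R s2 ?Q"
      proof (rule runs_Seq, rule runs_post[OF runs_search[OF inp2 ok2 dl]], assumption)
        fix s3
        assume A3: "agree_off {''best'', ''num'', ''den'', ''e'', ''g''} s2 s3 \<and>
          (s3 ''best'' 0 = s2 ''E'' 0 \<and> (\<forall>e<s2 ''E'' 0. \<not> eligible P s2 e)
          \<or> s3 ''best'' 0 < s2 ''E'' 0 \<and> eligible P s2 (s3 ''best'' 0)
           \<and> s3 ''num'' 0 = s2 ''C'' (s3 ''best'' 0) \<and> s3 ''den'' 0 = gain s2 (s3 ''best'' 0)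
           \<and> (\<forall>e<s2 ''E'' 0. eligible P s2 e \<longrightarrow> s3 ''num'' 0 * gain s2 e \<le> s2 ''C'' e * s3 ''den'' 0))"
        have eq3: "\<And>a. a \<notin> {''best'', ''num'', ''den'', ''e'', ''g''} \<Longrightarrow> s3 a = s2 a"
      by (rule agree_offD[OF conjunct1[OF A3]])
        have ag3: "agree_off grow_vars s s3" by (rule agree_off_trans[OF ag2 conjunct1[OF A3]]) simp
        have gr3: "growing P (levels s) g0 c d s3" by (rule growing_cong[OF gr2 conjunct1[OF A3]]) simp
        have op3: "open_entries s3 = open_entries s1"
          unfolding open_entries_def by (simp add: eq2 eq3)
        show "runsP (Cond (Equal (var ''best'') (var ''E''))
         (Seq (setv ''go'' (Const 0)) (setv ''bad'' (Const 1))) (Seq reprice_prog push_prog)) ?R s3 ?Q"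
        proof (rule runs_Cond)
          assume "bval (Equal (var ''best'') (var ''E'')) s3"
          then have "\<forall>e<s2 ''E'' 0. \<not> eligible P s2 e" using A3 by (simp add: eq3)
          then have st: "stuck P (levels s) (s1 ''x'')"
            unfolding stuck_def using A2 dl
            by (intro bexI[of _ "s2 ''ts'' 0"]) (auto simp: lev1 levels_def eligible_def eq2)
          let ?s = "store (store s3 ''go'' 0 0) ''bad'' 0 1"
          have "growing P (levels s) g0 c d ?s"
            by (rule growing_cong[OF gr3, of "{''go'', ''bad''}"]) simp_all
          moreover have "open_entries ?s = open_entries s1"
            unfolding open_entries_def by (simp add: store_apply eq2 eq3)
          ultimately show "runsP (Seq (setv ''go'' (Const 0)) (setv ''bad'' (Const 1))) ?R s3 ?Q"
            by (intro runs_Seq runs_Assign)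
              (use W_pos ag3 st go in \<open>simp_all add: grow_inv_def store_apply eq2 eq3\<close>)
        next
          assume "\<not> bval (Equal (var ''best'') (var ''E'')) s3"
          then have best: "s3 ''best'' 0 < s2 ''E'' 0" "eligible P s2 (s3 ''best'' 0)"
            and num: "s3 ''num'' 0 = s2 ''C'' (s3 ''best'' 0)" and den: "s3 ''den'' 0 = gain s2 (s3 ''best'' 0)"
            and min: "\<forall>e<s2 ''E'' 0. eligible P s2 e \<longrightarrow> s3 ''num'' 0 * gain s2 e \<le> s2 ''C'' e * s3 ''den'' 0"
            using A3 by (auto simp: eq3)
          have inp3: "holds_input P s3" by (rule holds_input_agree[OF inp2 conjunct1[OF A3]]) simp
          have ok3: "e < s3 ''E'' 0 \<Longrightarrow> s3 ''O'' e < num_items P" for e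
            using ok2 by (auto simp: eq3)
          have ts: "s2 ''ts'' 0 \<in> {1..horizon P}"
            "s2 ''dl'' 0 = demand P (s2 ''ts'' 0) - load P (s1 ''x'') (s2 ''ts'' 0)"
            using A2 dl by auto
          have "s3 ''best'' 0 \<in> open_entries s1"
            using best unfolding open_entries_def eligible_def by (simp add: eq2)
          then have "0 < card (open_entries s1)"
            by (subst card_gt_0_iff) (auto simp: open_entries_def)
          \<comment> \<open>The chosen entry is still open, so one more commitment keeps the stack
            height within the number of entries. This leaves room in \<open>W\<close> for one more
            factor of \<open>d\<close> bits.\<close>
          then have K: "Suc (s1 ''K'' 0) \<le> s ''E'' 0"
            using gr1 unfolding growing_def by (simp add: eq1)
          have CW: "s3 ''C'' e * s3 ''den'' 0 < 2 ^ W" if "e < s3 ''E'' 0" for e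
          proof -
            have "s3 ''den'' 0 < 2 ^ d"
              using den ts(2) d[OF ts(1)] unfolding gain_def by linarith
            moreover have "s3 ''C'' e < 2 ^ (c + d * s1 ''K'' 0)"
              using gr3 that unfolding growing_def by (simp add: eq3 eq2)
            ultimately have "s3 ''C'' e * s3 ''den'' 0 < 2 ^ (c + d * s1 ''K'' 0) * 2 ^ d"
              by (intro mult_strict_mono') auto
            also have "\<dots> = 2 ^ (c + d * Suc (s1 ''K'' 0))" by (simp add: power_add algebra_simps)
            also have "\<dots> \<le> 2 ^ W"
            proof (rule power_increasing)
              have "d * Suc (s1 ''K'' 0) \<le> d * s ''E'' 0" using K by (rule mult_le_mono2)
              then show "c + d * Suc (s1 ''K'' 0) \<le> W" using W(2) by linarith
            qed simp
            finally show ?thesis .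
          qed
          show "runsP (Seq reprice_prog push_prog) ?R s3 ?Q"
          proof (rule runs_Seq, rule runs_post[OF runs_reprice[OF inp3 ok3 _ CW]], assumption)
            fix s4
            assume A4: "agree_off {''C'', ''e'', ''g''} s3 s4 \<and>
               (\<forall>e<s3 ''E'' 0. s4 ''C'' e = s3 ''C'' e * s3 ''den'' 0 -
                 (if s3 ''ts'' 0 \<in> {left_end P (s3 ''O'' e)..right_end P (s3 ''O'' e)}
                  then s3 ''num'' 0 * gain s3 e else 0))"
            have eq4: "\<And>a. a \<notin> {''C'', ''e'', ''g''} \<Longrightarrow> s4 a = s3 a"
      by (rule agree_offD[OF conjunct1[OF A4]])
            have ag4: "agree_off grow_vars s s4" by (rule agree_off_trans[OF ag3 conjunct1[OF A4]]) simp
            let ?b = "s3 ''best'' 0" and ?K = "s1 ''K'' 0"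
            let ?i = "s ''O'' ?b"
            let ?s = "store (store (store (store (store s4 ''SO'' ?K ?i) ''SA'' ?K (s1 ''x'' ?i))
              ''SB'' ?K (s ''A'' ?b)) ''x'' ?i (s ''A'' ?b)) ''K'' 0 (Suc ?K)"
            have gn: "gain s3 e = min (s1 ''A'' e - s1 ''x'' (s1 ''O'' e)) (s2 ''dl'' 0)"
              "gain s2 e = min (s1 ''A'' e - s1 ''x'' (s1 ''O'' e)) (s2 ''dl'' 0)" for e
              unfolding gain_def by (simp_all add: eq2 eq3)
            have el: "eligible P s2 e \<longleftrightarrow>
                s2 ''ts'' 0 \<in> {left_end P (s1 ''O'' e)..right_end P (s1 ''O'' e)} \<and>
                s1 ''x'' (s1 ''O'' e) < s1 ''A'' e" for e
              unfolding eligible_def by (simp add: eq2)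
            have E: "s2 ''E'' = s1 ''E''" "s3 ''E'' = s1 ''E''" "s3 ''ts'' = s2 ''ts''"
              "s3 ''O'' = s1 ''O''" "s3 ''C'' = s1 ''C''" "s2 ''C'' = s1 ''C''"
              by (simp_all add: eq2 eq3)
            have fin: "growing P (levels s) g0 c d ?s \<and> card (open_entries ?s) < card (open_entries s1)"
            proof (rule growing_step[OF gr1 ok1 lev1 ts(1) dl ts(2), where best="?b"
                    and num="s3 ''num'' 0" and den="s3 ''den'' 0"])
              show "\<forall>e<s1 ''E'' 0. s2 ''ts'' 0 \<in> {left_end P (s1 ''O'' e)..right_end P (s1 ''O'' e)} \<and>
                  s1 ''x'' (s1 ''O'' e) < s1 ''A'' e \<longrightarrow>
                  s3 ''num'' 0 * min (s1 ''A'' e - s1 ''x'' (s1 ''O'' e)) (s2 ''dl'' 0)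
                  \<le> s1 ''C'' e * s3 ''den'' 0"
                using min unfolding el gn E .
              have "?s ''C'' = s4 ''C''" by (simp add: store_apply)
              then show "\<forall>e<s1 ''E'' 0. ?s ''C'' e = s1 ''C'' e * s3 ''den'' 0 -
                 (if s2 ''ts'' 0 \<in> {left_end P (s1 ''O'' e)..right_end P (s1 ''O'' e)}
                  then s3 ''num'' 0 * min (s1 ''A'' e - s1 ''x'' (s1 ''O'' e)) (s2 ''dl'' 0) else 0)"
                using conjunct2[OF A4] unfolding gn E by simp
              show "\<forall>t\<in>{1..horizon P}. demand P t - load P (s1 ''x'') t \<le> s2 ''dl'' 0"
                using A2 by blast
              show "?b < s1 ''E'' 0" using best(1) unfolding E .
              show "s2 ''ts'' 0 \<in> {left_end P (s1 ''O'' ?b)..right_end P (s1 ''O'' ?b)}"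
                "s1 ''x'' (s1 ''O'' ?b) < s1 ''A'' ?b" using best(2) unfolding el by blast+
              show "s3 ''num'' 0 = s1 ''C'' ?b" using num unfolding E .
              show "s3 ''den'' 0 = min (s1 ''A'' ?b - s1 ''x'' (s1 ''O'' ?b)) (s2 ''dl'' 0)"
                using den unfolding gn .
              show "demand P (s2 ''ts'' 0) < 2 ^ d" using d[OF ts(1)] .
            qed (simp_all add: eq1 eq2 eq3 eq4 store_apply)
            show "runsP push_prog ?R s4 ?Q"
              unfolding push_prog_def
            proof (intro runs_Seq runs_Assign, goal_cases)
              case 6
              show ?case using fin ag4 go bad
                by (simp add: store_apply eq1 eq2 eq3 eq4 grow_inv_def)
            qed (use K W(1) in \<open>simp_all add: store_apply eq1 eq2 eq3 eq4\<close>)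
          qed (use W in \<open>simp_all add: eq1 eq2 eq3\<close>)
        qed
      qed (use W in \<open>simp_all add: eq1 eq2\<close>)
    qed
  qed (assumption, rule le_add1)
qed

lemma runs_grow:
  assumes inp: "holds_input P s" and ok: "entries_ok P s"
    and d: "\<And>t. t \<in> {1..horizon P} \<Longrightarrow> demand P t < 2 ^ d"
    and W: "s ''E'' 0 < 2 ^ W" "c + d * s ''E'' 0 \<le> W"
    and init: "s ''x'' = (\<lambda>_. 0)" "s ''K'' 0 = 0" "s ''bad'' 0 = 0"
    and C: "\<And>e. e < s ''E'' 0 \<Longrightarrow> s ''C'' e = g0 (s ''O'' e) (s ''A'' e)"
      "\<And>e. e < s ''E'' 0 \<Longrightarrow> s ''C'' e < 2 ^ c"
    and R: "Suc (Suc (s ''E'' 0)) * (Suc (horizon P) * Suc (num_items P) + Suc (s ''E'' 0)) \<le> R"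
  shows "runsP grow_prog R s (\<lambda>s'. grow_inv s g0 c d s' \<and> s' ''go'' 0 \<noteq> 1)"
proof -
  let ?s = "store s ''go'' 0 1"
  have sub: "open_entries s \<subseteq> {..<s ''E'' 0}" unfolding open_entries_def by auto
  have cd: "card (open_entries s) \<le> s ''E'' 0" using card_mono[OF _ sub] by simp
  have op: "open_entries ?s = open_entries s" unfolding open_entries_def by (simp add: store_apply)
  have "growing P (levels s) g0 c d s"
    unfolding growing_def using C cd growth_Nil[of P "levels s" g0] init
    by (auto simp: stack_is_def)
  then have "growing P (levels s) g0 c d ?s"
    by (rule growing_cong[where V="{''go''}"]) simp_all
  then have I: "grow_inv s g0 c d ?s"
    unfolding grow_inv_def using init by (simp add: store_apply)
  have "runsP (While (Equal (var ''go'') (Const 1)) grow_body)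
      (Suc (Suc (s ''E'' 0)) * (Suc (horizon P) * Suc (num_items P) + Suc (s ''E'' 0))) ?s
      (\<lambda>s'. grow_inv s g0 c d s' \<and> s' ''go'' 0 \<noteq> 1)"
  proof (rule runs_While[where I="grow_inv s g0 c d" and \<mu>="\<lambda>s'. s' ''go'' 0 + card (open_entries s')"])
    fix s1 assume "grow_inv s g0 c d s1" "bval (Equal (var ''go'') (Const 1)) s1"
    then show "runsP grow_body (Suc (horizon P) * Suc (num_items P) + Suc (s ''E'' 0)) s1
      (\<lambda>s'. grow_inv s g0 c d s' \<and>
        s' ''go'' 0 + card (open_entries s') < s1 ''go'' 0 + card (open_entries s1))"
      by (intro runs_grow_body[OF inp ok d W]) simp_all
  qed (use I cd in \<open>simp_all add: op[simplified] store_apply\<close>)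
  then have "runsP (While (Equal (var ''go'') (Const 1)) grow_body) R ?s
      (\<lambda>s'. grow_inv s g0 c d s' \<and> s' ''go'' 0 \<noteq> 1)"
    by (rule runs_mono) (use R in simp_all)
  then show ?thesis unfolding grow_prog_def
    by (intro runs_Seq runs_Assign) (use W_pos in simp_all)
qed

end

section \<open>The pruning phase\<close>

context bit_budget
begin

text \<open>The base \<open>X\<close> and its prices \<open>g\<close> are not stored by the program;
  they are ghost values determined by the remaining history. Once the stack is empty they are the
  zero vector and \<open>g0\<close>, and \<open>four_approx\<close> becomes the global
  statement.\<close>

definition prune_inv ::
    "state \<Rightarrow> (nat \<Rightarrow> nat set) \<Rightarrow> (nat \<Rightarrow> nat \<Rightarrow> nat) \<Rightarrow> state \<Rightarrow> bool" where
  "prune_inv s S g0 s' \<longleftrightarrow> agree_off {''K'', ''x'', ''dl'', ''ts'', ''t'', ''S'', ''i''} s s' \<and>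
     (\<forall>i<num_items P. s' ''x'' i \<le> max_amount P) \<and>
     (\<exists>h X g. growth P S g0 h X g \<and> stack_is h s' \<and> four_approx P S g X (s' ''x''))"

lemma runs_prune_body:
  assumes inp: "holds_input P s" and I: "prune_inv s S g0 s1" and K: "0 < s1 ''K'' 0"
  shows "runsP prune_body (Suc (horizon P) * Suc (num_items P)) s1
    (\<lambda>s'. prune_inv s S g0 s' \<and> s' ''K'' 0 < s1 ''K'' 0)"
proof -
  let ?V = "{''K'', ''x'', ''dl'', ''ts'', ''t'', ''S'', ''i''}"
  let ?R = "Suc (horizon P) * Suc (num_items P)"
  let ?Q = "\<lambda>s'. prune_inv s S g0 s' \<and> s' ''K'' 0 < s1 ''K'' 0"
  have ag1: "agree_off ?V s s1" and x1: "\<And>i. i < num_items P \<Longrightarrow> s1 ''x'' i \<le> max_amount P"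
    using I unfolding prune_inv_def by auto
  obtain h0 X0 g where h0: "growth P S g0 h0 X0 g" "stack_is h0 s1" "four_approx P S g X0 (s1 ''x'')"
    using I unfolding prune_inv_def by blast
  have "h0 \<noteq> []" using h0(2) K unfolding stack_is_def by auto
  then obtain h i a b where h: "h0 = h @ [(i, a, b)]" by (metis prod_cases3 rev_exhaust)
  have "growth P S g0 (h @ [(i, a, b)]) X0 g" using h0(1) unfolding h .
  then obtain X g' where X: "X0 = X(i := b)" "a = X i" and gr: "growth P S g0 h X g'"
    and st: "growth_step P S X g' i b g"
    by (rule growth_snocE) auto
  have i: "i < num_items P" "X i < b" using st unfolding growth_step_def by auto
  have Kh: "s1 ''K'' 0 = Suc (length h)" using h0(2) unfolding stack_is_def h by simp
  have all: "\<forall>j<Suc (length h). (h @ [(i, a, b)]) ! j = (s1 ''SO'' j, s1 ''SA'' j, s1 ''SB'' j)"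
    using h0(2) unfolding stack_is_def h by simp
  have top: "s1 ''SO'' (length h) = i" "s1 ''SA'' (length h) = X i" "s1 ''SB'' (length h) = b"
    using all[rule_format, of "length h"] X(2) by auto
  have rest: "h ! j = (s1 ''SO'' j, s1 ''SA'' j, s1 ''SB'' j)" if "j < length h" for j
    using all[rule_format, of j] that by (simp add: nth_append)
  have ap: "four_approx P S g (X(i := b)) (s1 ''x'')" using h0(3) X(1) by simp
  \<comment> \<open>A successful undo, a revoked undo and a skipped one all have the shape of
    \<open>z\<close> in \<open>growth_step_four_approx\<close>.\<close>
  have fin: "?Q s'"
    if "agree_off ?V s1 s'" and "s' ''K'' 0 = length h"
      and z: "s' ''x'' = (if s1 ''x'' i = b \<and> feasible P ((s1 ''x'')(i := X i))
        then (s1 ''x'')(i := X i) else s1 ''x'')" for s'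
  proof -
    have eq: "s' ''SO'' = s1 ''SO''" "s' ''SA'' = s1 ''SA''" "s' ''SB'' = s1 ''SB''"
      using agree_offD[OF that(1)] by simp_all
    have "agree_off ?V s s'" by (rule agree_off_trans[OF ag1 that(1)]) simp
    moreover have "s' ''x'' j \<le> max_amount P" if "j < num_items P" for j
      using x1[OF that] i z by (auto split: if_splits)
    moreover have "stack_is h s'" unfolding stack_is_def eq using that(2) rest by simp
    moreover have "four_approx P S g' X (s' ''x'')" by (rule growth_step_four_approx[OF st ap z])
    ultimately show ?thesis unfolding prune_inv_def using gr Kh that(2) by auto
  qed
  let ?s2 = "store s1 ''K'' 0 (length h)"
  have inp2: "holds_input P s1" by (rule holds_input_agree[OF inp ag1]) simp
  show ?thesis
    unfolding prune_body_def
  proof (rule runs_Seq, rule runs_Assign, simp, unfold aval.simps Kh diff_Suc_1, rule runs_Cond)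
    assume "bval (Equal (Read ''x'' (Read ''SO'' (var ''K''))) (Read ''SB'' (var ''K''))) ?s2"
    then have xb: "s1 ''x'' i = b" by (simp add: store_apply top)
    let ?s3 = "store ?s2 ''x'' i (X i)"
    have inp3: "holds_input P ?s3" by (rule holds_input_agree[OF inp2, of ?V]) simp_all
    have x3: "?s3 ''x'' j \<le> max_amount P" if "j < num_items P" for j
      using x1[OF that] i xb by (auto simp: store_apply)
    show "runsP (Seq (Assign ''x'' (Read ''SO'' (var ''K'')) (Read ''SA'' (var ''K'')))
       (Seq scan_prog
         (Cond (Equal (var ''dl'') (Const 0)) Skip
           (Assign ''x'' (Read ''SO'' (var ''K'')) (Read ''SB'' (var ''K'')))))) ?R ?s2
       (\<lambda>s'. prune_inv s S g0 s' \<and> s' ''K'' 0 < Suc (length h))"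
      unfolding Kh[symmetric]
    proof (rule runs_Seq, rule runs_Assign)
      have e: "store ?s2 ''x'' (aval (Read ''SO'' (var ''K'')) ?s2) (aval (Read ''SA'' (var ''K'')) ?s2) = ?s3"
        by (simp add: store_apply top)
      show "runsP (Seq scan_prog (Cond (Equal (var ''dl'') (Const 0)) Skip
           (Assign ''x'' (Read ''SO'' (var ''K'')) (Read ''SB'' (var ''K''))))) ?R
           (store ?s2 ''x'' (aval (Read ''SO'' (var ''K'')) ?s2) (aval (Read ''SA'' (var ''K'')) ?s2)) ?Q"
        unfolding e
      proof (rule runs_Seq, rule runs_post[OF runs_scan[OF inp3 x3]])
        fix s4
        assume A4: "agree_off {''dl'', ''ts'', ''t'', ''S'', ''i''} ?s3 s4 \<and>
           (\<forall>t\<in>{1..horizon P}. demand P t - load P (?s3 ''x'') t \<le> s4 ''dl'' 0) \<and>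
           (0 < s4 ''dl'' 0 \<longrightarrow> s4 ''ts'' 0 \<in> {1..horizon P} \<and>
             s4 ''dl'' 0 = demand P (s4 ''ts'' 0) - load P (?s3 ''x'') (s4 ''ts'' 0))"
        have eq4: "\<And>a. a \<notin> {''dl'', ''ts'', ''t'', ''S'', ''i''} \<Longrightarrow> s4 a = ?s3 a"
          by (rule agree_offD[OF conjunct1[OF A4]])
        have ag4: "agree_off ?V s1 s4"
          by (rule agree_off_trans[OF _ conjunct1[OF A4], of ?V]) simp_all
        have x': "?s3 ''x'' = (s1 ''x'')(i := X i)" by (simp add: store_apply)
        have feas: "feasible P ((s1 ''x'')(i := X i)) \<longleftrightarrow> s4 ''dl'' 0 = 0"
        proof
          assume "feasible P ((s1 ''x'')(i := X i))"
          then show "s4 ''dl'' 0 = 0" using A4 unfolding x' feasible_def by fastforce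
        next
          assume "s4 ''dl'' 0 = 0"
          then show "feasible P ((s1 ''x'')(i := X i))" using A4 unfolding x' feasible_def by simp
        qed
        show "runsP (Cond (Equal (var ''dl'') (Const 0)) Skip
           (Assign ''x'' (Read ''SO'' (var ''K'')) (Read ''SB'' (var ''K'')))) ?R s4 ?Q"
        proof (intro runs_Cond runs_Skip runs_Assign)
          assume "bval (Equal (var ''dl'') (Const 0)) s4"
          then show "?Q s4"
            by (intro fin ag4) (simp_all add: eq4 store_apply feas xb)
        next
          assume n: "\<not> bval (Equal (var ''dl'') (Const 0)) s4"
          have "(s1 ''x'')(i := b) = s1 ''x''" using xb by auto
          with n show "?Q (store s4 ''x'' (aval (Read ''SO'' (var ''K'')) s4) (aval (Read ''SB'' (var ''K'')) s4))"
            by (intro fin) (simp_all add: ag4 eq4 store_apply feas xb top)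
        qed simp
      qed simp_all
    qed simp
  next
    assume "\<not> bval (Equal (Read ''x'' (Read ''SO'' (var ''K''))) (Read ''SB'' (var ''K''))) ?s2"
    then have xb: "s1 ''x'' i \<noteq> b" by (simp add: store_apply top)
    show "runsP Skip ?R ?s2 (\<lambda>s'. prune_inv s S g0 s' \<and> s' ''K'' 0 < Suc (length h))"
      unfolding Kh[symmetric]
      by (intro runs_Skip fin) (simp_all add: store_apply xb)
  qed
qed

lemma runs_prune:
  assumes inp: "holds_input P s" and gr: "growth P S g0 h (s ''x'') g" and st: "stack_is h s"
    and feas: "feasible P (s ''x'')" and x: "\<And>i. i < num_items P \<Longrightarrow> s ''x'' i \<le> max_amount P"
    and R: "Suc (s ''K'' 0) * (Suc (horizon P) * Suc (num_items P)) \<le> R"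
  shows "runsP prune_prog R s (\<lambda>s'. four_approx P S g0 (\<lambda>_. 0) (s' ''x'') \<and>
    (\<forall>i<num_items P. s' ''x'' i \<le> max_amount P))"
proof -
  have I: "prune_inv s S g0 s"
    unfolding prune_inv_def
    by (intro conjI agree_off_refl allI impI x exI[of _ h] exI[of _ "s ''x''"] exI[of _ g]
        gr st four_approx_refl feas)
  have "runsP prune_prog (Suc (s ''K'' 0) * (Suc (horizon P) * Suc (num_items P))) s
    (\<lambda>s'. four_approx P S g0 (\<lambda>_. 0) (s' ''x'') \<and> (\<forall>i<num_items P. s' ''x'' i \<le> max_amount P))"
    unfolding prune_prog_def
  proof (rule runs_While[where I="prune_inv s S g0" and \<mu>="\<lambda>s'. s' ''K'' 0"])
    fix s1 assume "prune_inv s S g0 s1" "bval (Less (Const 0) (var ''K'')) s1"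
    then show "runsP prune_body (Suc (horizon P) * Suc (num_items P)) s1
      (\<lambda>s'. prune_inv s S g0 s' \<and> s' ''K'' 0 < s1 ''K'' 0)"
      by (intro runs_prune_body[OF inp]) simp_all
  next
    fix s1 assume J: "prune_inv s S g0 s1" and K: "\<not> bval (Less (Const 0) (var ''K'')) s1"
    obtain h X g where h: "growth P S g0 h X g" "stack_is h s1" "four_approx P S g X (s1 ''x'')"
      using J unfolding prune_inv_def by blast
    have "h = []" using h(2) K unfolding stack_is_def by simp
    then have "X = (\<lambda>_. 0)" "g = g0" using h(1) by (auto elim: growth_NilE)
    then show "four_approx P S g0 (\<lambda>_. 0) (s1 ''x'') \<and> (\<forall>i<num_items P. s1 ''x'' i \<le> max_amount P)"
      using h(3) J unfolding prune_inv_def by simp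
  qed (use I in simp_all)
  then show ?thesis by (rule runs_mono) (use R in simp_all)
qed

end

section \<open>Geometric price levels\<close>

definition cost_num :: "ufp_cover \<Rightarrow> nat \<Rightarrow> nat \<Rightarrow> nat" where
  "cost_num P i x = fst (cost_code (cost_fun P i x))"

definition cost_den :: "ufp_cover \<Rightarrow> nat \<Rightarrow> nat \<Rightarrow> nat" where
  "cost_den P i x = snd (cost_code (cost_fun P i x))"

text \<open>\<open>u / v\<close> is the cost against which the candidate amounts are tested. The
  midpoint is rounded up so that setting \<open>lo\<close> to it makes progress. An infinite cost
  has code \<open>(1, 0)\<close> and fails the test for \<open>v > 0\<close> without separate
  treatment.\<close>

definition bisect_prog :: "nat \<Rightarrow> com" where
  "bisect_prog N = While (Less (var ''lo'') (var ''hi''))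
     (Seq (setv ''mid'' (Div (Plus (Plus (var ''lo'') (var ''hi'')) (Const 1)) (Const 2)))
     (Seq (Query ''q'' (var ''i'') (var ''mid''))
       (Cond (Less (Times (Times (Const (Suc N)) (var ''u'')) (Read ''q'' (Const 1)))
           (Times (Times (var ''q'') (Const N)) (var ''v'')))
         (setv ''hi'' (Minus (var ''mid'') (Const 1)))
         (setv ''lo'' (var ''mid'')))))"

text \<open>The cost at \<open>lo\<close> is queried anew, because the last query of the bisection
  need not have been at \<open>lo\<close>. Multiplying \<open>V\<close> by each new \<open>Q\<close>
  makes it a common denominator of all increases.\<close>

definition add_prog :: com where
  "add_prog = Seq (Query ''q'' (var ''i'') (var ''lo''))
     (Seq (setv ''u'' (var ''q'')) (Seq (setv ''v'' (Read ''q'' (Const 1)))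
     (Seq (Query ''q'' (var ''i'') (Const 0))
     (Seq (Assign ''O'' (var ''E'') (var ''i''))
     (Seq (Assign ''A'' (var ''E'') (var ''lo''))
     (Seq (Assign ''P'' (var ''E'') (Minus (Times (var ''u'') (Read ''q'' (Const 1))) (Times (var ''q'') (var ''v''))))
     (Seq (Assign ''Q'' (var ''E'') (Times (var ''v'') (Read ''q'' (Const 1))))
     (Seq (setv ''V'' (Times (var ''V'') (Read ''Q'' (var ''E''))))
     (Seq (setv ''h'' (var ''lo'')) (setv ''E'' (Plus (var ''E'') (Const 1))))))))))))"

definition item_body :: "nat \<Rightarrow> com" where
  "item_body N = Cond (Less (var ''h'') (var ''m''))
     (Seq (Query ''q'' (var ''i'') (Plus (var ''h'') (Const 1)))
       (Cond (Equal (Read ''q'' (Const 1)) (Const 0)) (setv ''go'' (Const 0))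
         (Seq (setv ''u'' (var ''q'')) (Seq (setv ''v'' (Read ''q'' (Const 1)))
         (Seq (setv ''lo'' (Plus (var ''h'') (Const 1))) (Seq (setv ''hi'' (var ''m''))
         (Seq (bisect_prog N) add_prog)))))))
     (setv ''go'' (Const 0))"

definition item_prog :: "nat \<Rightarrow> com" where
  "item_prog N = Seq (setv ''h'' (Const 0)) (Seq (setv ''go'' (Const 1))
     (While (Equal (var ''go'') (Const 1)) (item_body N)))"

definition levels_prog :: "nat \<Rightarrow> com" where
  "levels_prog N = Seq (setv ''V'' (Const 1)) (Seq (setv ''i'' (Const 0))
     (count_up ''i'' (var ''n'') (item_prog N)))"

definition scale_prog :: com where
  "scale_prog = Seq (setv ''e'' (Const 0)) (count_up ''e'' (var ''E'')
     (Assign ''C'' (var ''e'') (Times (Read ''P'' (var ''e'')) (Div (var ''V'') (Read ''Q'' (var ''e''))))))"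

section \<open>Cost codes and the number of geometric levels\<close>

lemma cost_value_code:
  assumes "valid_ufp_cover P" "i < num_items P" "x \<le> max_amount P"
  shows "cost_value (cost_fun P i x) =
    (if cost_den P i x = 0 then \<infinity> else ennreal (real (cost_num P i x) / real (cost_den P i x)))"
proof (cases "cost_fun P i x")
  case None
  then show ?thesis by (simp add: cost_value_def cost_den_def cost_code_def)
next
  case (Some r)
  then have r: "0 \<le> r" using assms unfolding valid_ufp_cover_def by blast
  obtain a b where ab: "quotient_of r = (a, b)" by force
  have b: "0 < b" using quotient_of_denom_pos[OF ab] .
  have rr: "r = of_int a / of_int b" using quotient_of_div[OF ab] .
  have a: "0 \<le> a" using r b unfolding rr by (simp add: zero_le_divide_iff)
  have "(of_rat r :: real) = of_int a / of_int b" unfolding rr by (simp add: of_rat_divide)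
  then show ?thesis
    using Some ab a b by (simp add: cost_value_def cost_den_def cost_num_def cost_code_def)
qed

text \<open>Bernoulli's inequality for \<open>(1 + 1 / N) ^ N\<close>, cleared of denominators:
  \<open>N\<close> steps by the factor \<open>1 + 1 / N\<close> at least double a cost.\<close>

lemma two_power_le_root: "2 * N ^ N \<le> Suc N ^ N" if "1 \<le> N" for N :: nat
proof -
  have "1 + real N * (1 / real N) \<le> (1 + 1 / real N) ^ N"
    by (rule Bernoulli_inequality) (rule order_trans[of _ 0], simp_all)
  then have "2 * real N ^ N \<le> (1 + 1 / real N) ^ N * real N ^ N"
    using that by (intro mult_right_mono) auto
  also have "\<dots> = real (Suc N) ^ N"
    using that by (simp add: power_mult_distrib[symmetric] field_simps)
  finally have "real (2 * N ^ N) \<le> real (Suc N ^ N)" by simp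
  then show ?thesis by (simp only: of_nat_le_iff)
qed

text \<open>Positive finite costs with codes of \<open>L\<close> bits lie between
  \<open>1 / 2 ^ L\<close> and \<open>2 ^ L\<close>. This range spans \<open>2 * L\<close>
  doublings, each of which takes at most \<open>N\<close> factors of
  \<open>1 + 1 / N\<close>.\<close>

lemma geometric_count:
  fixes N L j :: nat
  assumes N: "1 \<le> N" and j: "Suc N ^ j \<le> N ^ j * 2 ^ (2 * L)"
  shows "j \<le> 2 * N * L"
proof (rule ccontr)
  assume "\<not> ?thesis"
  then obtain r where r: "j = N * (2 * L) + Suc r" by (metis add_Suc_right less_imp_Suc_add mult.assoc mult.commute not_le)
  have "(2 * N ^ N) ^ (2 * L) \<le> (Suc N ^ N) ^ (2 * L)"
    by (rule power_mono[OF two_power_le_root[OF N]]) simp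
  then have 1: "2 ^ (2 * L) * N ^ (N * (2 * L)) \<le> Suc N ^ (N * (2 * L))"
    by (simp only: power_mult_distrib power_mult)
  have 2: "N ^ Suc r < Suc N ^ Suc r" by (rule power_strict_mono) auto
  have "N ^ j * 2 ^ (2 * L) = (2 ^ (2 * L) * N ^ (N * (2 * L))) * N ^ Suc r"
    unfolding r by (simp only: power_add) simp
  also have "\<dots> < (2 ^ (2 * L) * N ^ (N * (2 * L))) * Suc N ^ Suc r"
    using 2 N by (intro mult_strict_left_mono) auto
  also have "\<dots> \<le> Suc N ^ (N * (2 * L)) * Suc N ^ Suc r" using 1 by (rule mult_le_mono1)
  also have "\<dots> = Suc N ^ j" unfolding r by (simp only: power_add)
  finally show False using j by simp
qed

definition table_ok :: "ufp_cover \<Rightarrow> state \<Rightarrow> bool" where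
  "table_ok P s \<longleftrightarrow> (\<forall>e<s ''E'' 0. s ''O'' e < num_items P \<and> 0 < s ''A'' e \<and> s ''A'' e \<le> max_amount P \<and>
       cost_den P (s ''O'' e) (s ''A'' e) \<noteq> 0 \<and>
       s ''P'' e = cost_num P (s ''O'' e) (s ''A'' e) * cost_den P (s ''O'' e) 0
         - cost_num P (s ''O'' e) 0 * cost_den P (s ''O'' e) (s ''A'' e) \<and>
       s ''Q'' e = cost_den P (s ''O'' e) (s ''A'' e) * cost_den P (s ''O'' e) 0) \<and>
     s ''V'' 0 = (\<Prod>e<s ''E'' 0. s ''Q'' e)"

text \<open>The rounding guarantee with factor \<open>1 + 1 / N\<close>, cross-multiplied. Amount 0
  is left out because it is the base of all raises; \<open>H\<close> marks how far the table of item
  \<open>i\<close> has been built.\<close>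

definition refined :: "ufp_cover \<Rightarrow> nat \<Rightarrow> state \<Rightarrow> nat \<Rightarrow> nat \<Rightarrow> bool" where
  "refined P N s i H \<longleftrightarrow> (\<forall>x. 1 \<le> x \<and> x \<le> H \<and> cost_den P i x \<noteq> 0 \<longrightarrow>
     (\<exists>e<s ''E'' 0. s ''O'' e = i \<and> x \<le> s ''A'' e \<and>
        cost_num P i (s ''A'' e) * N * cost_den P i x
          \<le> Suc N * cost_num P i x * cost_den P i (s ''A'' e)))"

text \<open>An item gets at most \<open>2 * N * L + 2\<close> levels: geometric growth gives
  \<open>2 * N * L\<close>, one more is due to the first level, whose cost may be 0, and one to the
  level being added when the estimate is applied. \<open>W_prod\<close> leaves \<open>2 * L\<close>
  bits in the common denominator for each entry, and as much again for the numerator of one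
  price.\<close>

locale level_budget = bit_budget +
  fixes N L :: nat
  assumes valid: "valid_ufp_cover P" and N: "1 \<le> N"
    and num_L: "\<And>i x. i < num_items P \<Longrightarrow> x \<le> max_amount P \<Longrightarrow> cost_num P i x < 2 ^ L"
    and den_L: "\<And>i x. i < num_items P \<Longrightarrow> x \<le> max_amount P \<Longrightarrow> cost_den P i x < 2 ^ L"
    and W_levels: "Suc (num_items P * (2 * N * L + 2)) < 2 ^ W"
    and W_prod: "2 * L * Suc (num_items P * (2 * N * L + 2)) \<le> W"
begin

lemma cost_oracle_Some: "i < num_items P \<Longrightarrow> x \<le> max_amount P \<Longrightarrow>
    cost_oracle P i x = Some (cost_num P i x, cost_den P i x)"
  by (simp add: cost_oracle_def cost_num_def cost_den_def)

lemma L_le_W: "L \<le> W" "2 * L \<le> W"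
  using W_prod by auto

lemma code_W: "i < num_items P \<Longrightarrow> x \<le> max_amount P \<Longrightarrow> cost_num P i x < 2 ^ W"
  "i < num_items P \<Longrightarrow> x \<le> max_amount P \<Longrightarrow> cost_den P i x < 2 ^ W"
  using less_le_trans[OF num_L power_increasing[OF L_le_W(1)]]
    less_le_trans[OF den_L power_increasing[OF L_le_W(1)]] by auto

lemma prod_L: "(a::nat) < 2 ^ L \<Longrightarrow> b < 2 ^ L \<Longrightarrow> a * b < 2 ^ (2 * L)"
  by (simp add: mult_2 power_add mult_strict_mono')

lemma prod_W: "(a::nat) < 2 ^ L \<Longrightarrow> b < 2 ^ L \<Longrightarrow> a * b < 2 ^ W"
  using prod_L power_increasing[OF L_le_W(2), of "2::nat"] by (fastforce intro: less_le_trans)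

lemma cost_mono:
  assumes i: "i < num_items P" and xy: "x \<le> y" "y \<le> max_amount P" and y: "cost_den P i y \<noteq> 0"
  shows "cost_den P i x \<noteq> 0 \<and> cost_num P i x * cost_den P i y \<le> cost_num P i y * cost_den P i x"
proof -
  have mo: "mono_on {..max_amount P} (\<lambda>x. cost_value (cost_fun P i x))"
    using valid i unfolding valid_ufp_cover_def by blast
  have le: "cost_value (cost_fun P i x) \<le> cost_value (cost_fun P i y)"
    by (rule mono_onD[OF mo]) (use xy in auto)
  note cv = cost_value_code[OF valid i]
  have x: "cost_den P i x \<noteq> 0"
    using le y xy cv[of x] cv[of y] by (auto simp: top_unique split: if_splits)
  have "real (cost_num P i x) / real (cost_den P i x) \<le> real (cost_num P i y) / real (cost_den P i y)"
    using le x y xy cv[of x] cv[of y] by (simp add: ennreal_le_iff)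
  then have "real (cost_num P i x * cost_den P i y) \<le> real (cost_num P i y * cost_den P i x)"
    using x y by (simp add: field_simps)
  then show ?thesis using x unfolding of_nat_le_iff by blast
qed

text \<open>The test stays true at \<open>lo\<close> and false just above \<open>hi\<close>, unless
  \<open>hi\<close> is the maximal amount, so a boundary remains when they meet. Monotonicity of the
  costs later turns this boundary into a guarantee for the amounts skipped below it.\<close>

lemma runs_bisect:
  fixes s :: state
  defines "i \<equiv> s ''i'' 0" and "u \<equiv> s ''u'' 0" and "v \<equiv> s ''v'' 0"
  assumes i: "i < num_items P" and lo: "s ''lo'' 0 \<le> s ''hi'' 0" and hi: "s ''hi'' 0 = max_amount P"
    and init: "cost_num P i (s ''lo'' 0) * N * v \<le> Suc N * u * cost_den P i (s ''lo'' 0)"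
    and R: "Suc (bit_length (max_amount P)) \<le> R"
  shows "runsP (bisect_prog N) R s (\<lambda>s'. agree_off {''lo'', ''hi'', ''mid'', ''q''} s s' \<and>
     s ''lo'' 0 \<le> s' ''lo'' 0 \<and> s' ''lo'' 0 \<le> max_amount P \<and>
     cost_num P i (s' ''lo'' 0) * N * v \<le> Suc N * u * cost_den P i (s' ''lo'' 0) \<and>
     (s' ''lo'' 0 < max_amount P \<longrightarrow>
        Suc N * u * cost_den P i (Suc (s' ''lo'' 0)) < cost_num P i (Suc (s' ''lo'' 0)) * N * v))"
proof -
  let ?V = "{''lo'', ''hi'', ''mid'', ''q''}"
  let ?ok = "\<lambda>y. cost_num P i y * N * v \<le> Suc N * u * cost_den P i y"
  let ?I = "\<lambda>s'. agree_off ?V s s' \<and> s ''lo'' 0 \<le> s' ''lo'' 0 \<and> s' ''lo'' 0 \<le> s' ''hi'' 0 \<and>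
     s' ''hi'' 0 \<le> max_amount P \<and> ?ok (s' ''lo'' 0) \<and>
     (s' ''hi'' 0 < max_amount P \<longrightarrow> \<not> ?ok (Suc (s' ''hi'' 0)))"
  \<comment> \<open>Either half of the search interval is at most half as long, so the bit length of
    its length is a decreasing measure.\<close>
  have bl: "bit_length b < bit_length d" if "b \<le> d div 2" "0 < d" for b d
  proof -
    have "bit_length b \<le> bit_length (d div 2)" using that by (intro floorlog_mono)
    also have "\<dots> < bit_length d" using that by (subst (2) compute_floorlog) simp
    finally show ?thesis .
  qed
  have "runsP (bisect_prog N) (Suc (bit_length (max_amount P)) * 1) s (\<lambda>s'. agree_off ?V s s' \<and>
     s ''lo'' 0 \<le> s' ''lo'' 0 \<and> s' ''lo'' 0 \<le> max_amount P \<and> ?ok (s' ''lo'' 0) \<and>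
     (s' ''lo'' 0 < max_amount P \<longrightarrow> \<not> ?ok (Suc (s' ''lo'' 0))))"
    unfolding bisect_prog_def
  proof (rule runs_While[where I="?I" and \<mu>="\<lambda>s'. bit_length (s' ''hi'' 0 - s' ''lo'' 0)"])
    fix s1 assume I: "?I s1" and b: "bval (Less (var ''lo'') (var ''hi'')) s1"
    have eq: "\<And>a. a \<notin> ?V \<Longrightarrow> s1 a = s a" by (rule agree_offD[OF conjunct1[OF I]])
    have st: "s1 ''i'' 0 = i" "s1 ''u'' 0 = u" "s1 ''v'' 0 = v"
      unfolding i_def u_def v_def by (simp_all add: eq)
    define l r where "l = s1 ''lo'' 0" and "r = s1 ''hi'' 0"
    define md where "md = (l + r + 1) div 2"
    have lr: "l < r" using b unfolding l_def r_def by simp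
    have md: "l < md" "md \<le> r" using lr unfolding md_def by auto
    have rm: "r \<le> max_amount P" using I unfolding r_def by blast
    have md2: "s1 ''lo'' 0 \<le> md - Suc 0" "md - Suc 0 \<le> max_amount P" "Suc (md - Suc 0) = md"
      using md rm unfolding l_def by auto
    have w1: "bit_length (r - md) < bit_length (r - l)"
      by (rule bl) (use lr in \<open>auto simp: md_def\<close>)
    have w2: "bit_length (md - 1 - l) < bit_length (r - l)"
      by (rule bl) (use lr in \<open>auto simp: md_def\<close>)
    have mm: "aval (Div (Plus (Plus (var ''lo'') (var ''hi'')) (Const 1)) (Const 2)) s1 = md"
      unfolding md_def l_def r_def by simp
    show "runsP (Seq (setv ''mid'' (Div (Plus (Plus (var ''lo'') (var ''hi'')) (Const 1)) (Const 2)))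
     (Seq (Query ''q'' (var ''i'') (var ''mid''))
       (Cond (Less (Times (Times (Const (Suc N)) (var ''u'')) (Read ''q'' (Const 1)))
           (Times (Times (var ''q'') (Const N)) (var ''v'')))
         (setv ''hi'' (Minus (var ''mid'') (Const 1)))
         (setv ''lo'' (var ''mid''))))) 1 s1
       (\<lambda>s'. ?I s' \<and> bit_length (s' ''hi'' 0 - s' ''lo'' 0) < bit_length (s1 ''hi'' 0 - s1 ''lo'' 0))"
    proof (rule runs_Seq, rule runs_Assign)
      show "aval (Div (Plus (Plus (var ''lo'') (var ''hi'')) (Const 1)) (Const 2)) s1 < 2 ^ W"
        unfolding mm using md rm W_amount by simp
      let ?s2 = "store s1 ''mid'' 0 md"
      let ?s3 = "store (store ?s2 ''q'' 0 (cost_num P i md)) ''q'' 1 (cost_den P i md)"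
      have q: "aval (var ''i'') ?s2 = i" "aval (var ''mid'') ?s2 = md" by (simp_all add: store_apply st)
      have ag3: "agree_off ?V s ?s3" using conjunct1[OF I] by simp
      show "runsP (Seq (Query ''q'' (var ''i'') (var ''mid''))
       (Cond (Less (Times (Times (Const (Suc N)) (var ''u'')) (Read ''q'' (Const 1)))
           (Times (Times (var ''q'') (Const N)) (var ''v'')))
         (setv ''hi'' (Minus (var ''mid'') (Const 1)))
         (setv ''lo'' (var ''mid'')))) 1
         (store s1 ''mid'' (aval (Const 0) s1)
            (aval (Div (Plus (Plus (var ''lo'') (var ''hi'')) (Const 1)) (Const 2)) s1))
       (\<lambda>s'. ?I s' \<and> bit_length (s' ''hi'' 0 - s' ''lo'' 0) < bit_length (s1 ''hi'' 0 - s1 ''lo'' 0))"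
        unfolding mm aval.simps(1)
      proof (rule runs_Seq, rule runs_Query[where u="cost_num P i md" and v="cost_den P i md"])
        show "cost_oracle P (aval (var ''i'') ?s2) (aval (var ''mid'') ?s2)
           = Some (cost_num P i md, cost_den P i md)"
          unfolding q by (rule cost_oracle_Some) (use i md rm in auto)
        show "cost_num P i md < 2 ^ W" "cost_den P i md < 2 ^ W"
          using code_W[OF i] md rm by auto
        have c: "bval (Less (Times (Times (Const (Suc N)) (var ''u'')) (Read ''q'' (Const 1)))
           (Times (Times (var ''q'') (Const N)) (var ''v''))) ?s3 \<longleftrightarrow> \<not> ?ok md"
          by (simp add: store_apply st not_le)
        show "runsP (Cond (Less (Times (Times (Const (Suc N)) (var ''u'')) (Read ''q'' (Const 1)))
           (Times (Times (var ''q'') (Const N)) (var ''v'')))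
         (setv ''hi'' (Minus (var ''mid'') (Const 1)))
         (setv ''lo'' (var ''mid''))) 1 ?s3
           (\<lambda>s'. ?I s' \<and> bit_length (s' ''hi'' 0 - s' ''lo'' 0) < bit_length (s1 ''hi'' 0 - s1 ''lo'' 0))"
        proof (rule runs_Cond; unfold c; rule runs_Assign)
          assume "\<not> ?ok md"
          then show "?I (store ?s3 ''hi'' (aval (Const 0) ?s3) (aval (Minus (var ''mid'') (Const 1)) ?s3)) \<and>
             bit_length (store ?s3 ''hi'' (aval (Const 0) ?s3) (aval (Minus (var ''mid'') (Const 1)) ?s3) ''hi'' 0
              - store ?s3 ''hi'' (aval (Const 0) ?s3) (aval (Minus (var ''mid'') (Const 1)) ?s3) ''lo'' 0)
             < bit_length (s1 ''hi'' 0 - s1 ''lo'' 0)"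
            using I ag3 md rm w2 md2 unfolding l_def r_def by (simp add: store_apply)
        next
          assume "\<not> \<not> ?ok md"
          then show "?I (store ?s3 ''lo'' (aval (Const 0) ?s3) (aval (var ''mid'') ?s3)) \<and>
             bit_length (store ?s3 ''lo'' (aval (Const 0) ?s3) (aval (var ''mid'') ?s3) ''hi'' 0
              - store ?s3 ''lo'' (aval (Const 0) ?s3) (aval (var ''mid'') ?s3) ''lo'' 0)
             < bit_length (s1 ''hi'' 0 - s1 ''lo'' 0)"
            using I ag3 md rm w1 unfolding l_def r_def by (simp add: store_apply)
        qed simp_all
      qed
    qed
  next
    show "bit_length (s ''hi'' 0 - s ''lo'' 0) \<le> bit_length (max_amount P)"
      unfolding hi by (rule floorlog_mono) simp
  next
    fix s1 assume "?I s1" "\<not> bval (Less (var ''lo'') (var ''hi'')) s1"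
    then show "agree_off ?V s s1 \<and> s ''lo'' 0 \<le> s1 ''lo'' 0 \<and> s1 ''lo'' 0 \<le> max_amount P \<and>
      ?ok (s1 ''lo'' 0) \<and> (s1 ''lo'' 0 < max_amount P \<longrightarrow> \<not> ?ok (Suc (s1 ''lo'' 0)))"
      by auto
  qed (use lo hi init in simp_all)
  then show ?thesis by (rule runs_mono) (use R in \<open>simp_all add: not_le\<close>)
qed

lemma runs_add:
  fixes s :: state
  defines "i \<equiv> s ''i'' 0" and "l \<equiv> s ''lo'' 0" and "E \<equiv> s ''E'' 0"
  assumes i: "i < num_items P" and l: "0 < l" "l \<le> max_amount P" and fin: "cost_den P i l \<noteq> 0"
    and tab: "table_ok P s" and E: "E < num_items P * (2 * N * L + 2)"
    and V: "s ''V'' 0 \<le> 2 ^ (2 * L * E)"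
  shows "runsP add_prog R s
    (\<lambda>s'. agree_off {''q'', ''u'', ''v'', ''O'', ''A'', ''P'', ''Q'', ''V'', ''h'', ''E''} s s' \<and>
      s' ''h'' 0 = l \<and> s' ''E'' 0 = Suc E \<and> s' ''O'' = (s ''O'')(E := i) \<and> s' ''A'' = (s ''A'')(E := l) \<and>
      table_ok P s' \<and> s' ''V'' 0 \<le> 2 ^ (2 * L * Suc E))"
proof -
  let ?nl = "cost_num P i l" and ?dl = "cost_den P i l" and ?n0 = "cost_num P i 0" and ?d0 = "cost_den P i 0"
  have b: "?nl < 2 ^ L" "?dl < 2 ^ L" "?n0 < 2 ^ L" "?d0 < 2 ^ L"
    using num_L den_L i l by auto
  have bw: "?nl * ?d0 - ?n0 * ?dl < 2 ^ W" "?dl * ?d0 < 2 ^ W"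
    using prod_W[OF b(1,4)] prod_W[OF b(2,4)] by auto
  have "s ''V'' 0 * (?dl * ?d0) \<le> 2 ^ (2 * L * E) * (?dl * ?d0)" using V by (rule mult_le_mono1)
  also have "\<dots> < 2 ^ (2 * L * E) * 2 ^ (2 * L)"
    using prod_L[OF b(2,4)] by (rule mult_strict_left_mono) simp
  also have "\<dots> = 2 ^ (2 * L * Suc E)" by (simp add: power_add[symmetric] add.commute)
  finally have V': "s ''V'' 0 * (?dl * ?d0) < 2 ^ (2 * L * Suc E)" .
  also have "(2::nat) ^ (2 * L * Suc E) \<le> 2 ^ W"
  proof (rule power_increasing)
    have "2 * L * Suc E \<le> 2 * L * Suc (num_items P * (2 * N * L + 2))" using E by (intro mult_le_mono2) simp
    then show "2 * L * Suc E \<le> W" using W_prod by linarith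
  qed simp
  finally have VW: "s ''V'' 0 * (?dl * ?d0) < 2 ^ W" .
  have or: "cost_oracle P i l = Some (?nl, ?dl)" "cost_oracle P i 0 = Some (?n0, ?d0)"
    using cost_oracle_Some i l by auto
  have EW: "Suc E < 2 ^ W" using E W_levels by linarith
  let ?s = "store (store (store (store (store (store (store (store (store (store (store (store (store s
    ''q'' 0 ?nl) ''q'' 1 ?dl) ''u'' 0 ?nl) ''v'' 0 ?dl) ''q'' 0 ?n0) ''q'' 1 ?d0) ''O'' E i) ''A'' E l)
    ''P'' E (?nl * ?d0 - ?n0 * ?dl)) ''Q'' E (?dl * ?d0)) ''V'' 0 (s ''V'' 0 * (?dl * ?d0))) ''h'' 0 l)
    ''E'' 0 (Suc E)"
  have g: "?s ''E'' 0 = Suc E" "?s ''O'' = (s ''O'')(E := i)" "?s ''A'' = (s ''A'')(E := l)"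
    "?s ''P'' = (s ''P'')(E := ?nl * ?d0 - ?n0 * ?dl)" "?s ''Q'' = (s ''Q'')(E := ?dl * ?d0)"
    "?s ''V'' 0 = s ''V'' 0 * (?dl * ?d0)" "?s ''h'' 0 = l"
    by (simp_all add: store_apply)
  have pr: "(\<Prod>e<E. ((s ''Q'')(E := ?dl * ?d0)) e) = (\<Prod>e<E. s ''Q'' e)"
    by (rule prod.cong) auto
  have tab': "table_ok P ?s"
    using tab i l fin pr unfolding table_ok_def g E_def[symmetric] by (simp add: All_less_Suc mult.commute)
  show ?thesis
    unfolding add_prog_def
    apply (rule runs_Seq)
    apply (rule runs_Query_eq[where i="i" and x="l" and u="?nl" and v="?dl"])
    subgoal by (simp add: i_def)
    subgoal by (simp add: l_def)
    subgoal by (rule or(1))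
    subgoal using code_W(1)[OF i l(2)] .
    subgoal using code_W(2)[OF i l(2)] .
    apply (rule runs_Seq, rule runs_Assign_eq[where j=0 and v="?nl"])
    subgoal by simp
    subgoal by (simp add: store_apply)
    subgoal by simp
    apply (rule runs_Seq, rule runs_Assign_eq[where j=0 and v="?dl"])
    subgoal by simp
    subgoal by (simp add: store_apply)
    subgoal by simp
    apply (rule runs_Seq)
    apply (rule runs_Query_eq[where i="i" and x="0" and u="?n0" and v="?d0"])
    subgoal by (simp add: store_apply i_def)
    subgoal by simp
    subgoal by (rule or(2))
    subgoal using code_W(1)[OF i] by simp
    subgoal using code_W(2)[OF i] by simp
    apply (rule runs_Seq, rule runs_Assign_eq[where j="E" and v="i"])
    subgoal by (simp add: store_apply E_def)
    subgoal by (simp add: store_apply E_def i_def l_def)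
    subgoal by simp
    apply (rule runs_Seq, rule runs_Assign_eq[where j="E" and v="l"])
    subgoal by (simp add: store_apply E_def)
    subgoal by (simp add: store_apply E_def i_def l_def)
    subgoal by simp
    apply (rule runs_Seq, rule runs_Assign_eq[where j="E" and v="?nl * ?d0 - ?n0 * ?dl"])
    subgoal by (simp add: store_apply E_def)
    subgoal by (simp add: store_apply E_def i_def l_def)
    subgoal using bw(1) .
    apply (rule runs_Seq, rule runs_Assign_eq[where j="E" and v="?dl * ?d0"])
    subgoal by (simp add: store_apply E_def)
    subgoal by (simp add: store_apply E_def i_def l_def)
    subgoal using bw(2) .
    apply (rule runs_Seq, rule runs_Assign_eq[where j="0" and v="s ''V'' 0 * (?dl * ?d0)"])
    subgoal by (simp add: store_apply E_def)
    subgoal by (simp add: store_apply E_def i_def l_def)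
    subgoal using VW .
    apply (rule runs_Seq, rule runs_Assign_eq[where j="0" and v="l"])
    subgoal by (simp add: store_apply E_def)
    subgoal by (simp add: store_apply E_def i_def l_def)
    subgoal by simp
    apply (rule runs_Assign_eq[where j="0" and v="Suc E"])
    subgoal by (simp add: store_apply E_def)
    subgoal by (simp add: store_apply E_def i_def l_def)
    subgoal using EW .
    subgoal
      unfolding g(1-3,7) using tab' V' unfolding g(6) by simp
    done
qed

end

lemma cost_num_infinite: "cost_den P i x = 0 \<Longrightarrow> cost_num P i x \<noteq> 0"
proof (cases "cost_fun P i x")
  case (Some q)
  assume "cost_den P i x = 0"
  moreover have "0 < snd (quotient_of q)" by (rule quotient_of_denom_pos')
  ultimately show ?thesis using Some by (simp add: cost_den_def cost_code_def)
qed (simp add: cost_num_def cost_code_def)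

text \<open>\<open>u / v\<close> is the cost a new level is tested against, \<open>a / b\<close> the
  cost just beyond that level. The former may be 0 for the first level, but the latter is positive,
  hence more than \<open>1 / 2 ^ L\<close>. From then on every level contributes a factor
  \<open>1 + 1 / N\<close>.\<close>

lemma growth_chain:
  fixes u v a b :: nat
  assumes far: "Suc N * u * b < a * N * v" and b: "b < 2 ^ L"
    and prev: "1 \<le> c \<Longrightarrow> Suc N ^ (c - 1) * v \<le> N ^ (c - 1) * 2 ^ L * u"
  shows "Suc N ^ c * b \<le> N ^ c * 2 ^ L * a"
proof (cases c)
  case 0
  have "1 \<le> a" using far by (cases a) auto
  then have "2 ^ L * 1 \<le> 2 ^ L * a" by (rule mult_le_mono2)
  then have "b \<le> 2 ^ L * a" using b by linarith
  then show ?thesis using 0 by simp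
next
  case (Suc c')
  have v: "0 < v" using far by (cases v) auto
  have "(Suc N ^ c * b) * v = (Suc N * b) * (Suc N ^ c' * v)"
    unfolding Suc by (simp only: power_Suc ac_simps)
  also have "\<dots> \<le> (Suc N * b) * (N ^ c' * 2 ^ L * u)" using prev Suc by (intro mult_le_mono2) simp
  also have "\<dots> = (N ^ c' * 2 ^ L) * (Suc N * u * b)" by (simp only: ac_simps)
  also have "\<dots> \<le> (N ^ c' * 2 ^ L) * (a * N * v)" using far by (intro mult_le_mono2) simp
  also have "\<dots> = (N ^ c * 2 ^ L * a) * v" unfolding Suc by (simp add: ac_simps)
  finally show ?thesis using v by simp
qed

lemma refined_mono:
  assumes "refined P N s i H" "s' ''E'' 0 = Suc (s ''E'' 0)" "s' ''O'' = (s ''O'')(s ''E'' 0 := j)"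
    "s' ''A'' = (s ''A'')(s ''E'' 0 := l)"
  shows "refined P N s' i H"
  unfolding refined_def
proof (intro allI impI)
  fix x assume "1 \<le> x \<and> x \<le> H \<and> cost_den P i x \<noteq> 0"
  then obtain e where "e < s ''E'' 0" "s ''O'' e = i" "x \<le> s ''A'' e"
    "cost_num P i (s ''A'' e) * N * cost_den P i x \<le> Suc N * cost_num P i x * cost_den P i (s ''A'' e)"
    using assms(1) unfolding refined_def by blast
  then show "\<exists>e<s' ''E'' 0. s' ''O'' e = i \<and> x \<le> s' ''A'' e \<and>
      cost_num P i (s' ''A'' e) * N * cost_den P i x \<le> Suc N * cost_num P i x * cost_den P i (s' ''A'' e)"
    unfolding assms(2-4) by (intro exI[of _ e]) auto
qed

lemma refined_cong:
  "refined P N s i H \<Longrightarrow> s' ''E'' = s ''E'' \<Longrightarrow> s' ''O'' = s ''O'' \<Longrightarrow> s' ''A'' = s ''A'' \<Longrightarrow>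
    refined P N s' i H"
  unfolding refined_def by simp

lemma table_ok_cong:
  assumes "table_ok P s" "agree_off Z s s'" "Z \<inter> {''E'', ''O'', ''A'', ''P'', ''Q'', ''V''} = {}"
  shows "table_ok P s'"
proof -
  have eq: "s' a = s a" if "a \<in> {''E'', ''O'', ''A'', ''P'', ''Q'', ''V''}" for a
    by (rule agree_offD[OF assms(2)]) (use that assms(3) in blast)
  show ?thesis using assms(1) unfolding table_ok_def by (simp add: eq)
qed

context level_budget
begin

abbreviation item_vars :: "string set" where
  "item_vars \<equiv> {''h'', ''go'', ''q'', ''u'', ''v'', ''lo'', ''hi'', ''mid'', ''O'', ''A'', ''P'', ''Q'', ''V'', ''E''}"

text \<open>\<open>s\<close> is the state before item \<open>i\<close> is treated, so
  \<open>E - s E\<close> counts its levels. The power inequality bounds the cost just beyond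
  \<open>h\<close> from below and is claimed only once the first level exists.\<close>

definition item_inv :: "state \<Rightarrow> nat \<Rightarrow> state \<Rightarrow> bool" where
  "item_inv s i s' \<longleftrightarrow> agree_off item_vars s s' \<and> table_ok P s' \<and> s' ''V'' 0 \<le> 2 ^ (2 * L * s' ''E'' 0) \<and>
     s' ''h'' 0 \<le> max_amount P \<and> s ''E'' 0 \<le> s' ''E'' 0 \<and> s' ''E'' 0 - s ''E'' 0 \<le> 2 * N * L + 2 \<and>
     (1 \<le> s' ''E'' 0 - s ''E'' 0 \<and> s' ''h'' 0 < max_amount P \<longrightarrow>
       Suc N ^ (s' ''E'' 0 - s ''E'' 0 - 1) * cost_den P i (Suc (s' ''h'' 0))
       \<le> N ^ (s' ''E'' 0 - s ''E'' 0 - 1) * 2 ^ L * cost_num P i (Suc (s' ''h'' 0))) \<and>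
     refined P N s' i (s' ''h'' 0) \<and> (\<forall>j<i. refined P N s' j (max_amount P)) \<and>
     (s' ''go'' 0 = 1 \<or> s' ''go'' 0 = 0 \<and>
       (s' ''h'' 0 = max_amount P \<or> cost_den P i (Suc (s' ''h'' 0)) = 0))"

lemma item_inv_stop:
  assumes I: "item_inv s i s1" and ag: "agree_off {''q'', ''go''} s1 s2" and go: "s2 ''go'' 0 = 0"
    and stop: "s1 ''h'' 0 = max_amount P \<or> cost_den P i (Suc (s1 ''h'' 0)) = 0"
  shows "item_inv s i s2"
proof -
  have eq: "s2 ''V'' = s1 ''V''" "s2 ''E'' = s1 ''E''" "s2 ''h'' = s1 ''h''" "s2 ''O'' = s1 ''O''"
    "s2 ''A'' = s1 ''A''"
    using agree_offD[OF ag] by simp_all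
  have 0: "agree_off item_vars s s1" "table_ok P s1" "refined P N s1 i (s1 ''h'' 0)"
    "\<And>j. j < i \<Longrightarrow> refined P N s1 j (max_amount P)"
    using I unfolding item_inv_def by blast+
  have 1: "agree_off item_vars s s2"
    by (rule agree_off_trans[OF 0(1) ag]) simp
  have 2: "table_ok P s2" by (rule table_ok_cong[OF 0(2) ag]) simp
  have 3: "refined P N s2 i (s1 ''h'' 0)" by (rule refined_cong[OF 0(3)]) (simp_all add: eq)
  have 4: "refined P N s2 j (max_amount P)" if "j < i" for j
    by (rule refined_cong[OF 0(4)[OF that]]) (simp_all add: eq)
  show ?thesis using I 1 2 3 4 go stop unfolding item_inv_def eq by blast
qed

lemma runs_item_body:
  assumes inp: "holds_input P s" and ii: "s ''i'' 0 = i" and i: "i < num_items P"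
    and E0: "s ''E'' 0 \<le> i * (2 * N * L + 2)"
    and I: "item_inv s i s1" and go: "s1 ''go'' 0 = 1"
  shows "runsP (item_body N) (Suc (bit_length (max_amount P))) s1
    (\<lambda>s'. item_inv s i s' \<and> s' ''go'' 0 + (2 * N * L + 2 - (s' ''E'' 0 - s ''E'' 0))
      < s1 ''go'' 0 + (2 * N * L + 2 - (s1 ''E'' 0 - s ''E'' 0)))"
proof -
  let ?R = "Suc (bit_length (max_amount P))" and ?M = "2 * N * L + 2"
  let ?\<mu> = "\<lambda>s'. s' ''go'' 0 + (?M - (s' ''E'' 0 - s ''E'' 0))"
  let ?Q = "\<lambda>s'. item_inv s i s' \<and> ?\<mu> s' < ?\<mu> s1"
  define h E where "h = s1 ''h'' 0" and "E = s1 ''E'' 0"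
  define c where "c = E - s ''E'' 0"
  have ag1: "agree_off item_vars s s1" and tab: "table_ok P s1" and V: "s1 ''V'' 0 \<le> 2 ^ (2 * L * E)"
    and hm: "h \<le> max_amount P" and cE: "E = s ''E'' 0 + c" and cM: "c \<le> ?M"
    and chain: "1 \<le> c \<Longrightarrow> h < max_amount P \<Longrightarrow>
       Suc N ^ (c - 1) * cost_den P i (Suc h) \<le> N ^ (c - 1) * 2 ^ L * cost_num P i (Suc h)"
    and ref: "refined P N s1 i h" "\<And>j. j < i \<Longrightarrow> refined P N s1 j (max_amount P)"
    using I unfolding item_inv_def h_def E_def c_def by auto
  have st: "s1 ''i'' 0 = i" "s1 ''m'' 0 = max_amount P"
    using ii inp agree_offD[OF ag1] unfolding holds_input_def by simp_all
  have stop: "?Q s2" if "agree_off {''q'', ''go''} s1 s2" "s2 ''go'' 0 = 0"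
      "h = max_amount P \<or> cost_den P i (Suc h) = 0" for s2
  proof -
    have "s2 ''E'' = s1 ''E''" using agree_offD[OF that(1)] by simp
    then show ?thesis using item_inv_stop[OF I that(1,2)] that go unfolding h_def by simp
  qed
  show ?thesis
    unfolding item_body_def
  proof (rule runs_Cond)
    assume "\<not> bval (Less (var ''h'') (var ''m'')) s1"
    then have "h = max_amount P" using hm st unfolding h_def by simp
    then show "runsP (setv ''go'' (Const 0)) ?R s1 ?Q"
      by (intro runs_Assign stop) (simp_all add: store_apply)
  next
    assume "bval (Less (var ''h'') (var ''m'')) s1"
    then have lt: "h < max_amount P" using st unfolding h_def by simp
    define u v where "u = cost_num P i (Suc h)" and "v = cost_den P i (Suc h)"
    let ?s2 = "store (store s1 ''q'' 0 u) ''q'' 1 v"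
    have uv: "u < 2 ^ W" "v < 2 ^ W" "u < 2 ^ L"
      using code_W[OF i, of "Suc h"] num_L[OF i, of "Suc h"] lt unfolding u_def v_def by auto
    show "runsP (Seq (Query ''q'' (var ''i'') (Plus (var ''h'') (Const 1)))
       (Cond (Equal (Read ''q'' (Const 1)) (Const 0)) (setv ''go'' (Const 0))
         (Seq (setv ''u'' (var ''q'')) (Seq (setv ''v'' (Read ''q'' (Const 1)))
         (Seq (setv ''lo'' (Plus (var ''h'') (Const 1))) (Seq (setv ''hi'' (var ''m''))
         (Seq (bisect_prog N) add_prog))))))) ?R s1 ?Q"
    proof (rule runs_Seq, rule runs_Query_eq[where i=i and x="Suc h" and u=u and v=v])
      show "cost_oracle P i (Suc h) = Some (u, v)"
        unfolding u_def v_def by (rule cost_oracle_Some[OF i]) (use lt in simp)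
      show "runsP (Cond (Equal (Read ''q'' (Const 1)) (Const 0)) (setv ''go'' (Const 0))
         (Seq (setv ''u'' (var ''q'')) (Seq (setv ''v'' (Read ''q'' (Const 1)))
         (Seq (setv ''lo'' (Plus (var ''h'') (Const 1))) (Seq (setv ''hi'' (var ''m''))
         (Seq (bisect_prog N) add_prog)))))) ?R ?s2 ?Q"
      proof (rule runs_Cond)
        assume "bval (Equal (Read ''q'' (Const 1)) (Const 0)) ?s2"
        then have "cost_den P i (Suc h) = 0" unfolding v_def by (simp add: store_apply)
        then show "runsP (setv ''go'' (Const 0)) ?R ?s2 ?Q"
          by (intro runs_Assign stop) (use W_pos in \<open>simp_all add: store_apply\<close>)
      next
        assume "\<not> bval (Equal (Read ''q'' (Const 1)) (Const 0)) ?s2"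
        then have v0: "0 < v" by (simp add: store_apply)
        \<comment> \<open>The next amount has finite cost, so its denominator is at least 1 while
          its numerator is below \<open>2 ^ L\<close>; the lower bound on its cost then limits the
          number of levels so far.\<close>
        have c1: "c \<le> 2 * N * L + 1"
        proof (cases c)
          case (Suc c')
          have "Suc N ^ c' * 1 \<le> Suc N ^ c' * v" using v0 by (intro mult_le_mono2) simp
          also have "\<dots> \<le> N ^ c' * 2 ^ L * u" using chain lt Suc unfolding u_def v_def by simp
          also have "\<dots> \<le> N ^ c' * 2 ^ L * 2 ^ L" using uv by (intro mult_le_mono2) simp
          also have "\<dots> = N ^ c' * 2 ^ (2 * L)" by (simp add: mult_2 power_add)
          finally show ?thesis using geometric_count[OF N] Suc by simp
        qed simp
        have "Suc i * ?M \<le> num_items P * ?M" using i by (intro mult_le_mono1) simp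
        then have EM: "E < num_items P * ?M" using E0 c1 unfolding cE by simp
        let ?s6 = "store (store (store (store ?s2 ''u'' 0 u) ''v'' 0 v) ''lo'' 0 (Suc h)) ''hi'' 0 (max_amount P)"
        have s6: "?s6 ''i'' 0 = i" "?s6 ''lo'' 0 = Suc h" "?s6 ''hi'' 0 = max_amount P" "?s6 ''u'' 0 = u"
          "?s6 ''v'' 0 = v" by (simp_all add: store_apply st)
        have ag6: "agree_off {''q'', ''u'', ''v'', ''lo'', ''hi''} s1 ?s6" by simp
        show "runsP (Seq (setv ''u'' (var ''q'')) (Seq (setv ''v'' (Read ''q'' (Const 1)))
         (Seq (setv ''lo'' (Plus (var ''h'') (Const 1))) (Seq (setv ''hi'' (var ''m''))
         (Seq (bisect_prog N) add_prog))))) ?R ?s2 ?Q"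
        proof (rule runs_Seq, rule runs_Assign_eq[where j=0 and v=u],
            simp, simp add: store_apply, simp,
            rule runs_Seq, rule runs_Assign_eq[where j=0 and v=v],
            simp, simp add: store_apply, simp,
            rule runs_Seq, rule runs_Assign_eq[where j=0 and v="Suc h"],
            simp, simp add: store_apply h_def, use lt W_amount in simp,
            rule runs_Seq, rule runs_Assign_eq[where j=0 and v="max_amount P"],
            simp, simp add: store_apply st, simp,
            rule runs_Seq, rule runs_post[OF runs_bisect[of ?s6]])
          show "?s6 ''i'' 0 < num_items P" "?s6 ''lo'' 0 \<le> ?s6 ''hi'' 0" "?s6 ''hi'' 0 = max_amount P"
            using i lt unfolding s6 by auto
          show "cost_num P (?s6 ''i'' 0) (?s6 ''lo'' 0) * N * ?s6 ''v'' 0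
            \<le> Suc N * ?s6 ''u'' 0 * cost_den P (?s6 ''i'' 0) (?s6 ''lo'' 0)"
            unfolding s6 u_def[symmetric] v_def[symmetric] by simp
          fix s7
          assume A7: "agree_off {''lo'', ''hi'', ''mid'', ''q''} ?s6 s7 \<and>
             ?s6 ''lo'' 0 \<le> s7 ''lo'' 0 \<and> s7 ''lo'' 0 \<le> max_amount P \<and>
             cost_num P (?s6 ''i'' 0) (s7 ''lo'' 0) * N * ?s6 ''v'' 0
               \<le> Suc N * ?s6 ''u'' 0 * cost_den P (?s6 ''i'' 0) (s7 ''lo'' 0) \<and>
             (s7 ''lo'' 0 < max_amount P \<longrightarrow>
                Suc N * ?s6 ''u'' 0 * cost_den P (?s6 ''i'' 0) (Suc (s7 ''lo'' 0))
                < cost_num P (?s6 ''i'' 0) (Suc (s7 ''lo'' 0)) * N * ?s6 ''v'' 0)"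
          define l where "l = s7 ''lo'' 0"
          have l: "Suc h \<le> l" "l \<le> max_amount P" "cost_num P i l * N * v \<le> Suc N * u * cost_den P i l"
            "l < max_amount P \<Longrightarrow> Suc N * u * cost_den P i (Suc l) < cost_num P i (Suc l) * N * v"
            using A7 unfolding s6 l_def by blast+
          have ag7: "agree_off {''q'', ''u'', ''v'', ''lo'', ''hi'', ''mid''} s1 s7"
            by (rule agree_off_trans[OF ag6 conjunct1[OF A7]]) simp
          have eq7: "s7 ''i'' = s1 ''i''" "s7 ''E'' = s1 ''E''" "s7 ''V'' = s1 ''V''" "s7 ''O'' = s1 ''O''"
            "s7 ''A'' = s1 ''A''" "s7 ''go'' = s1 ''go''"
            using agree_offD[OF ag7] by simp_all
          \<comment> \<open>An infinite cost has a positive numerator, so with denominator 0 it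
            would violate the test that \<open>l\<close> has passed.\<close>
          have dl: "cost_den P i l \<noteq> 0"
          proof
            assume 0: "cost_den P i l = 0"
            then show False using l(3) cost_num_infinite[OF 0] N v0 by simp
          qed
          have tab7: "table_ok P s7" by (rule table_ok_cong[OF tab ag7]) simp
          have seven: "s7 ''i'' 0 = i" "s7 ''E'' 0 = E" using eq7 st unfolding E_def by simp_all
          show "runsP add_prog ?R s7 ?Q"
          proof (rule runs_post[OF runs_add[of s7]])
            fix s8
            assume "agree_off {''q'', ''u'', ''v'', ''O'', ''A'', ''P'', ''Q'', ''V'', ''h'', ''E''} s7 s8 \<and>
              s8 ''h'' 0 = s7 ''lo'' 0 \<and> s8 ''E'' 0 = Suc (s7 ''E'' 0) \<and>
              s8 ''O'' = (s7 ''O'')(s7 ''E'' 0 := s7 ''i'' 0) \<and> s8 ''A'' = (s7 ''A'')(s7 ''E'' 0 := s7 ''lo'' 0) \<and>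
              table_ok P s8 \<and> s8 ''V'' 0 \<le> 2 ^ (2 * L * Suc (s7 ''E'' 0))"
            then have ag8: "agree_off {''q'', ''u'', ''v'', ''O'', ''A'', ''P'', ''Q'', ''V'', ''h'', ''E''} s7 s8"
              and s8: "s8 ''h'' 0 = l" "s8 ''E'' 0 = Suc E" "s8 ''O'' = (s1 ''O'')(E := i)"
                "s8 ''A'' = (s1 ''A'')(E := l)"
              and tab8: "table_ok P s8" and V8: "s8 ''V'' 0 \<le> 2 ^ (2 * L * Suc E)"
              unfolding E_def l_def by (simp_all add: eq7 st)
            have "agree_off item_vars s s7" by (rule agree_off_trans[OF ag1 ag7]) simp
            from agree_off_trans[OF this ag8] have ag: "agree_off item_vars s s8" by simp
            have go8: "s8 ''go'' 0 = 1" using agree_offD[OF ag8, of "''go''"] eq7 go by simp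
            have ch: "Suc N ^ c * cost_den P i (Suc l) \<le> N ^ c * 2 ^ L * cost_num P i (Suc l)"
              if "l < max_amount P"
            proof (rule growth_chain[OF l(4)[OF that]])
              show "cost_den P i (Suc l) < 2 ^ L" by (rule den_L[OF i]) (use that in simp)
              show "Suc N ^ (c - 1) * v \<le> N ^ (c - 1) * 2 ^ L * u" if "1 \<le> c"
                unfolding u_def v_def by (rule chain[OF that lt])
            qed
            have rf: "refined P N s8 j (max_amount P)" if "j < i" for j
              by (rule refined_mono[OF ref(2)[OF that]]) (use s8 in \<open>auto simp: E_def\<close>)
            have rh: "refined P N s8 i h"
              by (rule refined_mono[OF ref(1)]) (use s8 in \<open>auto simp: E_def\<close>)
            have "refined P N s8 i l"
              unfolding refined_def
            proof (intro allI impI)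
              fix x assume x: "1 \<le> x \<and> x \<le> l \<and> cost_den P i x \<noteq> 0"
              show "\<exists>e<s8 ''E'' 0. s8 ''O'' e = i \<and> x \<le> s8 ''A'' e \<and>
                cost_num P i (s8 ''A'' e) * N * cost_den P i x
                  \<le> Suc N * cost_num P i x * cost_den P i (s8 ''A'' e)"
              proof (cases "x \<le> h")
                case True
                then show ?thesis using rh x unfolding refined_def by blast
              next
                case False
                \<comment> \<open>A skipped amount costs at least as much as \<open>Suc h\<close>,
                  and \<open>l\<close> was accepted against the cost of
                  \<open>Suc h\<close>.\<close>
                have mo: "u * cost_den P i x \<le> cost_num P i x * v"
                  using cost_mono[OF i, of "Suc h" x] False x l unfolding u_def v_def by auto
                have "(cost_num P i l * N * cost_den P i x) * v
                  = (cost_num P i l * N * v) * cost_den P i x" by simp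
                also have "\<dots> \<le> (Suc N * u * cost_den P i l) * cost_den P i x"
                  using l(3) by (rule mult_le_mono1)
                also have "\<dots> = (Suc N * cost_den P i l) * (u * cost_den P i x)" by (simp only: ac_simps)
                also have "\<dots> \<le> (Suc N * cost_den P i l) * (cost_num P i x * v)"
                  using mo by (rule mult_le_mono2)
                also have "\<dots> = (Suc N * cost_num P i x * cost_den P i l) * v" by (simp only: ac_simps)
                finally have "cost_num P i l * N * cost_den P i x \<le> Suc N * cost_num P i x * cost_den P i l"
                  using v0 by simp
                then show ?thesis unfolding s8 using x by (intro exI[of _ E]) simp
              qed
            qed
            moreover have "Suc E - s ''E'' 0 = Suc c" using cE by simp
            ultimately have "item_inv s i s8"
              unfolding item_inv_def s8(1,2) using ag tab8 V8 l(2) cE c1 ch rf go8 by simp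
            then show "?Q s8" using c1 cE go go8 s8(2) unfolding E_def[symmetric] by simp
          qed (use i l dl tab7 EM V in \<open>simp_all add: st eq7 l_def[symmetric] E_def[symmetric]\<close>)
        qed simp
      qed
    qed (use st uv in \<open>simp_all add: h_def\<close>)
  qed
qed

text \<open>By monotonicity all costs beyond the first infinite one are infinite, so no further
  amount requires a level.\<close>

lemma refined_complete:
  assumes i: "i < num_items P" and ref: "refined P N s i h"
    and stop: "h = max_amount P \<or> cost_den P i (Suc h) = 0"
  shows "refined P N s i (max_amount P)"
  unfolding refined_def
proof (intro allI impI)
  fix x assume x: "1 \<le> x \<and> x \<le> max_amount P \<and> cost_den P i x \<noteq> 0"
  have "x \<le> h"
  proof (rule ccontr)
    assume "\<not> x \<le> h"
    then show False using stop x cost_mono[OF i, of "Suc h" x] by auto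
  qed
  then show "\<exists>e<s ''E'' 0. s ''O'' e = i \<and> x \<le> s ''A'' e \<and>
      cost_num P i (s ''A'' e) * N * cost_den P i x \<le> Suc N * cost_num P i x * cost_den P i (s ''A'' e)"
    using ref x unfolding refined_def by blast
qed

lemma runs_item:
  assumes inp: "holds_input P s" and ii: "s ''i'' 0 = i" and i: "i < num_items P"
    and E0: "s ''E'' 0 \<le> i * (2 * N * L + 2)" and tab: "table_ok P s"
    and V: "s ''V'' 0 \<le> 2 ^ (2 * L * s ''E'' 0)"
    and ref: "\<And>j. j < i \<Longrightarrow> refined P N s j (max_amount P)"
    and R: "Suc (2 * N * L + 3) * Suc (bit_length (max_amount P)) \<le> R"
  shows "runsP (item_prog N) R s (\<lambda>s'. agree_off item_vars s s' \<and> table_ok P s' \<and>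
     s' ''V'' 0 \<le> 2 ^ (2 * L * s' ''E'' 0) \<and> s' ''E'' 0 \<le> Suc i * (2 * N * L + 2) \<and>
     (\<forall>j<Suc i. refined P N s' j (max_amount P)))"
proof -
  let ?M = "2 * N * L + 2"
  let ?Q = "\<lambda>s'. agree_off item_vars s s' \<and> table_ok P s' \<and>
     s' ''V'' 0 \<le> 2 ^ (2 * L * s' ''E'' 0) \<and> s' ''E'' 0 \<le> Suc i * ?M \<and>
     (\<forall>j<Suc i. refined P N s' j (max_amount P))"
  let ?s = "store (store s ''h'' 0 0) ''go'' 0 1"
  have tab': "table_ok P ?s" by (rule table_ok_cong[OF tab, of "{''h'', ''go''}"]) simp_all
  have ref': "refined P N ?s j (max_amount P)" if "j < i" for j
    by (rule refined_cong[OF ref[OF that]]) (simp_all add: store_apply)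
  have "refined P N ?s i 0" unfolding refined_def by simp
  then have I: "item_inv s i ?s"
    unfolding item_inv_def using tab' ref' V by (simp add: store_apply)
  have "runsP (While (Equal (var ''go'') (Const 1)) (item_body N))
      (Suc (2 * N * L + 3) * Suc (bit_length (max_amount P))) ?s ?Q"
  proof (rule runs_While[where I="item_inv s i" and
        \<mu>="\<lambda>s'. s' ''go'' 0 + (2 * N * L + 2 - (s' ''E'' 0 - s ''E'' 0))"])
    fix s1 assume "item_inv s i s1" "bval (Equal (var ''go'') (Const 1)) s1"
    then show "runsP (item_body N) (Suc (bit_length (max_amount P))) s1
      (\<lambda>s'. item_inv s i s' \<and> s' ''go'' 0 + (?M - (s' ''E'' 0 - s ''E'' 0))
        < s1 ''go'' 0 + (?M - (s1 ''E'' 0 - s ''E'' 0)))"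
      by (intro runs_item_body[OF inp ii i E0]) simp_all
  next
    fix s1 assume J: "item_inv s i s1" and n: "\<not> bval (Equal (var ''go'') (Const 1)) s1"
    then have st: "s1 ''h'' 0 = max_amount P \<or> cost_den P i (Suc (s1 ''h'' 0)) = 0"
      unfolding item_inv_def by simp
    have "refined P N s1 i (s1 ''h'' 0)" using J unfolding item_inv_def by blast
    then have "refined P N s1 i (max_amount P)" using refined_complete[OF i _ st] by blast
    moreover have "s1 ''E'' 0 \<le> Suc i * ?M"
    proof -
      have "s ''E'' 0 \<le> s1 ''E'' 0" "s1 ''E'' 0 - s ''E'' 0 \<le> ?M"
        using J unfolding item_inv_def by blast+
      then show ?thesis using E0 by simp
    qed
    ultimately show "?Q s1" using J unfolding item_inv_def All_less_Suc by blast
  qed (use I in \<open>simp_all add: store_apply\<close>)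
  then have "runsP (While (Equal (var ''go'') (Const 1)) (item_body N)) R ?s ?Q"
    by (rule runs_mono) (use R in simp_all)
  then show ?thesis unfolding item_prog_def
    by (intro runs_Seq runs_Assign) (use W_pos in simp_all)
qed

lemma runs_levels:
  assumes inp: "holds_input P s" and E0: "s ''E'' 0 = 0"
    and R: "Suc (num_items P) * (Suc (2 * N * L + 3) * Suc (bit_length (max_amount P))) \<le> R"
  shows "runsP (levels_prog N) R s (\<lambda>s'. agree_off (insert ''i'' item_vars) s s' \<and> table_ok P s' \<and>
     s' ''V'' 0 \<le> 2 ^ (2 * L * s' ''E'' 0) \<and> s' ''E'' 0 \<le> num_items P * (2 * N * L + 2) \<and>
     (\<forall>j<num_items P. refined P N s' j (max_amount P)))"
proof -
  let ?Z = "insert ''i'' item_vars"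
  let ?I = "\<lambda>j s'. agree_off ?Z s s' \<and> table_ok P s' \<and>
     s' ''V'' 0 \<le> 2 ^ (2 * L * s' ''E'' 0) \<and> s' ''E'' 0 \<le> j * (2 * N * L + 2) \<and>
     (\<forall>j'<j. refined P N s' j' (max_amount P))"
  let ?s = "store (store s ''V'' 0 1) ''i'' 0 0"
  have tab0: "table_ok P ?s" unfolding table_ok_def using E0 by (simp add: store_apply)
  have "runsP (count_up ''i'' (var ''n'') (item_prog N)) R ?s (?I (num_items P))"
  proof (rule runs_count_up[where I="?I" and a=0 and d="num_items P"])
    fix j s1 assume I: "?I j s1" and j: "s1 ''i'' 0 = j" "j < num_items P"
    have inp1: "holds_input P s1" by (rule holds_input_agree[OF inp conjunct1[OF I]]) simp
    show "runsP (item_prog N) (Suc (2 * N * L + 3) * Suc (bit_length (max_amount P))) s1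
       (\<lambda>s'. s' ''i'' 0 = j \<and> ?I (Suc j) (store s' ''i'' 0 (Suc j)))"
    proof (rule runs_post[OF runs_item[OF inp1 j]])
      fix s2
      assume A: "agree_off item_vars s1 s2 \<and> table_ok P s2 \<and>
       s2 ''V'' 0 \<le> 2 ^ (2 * L * s2 ''E'' 0) \<and> s2 ''E'' 0 \<le> Suc j * (2 * N * L + 2) \<and>
       (\<forall>j'<Suc j. refined P N s2 j' (max_amount P))"
      let ?s3 = "store s2 ''i'' 0 (Suc j)"
      have ag: "agree_off ?Z s s2"
        by (rule agree_off_trans[OF conjunct1[OF I] conjunct1[OF A]]) simp
      have tab2: "table_ok P s2" using A by blast
      have tab3: "table_ok P ?s3" by (rule table_ok_cong[OF tab2, of "{''i''}"]) simp_all
      have ref3: "refined P N ?s3 j' (max_amount P)" if "j' < Suc j" for j'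
        by (rule refined_cong[of P N s2]) (use A that in \<open>simp_all add: store_apply\<close>)
      have "s2 ''i'' 0 = j" using agree_offD[OF conjunct1[OF A], of "''i''"] j by simp
      moreover have "?s3 ''V'' 0 = s2 ''V'' 0" "?s3 ''E'' 0 = s2 ''E'' 0"
        by (simp_all add: store_apply)
      moreover have "agree_off ?Z s ?s3" using ag by simp
      ultimately show "s2 ''i'' 0 = j \<and> ?I (Suc j) ?s3"
        using A tab3 ref3 by presburger
    qed (use I in simp_all)
  next
    fix j s1 assume "?I j s1"
    then show "aval (var ''n'') s1 = num_items P"
      using inp agree_offD[of ?Z s s1 "''n''"] by (simp add: holds_input_def)
  qed (use tab0 E0 W_items R in \<open>simp_all add: store_apply\<close>)
  then show ?thesis unfolding levels_prog_def
    by (intro runs_Seq runs_Assign) (use W_pos in simp_all)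
qed

text \<open>A price has \<open>2 * L\<close> bits from its numerator and \<open>2 * L\<close> bits
  per entry from the common denominator. This exponent becomes the constant \<open>c\<close> of the
  growing phase.\<close>

lemma runs_scale:
  assumes tab: "table_ok P s" and V: "s ''V'' 0 \<le> 2 ^ (2 * L * s ''E'' 0)"
    and E: "s ''E'' 0 \<le> num_items P * (2 * N * L + 2)" and R: "Suc (s ''E'' 0) \<le> R"
  shows "runsP scale_prog R s (\<lambda>s'. agree_off {''C'', ''e''} s s' \<and>
     (\<forall>e<s ''E'' 0. s' ''C'' e = s ''P'' e * (s ''V'' 0 div s ''Q'' e) \<and>
        s' ''C'' e < 2 ^ (2 * L * Suc (s ''E'' 0))))"
proof -
  let ?Z = "{''C'', ''e''}"
  let ?I = "\<lambda>j s'. agree_off ?Z s s' \<and> (\<forall>e<j. s' ''C'' e = s ''P'' e * (s ''V'' 0 div s ''Q'' e))"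
  have small: "s ''P'' e * (s ''V'' 0 div s ''Q'' e) < 2 ^ (2 * L * Suc (s ''E'' 0))" if e: "e < s ''E'' 0" for e
  proof -
    have o: "s ''O'' e < num_items P" "s ''A'' e \<le> max_amount P" using tab e unfolding table_ok_def by auto
    have "s ''P'' e \<le> cost_num P (s ''O'' e) (s ''A'' e) * cost_den P (s ''O'' e) 0"
      using tab e unfolding table_ok_def by auto
    also have "\<dots> < 2 ^ (2 * L)" by (rule prod_L[OF num_L den_L]) (use o in auto)
    finally have 1: "s ''P'' e < 2 ^ (2 * L)" .
    have 2: "s ''V'' 0 div s ''Q'' e \<le> 2 ^ (2 * L * s ''E'' 0)" using V le_trans[OF div_le_dividend] by blast
    have "s ''P'' e * (s ''V'' 0 div s ''Q'' e) \<le> s ''P'' e * 2 ^ (2 * L * s ''E'' 0)"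
      using 2 by (rule mult_le_mono2)
    also have "\<dots> < 2 ^ (2 * L) * 2 ^ (2 * L * s ''E'' 0)" using 1 by simp
    also have "\<dots> = 2 ^ (2 * L * Suc (s ''E'' 0))" by (simp add: power_add)
    finally show ?thesis .
  qed
  have le: "(2::nat) ^ (2 * L * Suc (s ''E'' 0)) \<le> 2 ^ W"
  proof (rule power_increasing)
    have "2 * L * Suc (s ''E'' 0) \<le> 2 * L * Suc (num_items P * (2 * N * L + 2))"
      using E by (intro mult_le_mono2) simp
    then show "2 * L * Suc (s ''E'' 0) \<le> W" using W_prod by linarith
  qed simp
  have EW: "s ''E'' 0 < 2 ^ W" using E W_levels by linarith
  have "runsP (count_up ''e'' (var ''E'')
     (Assign ''C'' (var ''e'') (Times (Read ''P'' (var ''e'')) (Div (var ''V'') (Read ''Q'' (var ''e''))))))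
     R (store s ''e'' 0 0) (?I (s ''E'' 0))"
  proof (rule runs_count_up[where I="?I" and a=0 and d="s ''E'' 0" and R=1])
    fix j s1 assume I: "?I j s1" and j: "s1 ''e'' 0 = j" "j < s ''E'' 0"
    have eq: "s1 ''P'' = s ''P''" "s1 ''V'' = s ''V''" "s1 ''Q'' = s ''Q''"
      using agree_offD[OF conjunct1[OF I]] by simp_all
    show "runsP (Assign ''C'' (var ''e'') (Times (Read ''P'' (var ''e'')) (Div (var ''V'') (Read ''Q'' (var ''e'')))))
      1 s1 (\<lambda>s'. s' ''e'' 0 = j \<and> ?I (Suc j) (store s' ''e'' 0 (Suc j)))"
      by (rule runs_Assign_eq[where j=j and v="s ''P'' j * (s ''V'' 0 div s ''Q'' j)"])
        (use I j less_le_trans[OF small[OF j(2)] le] in \<open>simp_all add: eq store_apply All_less_Suc\<close>)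
  next
    fix j s1 assume "?I j s1"
    then show "aval (var ''E'') s1 = s ''E'' 0" using agree_offD[of ?Z s s1 "''E''"] by simp
  qed (use EW R in \<open>simp_all add: store_apply\<close>)
  then have "runsP (count_up ''e'' (var ''E'')
     (Assign ''C'' (var ''e'') (Times (Read ''P'' (var ''e'')) (Div (var ''V'') (Read ''Q'' (var ''e''))))))
     R (store s ''e'' 0 0) (\<lambda>s'. agree_off {''C'', ''e''} s s' \<and>
     (\<forall>e<s ''E'' 0. s' ''C'' e = s ''P'' e * (s ''V'' 0 div s ''Q'' e) \<and>
        s' ''C'' e < 2 ^ (2 * L * Suc (s ''E'' 0))))"
    by (rule runs_post) (use small in simp)
  then show ?thesis unfolding scale_prog_def
    by (intro runs_Seq runs_Assign) (use W_pos in simp_all)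
qed

end

section \<open>The complete algorithm\<close>

text \<open>Run only when every solution is known to have infinite cost. Maximal amounts are
  feasible because some solution exists.\<close>

definition fill_prog :: com where
  "fill_prog = Seq (setv ''i'' (Const 0)) (count_up ''i'' (var ''n'') (Assign ''x'' (var ''i'') (var ''m'')))"

definition ufp_prog :: "nat \<Rightarrow> com" where
  "ufp_prog N = Seq (levels_prog N) (Seq scale_prog (Seq grow_prog
     (Cond (Equal (var ''bad'') (Const 0)) prune_prog fill_prog)))"

definition real_cost :: "ufp_cover \<Rightarrow> nat \<Rightarrow> nat \<Rightarrow> real" where
  "real_cost P i x = real (cost_num P i x) / real (cost_den P i x)"

lemma solutions_iff:
  "x \<in> solutions P \<longleftrightarrow> (\<forall>i<num_items P. x i \<le> max_amount P) \<and> feasible P x"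
  unfolding solutions_def feasible_def load_def by auto

lemma total_cost_finite:
  assumes valid: "valid_ufp_cover P"
    and x: "\<And>i. i < num_items P \<Longrightarrow> x i \<le> max_amount P \<and> cost_den P i (x i) \<noteq> 0"
  shows "total_cost P x = ennreal (\<Sum>i<num_items P. real_cost P i (x i))"
proof -
  have "total_cost P x = (\<Sum>i<num_items P. ennreal (real_cost P i (x i)))"
    unfolding total_cost_def real_cost_def
    by (rule sum.cong) (use x cost_value_code[OF valid] in auto)
  also have "\<dots> = ennreal (\<Sum>i<num_items P. real_cost P i (x i))"
    by (rule sum_ennreal) (simp add: real_cost_def)
  finally show ?thesis .
qed

lemma total_cost_infinite:
  assumes valid: "valid_ufp_cover P"
    and i: "i < num_items P" "x i \<le> max_amount P" "cost_den P i (x i) = 0"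
  shows "total_cost P x = \<infinity>"
proof -
  have "cost_value (cost_fun P i (x i)) \<le> total_cost P x"
    unfolding total_cost_def by (rule member_le_sum) (use i in auto)
  then show ?thesis using cost_value_code[OF valid i(1,2)] i(3) by (simp add: top_unique)
qed

section \<open>From integral prices back to costs\<close>

context level_budget
begin

lemma levels_facts:
  assumes tab: "table_ok P s" and a: "a \<in> levels s i"
  shows "i < num_items P" "0 < a" "a \<le> max_amount P" "cost_den P i a \<noteq> 0" "cost_den P i 0 \<noteq> 0"
    "cost_den P i a * cost_den P i 0 dvd s ''V'' 0"
proof -
  obtain e where e: "e < s ''E'' 0" "s ''O'' e = i" "s ''A'' e = a" using a unfolding levels_def by auto
  show 1: "i < num_items P" "0 < a" "a \<le> max_amount P" "cost_den P i a \<noteq> 0"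
    using tab e unfolding table_ok_def by auto
  show "cost_den P i 0 \<noteq> 0" using cost_mono[OF 1(1) _ 1(3,4), of 0] by simp
  have "s ''Q'' e dvd (\<Prod>e<s ''E'' 0. s ''Q'' e)" by (rule dvd_prodI) (use e in auto)
  then show "cost_den P i a * cost_den P i 0 dvd s ''V'' 0" using tab e unfolding table_ok_def by auto
qed

text \<open>The cost increase over amount 0, brought to the common denominator \<open>V\<close>. For
  table levels the denominators divide \<open>V\<close>, so the integer division is exact.\<close>

definition scaled_price :: "nat \<Rightarrow> nat \<Rightarrow> nat \<Rightarrow> nat" where
  "scaled_price V i a = (cost_num P i a * cost_den P i 0 - cost_num P i 0 * cost_den P i a)
     * (V div (cost_den P i a * cost_den P i 0))"

lemma scaled_price_real:
  assumes tab: "table_ok P s" and a: "a \<in> levels s i"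
  shows "real (scaled_price (s ''V'' 0) i a) = real (s ''V'' 0) * (real_cost P i a - real_cost P i 0)"
proof -
  note f = levels_facts[OF tab a]
  have le: "cost_num P i 0 * cost_den P i a \<le> cost_num P i a * cost_den P i 0"
    using cost_mono[OF f(1) _ f(3,4), of 0] by simp
  have d: "real (s ''V'' 0 div (cost_den P i a * cost_den P i 0))
      = real (s ''V'' 0) / (real (cost_den P i a) * real (cost_den P i 0))"
    using real_of_nat_div[OF f(6)] by simp
  show ?thesis
    unfolding scaled_price_def real_cost_def of_nat_mult d of_nat_diff[OF le]
    using f(4,5) by (simp add: field_simps)
qed

lemma raise_cost_real:
  assumes tab: "table_ok P s" and z: "raises P (levels s) (\<lambda>_. 0) z"
  shows "real (raise_cost P (scaled_price (s ''V'' 0)) (\<lambda>_. 0) z)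
    = real (s ''V'' 0) * ((\<Sum>i<num_items P. real_cost P i (z i)) - (\<Sum>i<num_items P. real_cost P i 0))"
proof -
  have "real (raise_cost P (scaled_price (s ''V'' 0)) (\<lambda>_. 0) z)
      = (\<Sum>i<num_items P. real (if 0 < z i then scaled_price (s ''V'' 0) i (z i) else 0))"
    unfolding raise_cost_def by simp
  also have "\<dots> = (\<Sum>i<num_items P. real (s ''V'' 0) * (real_cost P i (z i) - real_cost P i 0))"
  proof (rule sum.cong)
    fix i assume "i \<in> {..<num_items P}"
    then have "z i = 0 \<or> 0 < z i \<and> z i \<in> levels s i" using z unfolding raises_def by auto
    then show "real (if 0 < z i then scaled_price (s ''V'' 0) i (z i) else 0)
        = real (s ''V'' 0) * (real_cost P i (z i) - real_cost P i 0)"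
      using scaled_price_real[OF tab] by auto
  qed simp
  finally show ?thesis by (simp add: sum_subtractf sum_distrib_left[symmetric])
qed

text \<open>Rounding every amount up to its level cannot decrease a load, so feasibility survives,
  and the factor arises item by item. Amounts 0 stay put.\<close>

lemma round_up:
  assumes tab: "table_ok P s" and ref: "\<And>i. i < num_items P \<Longrightarrow> refined P N s i (max_amount P)"
    and y: "y \<in> solutions P" "\<And>i. i < num_items P \<Longrightarrow> cost_den P i (y i) \<noteq> 0"
  obtains w where "raises P (levels s) (\<lambda>_. 0) w" "feasible P w"
    "\<And>i. i < num_items P \<Longrightarrow> real_cost P i (w i) \<le> (1 + 1 / real N) * real_cost P i (y i)"
proof -
  have ym: "y i \<le> max_amount P" if "i < num_items P" for i using y that by (auto simp: solutions_iff)
  have "\<exists>a. (a = 0 \<or> 0 < a \<and> a \<in> levels s i) \<and> y i \<le> a \<and>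
      real_cost P i a \<le> (1 + 1 / real N) * real_cost P i (y i)" if i: "i < num_items P" for i
  proof (cases "y i = 0")
    case True
    have "1 * real_cost P i 0 \<le> (1 + 1 / real N) * real_cost P i 0"
      by (rule mult_right_mono) (auto simp: real_cost_def)
    then show ?thesis using True by auto
  next
    case False
    then obtain e where e: "e < s ''E'' 0" "s ''O'' e = i" "y i \<le> s ''A'' e"
      and le: "cost_num P i (s ''A'' e) * N * cost_den P i (y i)
        \<le> Suc N * cost_num P i (y i) * cost_den P i (s ''A'' e)"
      using ref[OF i] ym[OF i] y(2)[OF i] unfolding refined_def by (metis One_nat_def Suc_leI not_gr_zero)
    have mem: "s ''A'' e \<in> levels s i" using e unfolding levels_def by auto
    have pos: "0 < real N" "0 < real (cost_den P i (y i))" "0 < real (cost_den P i (s ''A'' e))"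
      using N y(2)[OF i] levels_facts(4)[OF tab mem] by auto
    have "real (cost_num P i (s ''A'' e) * N * cost_den P i (y i))
        \<le> real (Suc N * cost_num P i (y i) * cost_den P i (s ''A'' e))"
      using le by (simp only: of_nat_le_iff)
    then have "real (cost_num P i (s ''A'' e)) * real N * real (cost_den P i (y i))
        \<le> (real N + 1) * real (cost_num P i (y i)) * real (cost_den P i (s ''A'' e))"
      by (simp add: algebra_simps)
    then have "real_cost P i (s ''A'' e) \<le> (1 + 1 / real N) * real_cost P i (y i)"
      using pos unfolding real_cost_def by (simp add: field_simps)
    then show ?thesis using mem e levels_facts(2)[OF tab mem] by blast
  qed
  then obtain w where w: "\<And>i. i < num_items P \<Longrightarrow> (w i = 0 \<or> 0 < w i \<and> w i \<in> levels s i) \<and> y i \<le> w i \<and>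
      real_cost P i (w i) \<le> (1 + 1 / real N) * real_cost P i (y i)" by metis
  show ?thesis
  proof
    show "raises P (levels s) (\<lambda>_. 0) w" using w unfolding raises_def by auto
    show "feasible P w" using y(1) w by (auto simp: solutions_iff intro: feasible_mono)
    show "real_cost P i (w i) \<le> (1 + 1 / real N) * real_cost P i (y i)" if "i < num_items P" for i
      using w[OF that] by blast
  qed
qed

lemma four_approx_total_cost:
  assumes tab: "table_ok P s" and ref: "\<And>i. i < num_items P \<Longrightarrow> refined P N s i (max_amount P)"
    and z: "four_approx P (levels s) (scaled_price (s ''V'' 0)) (\<lambda>_. 0) z" "\<And>i. i < num_items P \<Longrightarrow> z i \<le> max_amount P"
    and y: "y \<in> solutions P"
  shows "total_cost P z \<le> ennreal (4 * (1 + 1 / real N)) * total_cost P y"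
proof (cases "\<forall>i<num_items P. cost_den P i (y i) \<noteq> 0")
  case False
  then obtain i where "i < num_items P" "cost_den P i (y i) = 0" by blast
  then have "total_cost P y = \<infinity>"
    using y by (intro total_cost_infinite[OF valid]) (auto simp: solutions_iff)
  \<comment> \<open>In \<open>ennreal\<close> the product of 0 and infinity is 0, so the factor has
    to be nonzero for the right-hand side to be infinite.\<close>
  moreover have "ennreal (4 * (1 + 1 / real N)) \<noteq> 0"
  proof -
    have "0 < 4 * (1 + 1 / real N)" using N by (simp add: add_pos_nonneg)
    then show ?thesis by (simp add: ennreal_eq_0_iff not_le)
  qed
  ultimately show ?thesis by (simp add: ennreal_mult_top)
next
  case True
  let ?n = "num_items P"
  have ym: "y i \<le> max_amount P" if "i < ?n" for i using y that by (auto simp: solutions_iff)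
  obtain w where w: "raises P (levels s) (\<lambda>_. 0) w" "feasible P w"
    "\<And>i. i < ?n \<Longrightarrow> real_cost P i (w i) \<le> (1 + 1 / real N) * real_cost P i (y i)"
    using round_up[OF tab ref y] True by metis
  have rz: "raises P (levels s) (\<lambda>_. 0) z"
    and zw: "raise_cost P (scaled_price (s ''V'' 0)) (\<lambda>_. 0) z
      \<le> 4 * raise_cost P (scaled_price (s ''V'' 0)) (\<lambda>_. 0) w"
    using z(1) w unfolding four_approx_def by auto
  have den0: "cost_den P i 0 \<noteq> 0" if "i < ?n" for i
    using cost_mono[OF that _ ym[OF that]] True that by blast
  have dz: "cost_den P i (z i) \<noteq> 0" if "i < ?n" for i
    using rz that den0[OF that] levels_facts(4)[OF tab, of "z i" i] unfolding raises_def by metis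
  \<comment> \<open>Since \<open>y\<close> has finite cost, monotonicity makes all costs at 0
    finite, so no denominator in the product vanishes and \<open>V\<close> can be cancelled.\<close>
  have V: "0 < s ''V'' 0"
  proof -
    have "s ''Q'' e \<noteq> 0" if e: "e < s ''E'' 0" for e
      using tab e den0 unfolding table_ok_def by simp
    then have "(\<Prod>e<s ''E'' 0. s ''Q'' e) \<noteq> 0" by (simp add: prod_zero_iff)
    then show ?thesis using tab unfolding table_ok_def by simp
  qed
  let ?F = "\<lambda>x. \<Sum>i<?n. real_cost P i (x i)"
  have "real (s ''V'' 0) * (?F z - ?F (\<lambda>_. 0)) \<le> real (s ''V'' 0) * (4 * (?F w - ?F (\<lambda>_. 0)))"
  proof -
    have "real (raise_cost P (scaled_price (s ''V'' 0)) (\<lambda>_. 0) z)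
        \<le> real (4 * raise_cost P (scaled_price (s ''V'' 0)) (\<lambda>_. 0) w)"
      using zw by (simp only: of_nat_le_iff)
    then show ?thesis unfolding of_nat_mult raise_cost_real[OF tab rz] raise_cost_real[OF tab w(1)]
      by (simp add: algebra_simps)
  qed
  then have "?F z - ?F (\<lambda>_. 0) \<le> 4 * (?F w - ?F (\<lambda>_. 0))"
    using V by (simp only: mult_le_cancel_left_pos of_nat_0_less_iff)
  \<comment> \<open>Moving the costs at 0 to the right leaves \<open>-3\<close> times their sum,
    which may be dropped because it is not positive.\<close>
  moreover have "0 \<le> ?F (\<lambda>_. 0)" by (rule sum_nonneg) (simp add: real_cost_def)
  moreover have "?F w \<le> (1 + 1 / real N) * ?F y"
    unfolding sum_distrib_left by (rule sum_mono) (use w(3) in auto)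
  ultimately have "?F z \<le> 4 * (1 + 1 / real N) * ?F y" by (simp add: algebra_simps)
  then have "ennreal (?F z) \<le> ennreal (4 * (1 + 1 / real N) * ?F y)" by (rule ennreal_leI)
  also have "\<dots> = ennreal (4 * (1 + 1 / real N)) * ennreal (?F y)"
    by (rule ennreal_mult) (auto intro!: sum_nonneg simp: real_cost_def)
  finally show ?thesis
    using total_cost_finite[OF valid, of z] total_cost_finite[OF valid, of y] z(2) dz ym True by simp
qed

lemma runs_fill:
  assumes inp: "holds_input P s" and R: "Suc (num_items P) \<le> R"
  shows "runsP fill_prog R s (\<lambda>s'. \<forall>i<num_items P. s' ''x'' i = max_amount P)"
proof -
  let ?I = "\<lambda>j s'. agree_off {''x'', ''i''} s s' \<and> (\<forall>i<j. s' ''x'' i = max_amount P)"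
  have "runsP (count_up ''i'' (var ''n'') (Assign ''x'' (var ''i'') (var ''m''))) R (store s ''i'' 0 0)
      (\<lambda>s'. \<forall>i<num_items P. s' ''x'' i = max_amount P)"
  proof (rule runs_count_up[where I="?I" and a=0 and d="num_items P" and R=1])
    fix j s1 assume I: "?I j s1" and j: "s1 ''i'' 0 = j" "j < num_items P"
    have "s1 ''m'' 0 = max_amount P"
      using inp agree_offD[OF conjunct1[OF I], of "''m''"] unfolding holds_input_def by simp
    then show "runsP (Assign ''x'' (var ''i'') (var ''m'')) 1 s1
        (\<lambda>s'. s' ''i'' 0 = j \<and> ?I (Suc j) (store s' ''i'' 0 (Suc j)))"
      by (intro runs_Assign_eq[where j=j and v="max_amount P"])
        (use I j in \<open>simp_all add: store_apply All_less_Suc\<close>)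
  next
    fix j s1 assume "?I j s1"
    then show "aval (var ''n'') s1 = num_items P"
      using inp agree_offD[of "{''x'', ''i''}" s s1 "''n''"] unfolding holds_input_def by simp
  qed (use W_items R in \<open>simp_all add: store_apply\<close>)
  then show ?thesis unfolding fill_prog_def
    by (intro runs_Seq runs_Assign) (use W_pos in simp_all)
qed

text \<open>\<open>B\<close> bounds the number of table entries. The condition \<open>W\<close> is
  the price budget \<open>c + d * E\<close> of growing, with the initial exponent from scaling and
  \<open>E\<close> replaced by \<open>B\<close>.\<close>

lemma runs_ufp:
  fixes s :: state and d R :: nat
  defines "B \<equiv> num_items P * (2 * N * L + 2)"
  assumes inp: "holds_input P s" and zero: "s ''E'' 0 = 0" "s ''x'' = (\<lambda>_. 0)" "s ''K'' 0 = 0" "s ''bad'' 0 = 0"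
    and sol: "solutions P \<noteq> {}"
    and d: "\<And>t. t \<in> {1..horizon P} \<Longrightarrow> demand P t < 2 ^ d"
    and W: "2 * L * Suc B + d * B \<le> W"
    and R: "Suc (num_items P) * (Suc (2 * N * L + 3) * Suc (bit_length (max_amount P))) \<le> R"
      "Suc (Suc B) * (Suc (horizon P) * Suc (num_items P) + Suc B) \<le> R" "Suc (num_items P) \<le> R"
  shows "runsP (ufp_prog N) R s (\<lambda>s'. s' ''x'' \<in> solutions P \<and>
    (\<forall>y\<in>solutions P. total_cost P (s' ''x'') \<le> ennreal (4 * (1 + 1 / real N)) * total_cost P y))"
  unfolding ufp_prog_def
proof (rule runs_Seq, rule runs_post[OF runs_levels[OF inp zero(1) R(1)]])
  let ?Q = "\<lambda>s'. s' ''x'' \<in> solutions P \<and>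
    (\<forall>y\<in>solutions P. total_cost P (s' ''x'') \<le> ennreal (4 * (1 + 1 / real N)) * total_cost P y)"
  have RB: "Suc B \<le> R" "Suc B * (Suc (horizon P) * Suc (num_items P)) \<le> R"
  proof -
    have "Suc B \<le> Suc (Suc B) * (Suc (horizon P) * Suc (num_items P) + Suc B)" by simp
    then show "Suc B \<le> R" using R(2) by linarith
    have "Suc B * (Suc (horizon P) * Suc (num_items P))
        \<le> Suc (Suc B) * (Suc (horizon P) * Suc (num_items P) + Suc B)"
      by (rule mult_le_mono) auto
    then show "Suc B * (Suc (horizon P) * Suc (num_items P)) \<le> R" using R(2) by linarith
  qed
  fix s1
  assume A1: "agree_off (insert ''i'' item_vars) s s1 \<and> table_ok P s1 \<and>
     s1 ''V'' 0 \<le> 2 ^ (2 * L * s1 ''E'' 0) \<and> s1 ''E'' 0 \<le> num_items P * (2 * N * L + 2) \<and>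
     (\<forall>j<num_items P. refined P N s1 j (max_amount P))"
  have tab: "table_ok P s1" and V: "s1 ''V'' 0 \<le> 2 ^ (2 * L * s1 ''E'' 0)" and E: "s1 ''E'' 0 \<le> B"
    and ref: "\<And>j. j < num_items P \<Longrightarrow> refined P N s1 j (max_amount P)"
    using A1 unfolding B_def by blast+
  have inp1: "holds_input P s1" by (rule holds_input_agree[OF inp conjunct1[OF A1]]) simp
  have zero1: "s1 ''x'' = (\<lambda>_. 0)" "s1 ''K'' 0 = 0" "s1 ''bad'' 0 = 0"
    using zero agree_offD[OF conjunct1[OF A1]] by simp_all
  show "runsP (Seq scale_prog (Seq grow_prog
     (Cond (Equal (var ''bad'') (Const 0)) prune_prog fill_prog))) R s1 ?Q"
  proof (rule runs_Seq, rule runs_post[OF runs_scale[OF tab V]])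
    show "s1 ''E'' 0 \<le> num_items P * (2 * N * L + 2)" using E unfolding B_def .
    show "Suc (s1 ''E'' 0) \<le> R" using E RB(1) by linarith
    fix s2
    let ?g = "scaled_price (s1 ''V'' 0)"
    assume A2: "agree_off {''C'', ''e''} s1 s2 \<and>
       (\<forall>e<s1 ''E'' 0. s2 ''C'' e = s1 ''P'' e * (s1 ''V'' 0 div s1 ''Q'' e) \<and>
          s2 ''C'' e < 2 ^ (2 * L * Suc (s1 ''E'' 0)))"
    have eq2: "s2 ''E'' = s1 ''E''" "s2 ''O'' = s1 ''O''" "s2 ''A'' = s1 ''A''" "s2 ''x'' = s1 ''x''"
      "s2 ''K'' = s1 ''K''" "s2 ''bad'' = s1 ''bad''"
      using agree_offD[OF conjunct1[OF A2]] by simp_all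
    have inp2: "holds_input P s2" by (rule holds_input_agree[OF inp1 conjunct1[OF A2]]) simp
    have ok2: "entries_ok P s2" using tab unfolding entries_ok_def table_ok_def eq2 by blast
    have lev: "levels s2 = levels s1" unfolding levels_def eq2 ..
    have C2: "s2 ''C'' e = ?g (s2 ''O'' e) (s2 ''A'' e)" "s2 ''C'' e < 2 ^ (2 * L * Suc (s1 ''E'' 0))"
      if e: "e < s2 ''E'' 0" for e
    proof -
      have pq: "s1 ''P'' e = cost_num P (s1 ''O'' e) (s1 ''A'' e) * cost_den P (s1 ''O'' e) 0
          - cost_num P (s1 ''O'' e) 0 * cost_den P (s1 ''O'' e) (s1 ''A'' e)"
        "s1 ''Q'' e = cost_den P (s1 ''O'' e) (s1 ''A'' e) * cost_den P (s1 ''O'' e) 0"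
        using tab e unfolding table_ok_def eq2 by blast+
      have "s2 ''C'' e = s1 ''P'' e * (s1 ''V'' 0 div s1 ''Q'' e)" using A2 e unfolding eq2 by blast
      then show "s2 ''C'' e = ?g (s2 ''O'' e) (s2 ''A'' e)" unfolding eq2 scaled_price_def pq .
      show "s2 ''C'' e < 2 ^ (2 * L * Suc (s1 ''E'' 0))" using A2 e unfolding eq2 by blast
    qed
    have R2: "Suc (Suc (s2 ''E'' 0)) * (Suc (horizon P) * Suc (num_items P) + Suc (s2 ''E'' 0)) \<le> R"
      by (rule le_trans[OF mult_le_mono R(2)]) (use E in \<open>auto simp: eq2\<close>)
    have W2: "s2 ''E'' 0 < 2 ^ W" "2 * L * Suc (s1 ''E'' 0) + d * s2 ''E'' 0 \<le> W"
    proof -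
      show "s2 ''E'' 0 < 2 ^ W" using E W_levels unfolding eq2 B_def by linarith
      have "2 * L * Suc (s1 ''E'' 0) + d * s2 ''E'' 0 \<le> 2 * L * Suc B + d * B"
        unfolding eq2 by (intro add_mono mult_le_mono2) (use E in auto)
      then show "2 * L * Suc (s1 ''E'' 0) + d * s2 ''E'' 0 \<le> W" using W by linarith
    qed
    have zero2: "s2 ''x'' = (\<lambda>_. 0)" "s2 ''K'' 0 = 0" "s2 ''bad'' 0 = 0"
      using zero1 unfolding eq2 by auto
    show "runsP (Seq grow_prog (Cond (Equal (var ''bad'') (Const 0)) prune_prog fill_prog)) R s2 ?Q"
    proof (rule runs_Seq, rule runs_post[OF runs_grow[OF inp2 ok2 d W2 zero2 C2 R2]], assumption, assumption, assumption)
      fix s3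
      assume A3: "grow_inv s2 ?g (2 * L * Suc (s1 ''E'' 0)) d s3 \<and> s3 ''go'' 0 \<noteq> 1"
      then have ag3: "agree_off grow_vars s2 s3"
        and gr3: "growing P (levels s1) ?g (2 * L * Suc (s1 ''E'' 0)) d s3"
        and out: "s3 ''bad'' 0 = 0 \<and> feasible P (s3 ''x'') \<or> s3 ''bad'' 0 = 1 \<and> stuck P (levels s1) (s3 ''x'')"
        unfolding grow_inv_def lev by auto
      have inp3: "holds_input P s3" by (rule holds_input_agree[OF inp2 ag3]) simp
      have E3: "s3 ''E'' 0 = s1 ''E'' 0" using agree_offD[OF ag3] eq2 by simp
      show "runsP (Cond (Equal (var ''bad'') (Const 0)) prune_prog fill_prog) R s3 ?Q"
      proof (rule runs_Cond)
        assume "bval (Equal (var ''bad'') (Const 0)) s3"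
        then have feas: "feasible P (s3 ''x'')" using out by auto
        obtain h g where h: "growth P (levels s1) ?g h (s3 ''x'') g" "stack_is h s3"
          and x3: "\<And>i. i < num_items P \<Longrightarrow> s3 ''x'' i \<le> max_amount P" and K: "s3 ''K'' 0 \<le> s1 ''E'' 0"
          using gr3 E3 unfolding growing_def by auto
        have "Suc (s3 ''K'' 0) * (Suc (horizon P) * Suc (num_items P)) \<le> R"
          by (rule le_trans[OF mult_le_mono1 RB(2)]) (use K E in linarith)
        from runs_prune[OF inp3 h feas x3 this]
        show "runsP prune_prog R s3 ?Q"
        proof (rule runs_post)
          fix s4 assume A4: "four_approx P (levels s1) ?g (\<lambda>_. 0) (s4 ''x'') \<and>
            (\<forall>i<num_items P. s4 ''x'' i \<le> max_amount P)"
          then have "feasible P (s4 ''x'')" unfolding four_approx_def by blast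
          then show "?Q s4" using A4 four_approx_total_cost[OF tab ref, of "s4 ''x''"]
            by (auto simp: solutions_iff)
        qed
      next
        assume "\<not> bval (Equal (var ''bad'') (Const 0)) s3"
        then have st: "stuck P (levels s1) (s3 ''x'')" using out by auto
        obtain t0 where t0: "t0 \<in> {1..horizon P}" "load P (s3 ''x'') t0 < demand P t0"
          "\<And>i a. i < num_items P \<Longrightarrow> t0 \<in> {left_end P i..right_end P i} \<Longrightarrow> a \<in> levels s1 i \<Longrightarrow> a \<le> s3 ''x'' i"
          using st unfolding stuck_def by blast
        \<comment> \<open>A solution of finite cost could be rounded up to a feasible choice of
          levels, which the stuck time excludes.\<close>
        have inf: "total_cost P y = \<infinity>" if y: "y \<in> solutions P" for y
        proof -
          have "\<exists>i<num_items P. cost_den P i (y i) = 0"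
          proof (rule ccontr)
            assume "\<not> ?thesis"
            then obtain w where "raises P (levels s1) (\<lambda>_. 0) w" "feasible P w"
              using round_up[OF tab ref y] by metis
            then show False using stuck_no_finite_solution[OF t0] by blast
          qed
          then obtain i where i: "i < num_items P" "cost_den P i (y i) = 0" by blast
          show ?thesis
            by (rule total_cost_infinite[where x=y, OF valid i(1) _ i(2)]) (use y i in \<open>auto simp: solutions_iff\<close>)
        qed
        have pos: "ennreal (4 * (1 + 1 / real N)) \<noteq> 0"
        proof -
          have "0 < 4 * (1 + 1 / real N)" using N by (simp add: add_pos_nonneg)
          then show ?thesis by (simp add: ennreal_eq_0_iff not_le)
        qed
        obtain y where y: "y \<in> solutions P" using sol by blast
        show "runsP fill_prog R s3 ?Q"
        proof (rule runs_post[OF runs_fill[OF inp3 R(3)]])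
          fix s4 assume A4: "\<forall>i<num_items P. s4 ''x'' i = max_amount P"
          have "feasible P (s4 ''x'')"
            by (rule feasible_mono[of P y]) (use y A4 in \<open>auto simp: solutions_iff\<close>)
          then show "?Q s4" using A4 inf pos by (auto simp: solutions_iff ennreal_mult_top)
        qed
      qed
    qed
  qed
qed

end

section \<open>Polynomial running time\<close>

definition level_bound :: "nat \<Rightarrow> nat \<Rightarrow> nat" where
  "level_bound N z = z * (2 * N * z + 2)"

text \<open>A sum that dominates each requirement on the word length separately. The input size
  \<open>z\<close> replaces the number of items, the bit length \<open>L\<close> of cost codes and
  the bit length \<open>d\<close> of demands.\<close>

definition word_bound :: "nat \<Rightarrow> nat \<Rightarrow> nat" where
  "word_bound N z = 2 * z * Suc (level_bound N z) + z * level_bound N z + level_bound N z + 2 * z + 2"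

text \<open>The first summand is the table construction: items, times levels per item, times
  bisection rounds. The second is growing: commitments, times one scan plus one pass over the table;
  it also covers scaling and pruning.\<close>

definition round_bound :: "nat \<Rightarrow> nat \<Rightarrow> nat" where
  "round_bound N z = Suc z * (Suc (2 * N * z + 3) * Suc z)
     + Suc (Suc (level_bound N z)) * (Suc z * Suc z + Suc (level_bound N z))"

definition is_poly :: "(nat \<Rightarrow> nat) \<Rightarrow> bool" where
  "is_poly f \<longleftrightarrow> (\<exists>p :: nat poly. \<forall>z. f z = poly p z)"

lemma is_poly_const: "is_poly (\<lambda>z. c)"
  unfolding is_poly_def by (intro exI[of _ "[:c:]"]) simp

lemma is_poly_id: "is_poly (\<lambda>z. z)"
  unfolding is_poly_def by (intro exI[of _ "[:0, 1:]"]) simp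

lemma is_poly_add: "is_poly f \<Longrightarrow> is_poly g \<Longrightarrow> is_poly (\<lambda>z. f z + g z)"
  unfolding is_poly_def by (metis poly_add)

lemma is_poly_mult: "is_poly f \<Longrightarrow> is_poly g \<Longrightarrow> is_poly (\<lambda>z. f z * g z)"
  unfolding is_poly_def by (metis poly_mult)

lemma is_poly_Suc: "is_poly f \<Longrightarrow> is_poly (\<lambda>z. Suc (f z))"
  using is_poly_add[OF _ is_poly_const[of 1], of f] by simp

lemmas is_poly_intros = is_poly_Suc is_poly_add is_poly_mult is_poly_id is_poly_const

lemma is_poly_time: "is_poly (\<lambda>z. round_bound N z * (c * Suc (word_bound N z)))"
  unfolding round_bound_def word_bound_def level_bound_def by (intro is_poly_intros)

lemma input_size_bounds:
  fixes P :: ufp_cover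
  defines "z \<equiv> input_size P"
  shows "num_items P \<le> z" "horizon P \<le> z" "bit_length (max_amount P) \<le> z"
    "t \<in> {1..horizon P} \<Longrightarrow> demand P t < 2 ^ z"
    "i < num_items P \<Longrightarrow> x \<le> max_amount P \<Longrightarrow> cost_num P i x < 2 ^ z"
    "i < num_items P \<Longrightarrow> x \<le> max_amount P \<Longrightarrow> cost_den P i x < 2 ^ z"
proof -
  show "num_items P \<le> z" "horizon P \<le> z" "bit_length (max_amount P) \<le> z"
    unfolding z_def input_size_def by auto
  show "demand P t < 2 ^ z" if "t \<in> {1..horizon P}"
  proof -
    have "bit_length (demand P t) \<le> (\<Sum>t\<in>{1..horizon P}. bit_length (demand P t))"
      by (rule member_le_sum[OF that]) auto
    then have "bit_length (demand P t) \<le> z" unfolding z_def input_size_def by simp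
    then show ?thesis by (rule floorlog_leD) simp
  qed
  let ?S = "{code_length (cost_fun P i x) |i x. i < num_items P \<and> x \<le> max_amount P}"
  have "?S = (\<lambda>(i, x). code_length (cost_fun P i x)) ` ({..<num_items P} \<times> {..max_amount P})" by auto
  then have fin: "finite (insert 0 ?S)" by simp
  have len: "code_length (cost_fun P i x) \<le> z" if "i < num_items P" "x \<le> max_amount P"
  proof -
    have "code_length (cost_fun P i x) \<le> Max (insert 0 ?S)"
      by (rule Max_ge[OF fin]) (use that in blast)
    then show ?thesis unfolding z_def input_size_def by simp
  qed
  show "cost_num P i x < 2 ^ z" if "i < num_items P" "x \<le> max_amount P"
    unfolding cost_num_def by (rule floorlog_leD) (use len[OF that] in \<open>auto simp: code_length_def\<close>)
  show "cost_den P i x < 2 ^ z" if "i < num_items P" "x \<le> max_amount P"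
    unfolding cost_den_def by (rule floorlog_leD) (use len[OF that] in \<open>auto simp: code_length_def\<close>)
qed

lemma level_budget_input:
  assumes valid: "valid_ufp_cover P" and N: "1 \<le> N"
  shows "level_budget P (word_bound N (input_size P)) N (input_size P)"
proof -
  define z where "z = input_size P"
  define W where "W = word_bound N z"
  note b = input_size_bounds[where P=P, folded z_def]
  have m: "max_amount P < 2 ^ z" using b(3) by (rule floorlog_leD) simp
  have pw: "a < 2 ^ W" if "a < 2 ^ c" "c \<le> W" for a c :: nat
    using less_le_trans[OF that(1) power_increasing[OF that(2)]] by simp
  have n: "num_items P < 2 ^ z"
    using b(1) less_exp[of z] by linarith
  have B: "num_items P * (2 * N * z + 2) \<le> level_bound N z"
    unfolding level_bound_def using b(1) by (rule mult_le_mono1)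
  have W: "2 * z \<le> W" "z \<le> W" "z + 2 \<le> W" "Suc (level_bound N z) \<le> W" "1 \<le> W"
    "2 * z * Suc (level_bound N z) \<le> W"
    unfolding W_def word_bound_def by auto
  show ?thesis
    unfolding z_def[symmetric] W_def[symmetric]
  proof
    show "1 < (2::nat) ^ W" using W(5) by (metis One_nat_def Suc_le_eq one_less_numeral_iff one_less_power semiring_norm(76))
    have "num_items P * max_amount P < 2 ^ z * 2 ^ z" using n m by (intro mult_strict_mono') auto
    then show "num_items P * max_amount P < 2 ^ W" by (intro pw[OF _ W(1)]) (simp add: mult_2 power_add)
    show "num_items P < 2 ^ W" by (rule pw[OF n W(2)])
    have "Suc (horizon P) < 2 ^ (z + 2)" using b(2) less_exp[of "z + 2"] by linarith
    then show "Suc (horizon P) < 2 ^ W" by (rule pw[OF _ W(3)])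
    show "max_amount P < 2 ^ W" by (rule pw[OF m W(2)])
    have "Suc (num_items P * (2 * N * z + 2)) < 2 ^ Suc (level_bound N z)"
      using B less_exp[of "Suc (level_bound N z)"] by linarith
    then show "Suc (num_items P * (2 * N * z + 2)) < 2 ^ W" by (rule pw[OF _ W(4)])
    have "2 * z * Suc (num_items P * (2 * N * z + 2)) \<le> 2 * z * Suc (level_bound N z)"
      using B by (intro mult_le_mono2) simp
    then show "2 * z * Suc (num_items P * (2 * N * z + 2)) \<le> W" using W(6) by linarith
  qed (use valid N b in auto)
qed

lemma input_state_bounded:
  assumes valid: "valid_ufp_cover P" and N: "1 \<le> N"
  shows "bounded (word_bound N (input_size P)) (input_state P)"
proof -
  let ?W = "word_bound N (input_size P)"
  interpret level_budget P ?W N "input_size P" by (rule level_budget_input[OF assms])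
  have lr: "left_end P i \<le> Suc (horizon P)" "right_end P i \<le> Suc (horizon P)" if "i < num_items P" for i
    using valid that unfolding valid_ufp_cover_def by force+
  have D: "demand P t < 2 ^ ?W" if "t \<in> {1..horizon P}" for t
  proof -
    have "(2::nat) ^ input_size P \<le> 2 ^ ?W"
      by (rule power_increasing) (auto simp: word_bound_def)
    then show ?thesis using input_size_bounds(4)[OF that] by linarith
  qed
  show ?thesis
    unfolding bounded_def input_state_def
    using W_horizon W_items W_amount D lr by (auto intro: le_less_trans)
qed

lemma ufp_prog_exec:
  assumes valid: "valid_ufp_cover P" and sol: "solutions P \<noteq> {}" and N: "1 \<le> N"
  shows "\<exists>t s. exec (cost_oracle P) (ufp_prog N) (input_state P) t s \<and>
    t \<le> round_bound N (input_size P) * (com_coeff (ufp_prog N) * Suc (word_bound N (input_size P))) \<and>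
    output_of s \<in> solutions P \<and>
    (\<forall>y\<in>solutions P. total_cost P (output_of s) \<le> ennreal (4 * (1 + 1 / real N)) * total_cost P y)"
proof -
  define z where "z = input_size P"
  note b = input_size_bounds[where P=P, folded z_def]
  interpret level_budget P "word_bound N z" N z
    unfolding z_def by (rule level_budget_input[OF valid N])
  let ?B = "num_items P * (2 * N * z + 2)"
  have B: "?B \<le> level_bound N z"
    unfolding level_bound_def using b(1) by (rule mult_le_mono1)
  have "runsP (ufp_prog N) (round_bound N z) (input_state P) (\<lambda>s'. s' ''x'' \<in> solutions P \<and>
    (\<forall>y\<in>solutions P. total_cost P (s' ''x'') \<le> ennreal (4 * (1 + 1 / real N)) * total_cost P y))"
  proof (rule runs_ufp[where d=z])
    show "holds_input P (input_state P)" unfolding holds_input_def input_state_def by simp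
    show "input_state P ''E'' 0 = 0" "input_state P ''x'' = (\<lambda>_. 0)" "input_state P ''K'' 0 = 0"
      "input_state P ''bad'' 0 = 0" by (simp_all add: input_state_def)
    show "solutions P \<noteq> {}" by (rule sol)
    show "demand P t < 2 ^ z" if "t \<in> {1..horizon P}" for t using b(4)[OF that] .
    have "2 * z * Suc ?B + z * ?B \<le> 2 * z * Suc (level_bound N z) + z * level_bound N z"
      using B by (intro add_mono mult_le_mono2) auto
    then show "2 * z * Suc ?B + z * ?B \<le> word_bound N z" unfolding word_bound_def by linarith
    have "Suc (num_items P) * (Suc (2 * N * z + 3) * Suc (bit_length (max_amount P)))
        \<le> Suc z * (Suc (2 * N * z + 3) * Suc z)"
      using b by (intro mult_le_mono) auto
    then show "Suc (num_items P) * (Suc (2 * N * z + 3) * Suc (bit_length (max_amount P))) \<le> round_bound N z"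
      unfolding round_bound_def by linarith
    have "Suc (Suc ?B) * (Suc (horizon P) * Suc (num_items P) + Suc ?B)
        \<le> Suc (Suc (level_bound N z)) * (Suc z * Suc z + Suc (level_bound N z))"
      using b B by (intro mult_le_mono add_le_mono) auto
    then show "Suc (Suc ?B) * (Suc (horizon P) * Suc (num_items P) + Suc ?B) \<le> round_bound N z"
      unfolding round_bound_def by linarith
    have "Suc (num_items P) * 1 \<le> Suc z * (Suc (2 * N * z + 3) * Suc z)"
      using b by (intro mult_le_mono) auto
    then show "Suc (num_items P) \<le> round_bound N z"
      unfolding round_bound_def mult.right_neutral by (rule trans_le_add1)
  qed
  moreover have "bounded (word_bound N z) (input_state P)"
    unfolding z_def by (rule input_state_bounded[OF valid N])
  moreover have "1 \<le> round_bound N z" unfolding round_bound_def by simp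
  ultimately show ?thesis unfolding runs_def output_of_def z_def by blast
qed

theorem theorem5:
  fixes \<epsilon> :: real
  assumes "\<epsilon> > 0"
  shows "\<exists>c :: com. polynomial_time c \<and> approximation_algorithm (4 + \<epsilon>) c"
proof -
  \<comment> \<open>Rounding turns the factor 4 into \<open>4 + 4 / N\<close>, so \<open>N\<close>
    is chosen at least \<open>4 / \<epsilon>\<close>; \<open>Suc\<close> keeps it positive.\<close>
  define N where "N = Suc (nat \<lceil>4 / \<epsilon>\<rceil>)"
  have N: "1 \<le> N" unfolding N_def by simp
  have "4 / \<epsilon> \<le> real N" unfolding N_def by linarith
  then have "4 \<le> real N * \<epsilon>" using assms by (simp add: field_simps)
  then have ratio: "4 * (1 + 1 / real N) \<le> 4 + \<epsilon>" using N by (simp add: field_simps)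
  obtain p :: "nat poly" where
    p: "\<And>z. round_bound N z * (com_coeff (ufp_prog N) * Suc (word_bound N z)) = poly p z"
    using is_poly_time[of N "com_coeff (ufp_prog N)"] unfolding is_poly_def by blast
  have "polynomial_time (ufp_prog N)"
    unfolding polynomial_time_def using ufp_prog_exec[OF _ _ N] unfolding p by blast
  moreover have "approximation_algorithm (4 + \<epsilon>) (ufp_prog N)"
    unfolding approximation_algorithm_def
  proof (intro allI impI)
    fix P assume "valid_ufp_cover P \<and> solutions P \<noteq> {}"
    then obtain t s where run: "exec (cost_oracle P) (ufp_prog N) (input_state P) t s"
      and x: "output_of s \<in> solutions P"
      and le: "\<And>y. y \<in> solutions P \<Longrightarrow>
        total_cost P (output_of s) \<le> ennreal (4 * (1 + 1 / real N)) * total_cost P y"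
      using ufp_prog_exec[of P N] N by blast
    have pos: "0 < ennreal (4 + \<epsilon>)"
      using assms unfolding zero_less_iff_neq_zero ennreal_eq_0_iff by simp
    \<comment> \<open>Dividing by the positive finite factor makes the left side a lower bound for
      each single solution, so it passes to the infimum.\<close>
    have "total_cost P (output_of s) / ennreal (4 + \<epsilon>) \<le> optimum P"
      unfolding optimum_def
    proof (rule INF_greatest)
      fix y assume "y \<in> solutions P"
      from le[OF this] have "total_cost P (output_of s) \<le> ennreal (4 + \<epsilon>) * total_cost P y"
        by (rule order_trans) (intro mult_right_mono ennreal_leI ratio, simp)
      then show "total_cost P (output_of s) / ennreal (4 + \<epsilon>) \<le> total_cost P y"
        by (intro divide_le_posI_ennreal pos) (simp add: mult.commute)
    qed
    then have "ennreal (4 + \<epsilon>) * (total_cost P (output_of s) / ennreal (4 + \<epsilon>))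
        \<le> ennreal (4 + \<epsilon>) * optimum P"
      by (rule mult_left_mono) simp
    then have "total_cost P (output_of s) \<le> ennreal (4 + \<epsilon>) * optimum P"
      using pos by (simp add: ennreal_mult_divide_eq ennreal_times_divide mult.commute)
    then show "\<exists>t s. exec (cost_oracle P) (ufp_prog N) (input_state P) t s \<and>
        output_of s \<in> solutions P \<and> total_cost P (output_of s) \<le> ennreal (4 + \<epsilon>) * optimum P"
      using run x by blast
  qed
  ultimately show ?thesis by blast
qed

end
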